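(* For integers $n\ge 3$, $$C(n,n-3)=\begin{cases}(7n-15)\,2^{n-3}, & 3\le n\le 5,\\[2pt] \left(\tfrac12 n^2+\tfrac{11}{4}n-\tfrac{25}{4}\right)2^{n-3}, & n\ge 5.\end{cases}$$
   Context: A composition of a positive integer $n$ is a finite sequence $(a_1,\dots,a_m)$ of positive integers with $\sum a_i=n$. Let $V$ be an $n$-dimensional vector space over $\mathbb{C}$ with basis $e_1,\dots,e_n$. For compositions $\mathbf{a}=(a_1,\dots,a_m)$ and $\mathbf{b}=(b_1,\dots,b_t)$ of $n$, the seaweed algebra $\mathfrak{p}^{A}_n(\mathbf{a},\mathbf{b})$ is the subalgebra of $\mathfrak{sl}(n)$ consisting of traceless matrices preserving both flags $V_1\subset\cdots\subset V_m=V$, with $V_i=\mathrm{span}\{e_1,\dots,e_{a_1+\cdots+a_i}\}$, and $V=W_0\supset W_1\supset\cdots\supset W_t=\{0\}$, with $W_j=\mathrm{span}\{e_{b_1+\cdots+b_j+1},\dots,e_n\}$. The index of a finite-dimensional Lie algebra $\mathfrak{g}$ is $\min_{f\in\mathfrak{g}^*}\dim\ker B_f$, where $B_f(x,y)=f([x,y])$. For integers $n\ge1$ and $k$, $C(n,k)$ denotes the number of ordered pairs $(\mathbf{a},\mathbf{b})$ of compositions of $n$ such that $\mathfrak{p}^A_n(\mathbf{a},\mathbf{b})$ has index $k$. *)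

theory Defs
  imports Complex_Main "HOL-Library.Function_Algebras"
begin

text \<open>Conventions. An n x n complex matrix is a function M :: nat => nat => complex
  that vanishes outside {0..<n} x {0..<n}; the basis vector e_(k+1) of the paper
  corresponds to index k. Column vectors are functions nat => complex.
  Matrices form a complex vector space under pointwise addition (Function_Algebras)
  and the scalar multiplication mscale below.\<close>

type_synonym cmat = "nat \<Rightarrow> nat \<Rightarrow> complex"

definition mscale :: "complex \<Rightarrow> cmat \<Rightarrow> cmat" where
  "mscale c A = (\<lambda>i j. c * A i j)"

definition is_mat :: "nat \<Rightarrow> cmat \<Rightarrow> bool" where
  "is_mat n A \<longleftrightarrow> (\<forall>i j. (n \<le> i \<or> n \<le> j) \<longrightarrow> A i j = 0)"

definition mmul :: "nat \<Rightarrow> cmat \<Rightarrow> cmat \<Rightarrow> cmat" where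
  "mmul n A B = (\<lambda>i j. \<Sum>k<n. A i k * B k j)"

definition bracket :: "nat \<Rightarrow> cmat \<Rightarrow> cmat \<Rightarrow> cmat" where
  "bracket n A B = mmul n A B - mmul n B A"

definition mtrace :: "nat \<Rightarrow> cmat \<Rightarrow> complex" where
  "mtrace n A = (\<Sum>i<n. A i i)"

definition preserves :: "nat \<Rightarrow> cmat \<Rightarrow> nat set \<Rightarrow> bool" where
  "preserves n A S \<longleftrightarrow>
     (\<forall>v :: nat \<Rightarrow> complex. (\<forall>k. k \<notin> S \<longrightarrow> v k = 0) \<longrightarrow>
        (\<forall>r. r < n \<and> r \<notin> S \<longrightarrow> (\<Sum>c<n. A r c * v c) = 0))"

definition is_composition :: "nat \<Rightarrow> nat list \<Rightarrow> bool" where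
  "is_composition n a \<longleftrightarrow> (\<forall>x\<in>set a. 0 < x) \<and> sum_list a = n"

definition psum :: "nat list \<Rightarrow> nat \<Rightarrow> nat" where
  "psum a i = sum_list (take i a)"

definition seaweed :: "nat \<Rightarrow> nat list \<Rightarrow> nat list \<Rightarrow> cmat set" where
  "seaweed n a b = {A. is_mat n A \<and> mtrace n A = 0 \<and>
      (\<forall>i\<in>{1..length a}. preserves n A {0..<psum a i}) \<and>
      (\<forall>j\<in>{0..length b}. preserves n A {psum b j..<n})}"

definition lin_functional :: "cmat set \<Rightarrow> (cmat \<Rightarrow> complex) \<Rightarrow> bool" where
  "lin_functional g f \<longleftrightarrow>
     (\<forall>x\<in>g. \<forall>y\<in>g. f (x + y) = f x + f y) \<and>
     (\<forall>c. \<forall>x\<in>g. f (mscale c x) = c * f x)"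

definition kirillov_ker :: "nat \<Rightarrow> cmat set \<Rightarrow> (cmat \<Rightarrow> complex) \<Rightarrow> cmat set" where
  "kirillov_ker n g f = {x\<in>g. \<forall>y\<in>g. f (bracket n x y) = 0}"

definition lie_index :: "nat \<Rightarrow> cmat set \<Rightarrow> nat" where
  "lie_index n g = (LEAST k. \<exists>f. lin_functional g f \<and>
      vector_space.dim mscale (kirillov_ker n g f) = k)"

definition C :: "nat \<Rightarrow> int \<Rightarrow> nat" where
  "C n k = card {(a, b). is_composition n a \<and> is_composition n b \<and>
                         int (lie_index n (seaweed n a b)) = k}"

end

(*
  Index formula.  Write q for the algebra of all n x n matrices preserving the two flags of (a, b); it
  is cut out by a pattern of matrix positions, and its index exceeds that of its traceless part by one.
  If the first blocks have sizes p < q, the positions joining the first p indices to the next q - p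
  form an abelian ideal V.  A generic functional on V has an open orbit, and its stabilizer is V
  plus a copy of a smaller seaweed algebra, so the index does not change (Rais, Panyushev).  For an arbitrary
  functional the bound from below uses that the kernel dimension can jump only at finitely many
  points of a line.  If p = q, a full matrix algebra of index p splits off.  This computes
  n - index as an explicit recursive function "defect" of (a, b).

  Counting.  Every step of the recursion with first parts p < q adds at least min(p, q - p) to the
  defect, so for defect two only very few first parts are possible, and counting the pairs by
  their first parts gives a linear recursion for their number.
*)
theory Submission
  imports Defs "Jordan_Normal_Form.Schur_Decomposition"
begin

section \<open>Dimensions inside a finitely spanned subspace\<close>

text \<open>Index inequalities come from injections between kernels of the forms
  \<open>f (bracket n x y)\<close>. Only the full matrix block is counted directly: distinct
  diagonal weights bound its index from above, and after triangularizing a functional, the linear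
  conditions fall short of the unknowns by the size of the block. The delicate direction of the
  reduction is the bound from below. A functional with minimal kernel may be degenerate on the
  ideal, so it is first moved towards the standard functional, avoiding both the values of
  \<open>t\<close> where the kernel grows and those where its pairing matrix is singular, and then
  conjugated twice until it is standard on the ideal. In the count, equal first parts cancel, so
  each counting function satisfies \<open>F n = (\<Sum>p=1..n. F (n - p)) + g n\<close>. Consecutive
  instances give \<open>F (n + 1) = 2 * F n + g (n + 1) - g n\<close>, whence the powers of two with
  polynomial factors. The case distinction of the theorem comes from small sizes where the empty
  composition enters: it counts as 1, while \<open>2 ^ (n - 1)\<close> continued to
  \<open>n = 0\<close> would give 1/2.\<close>

context vector_space
begin

text \<open>\<open>dim\<close> is 0 for a space without finite basis, and the space of all
  \<open>cmat\<close> is infinite dimensional. Monotonicity therefore needs a finite set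
  \<open>F\<close> that spans the larger space; the dimension lemmas below carry one for this
  reason.\<close>

lemma independent_card_le_dim_span:
  assumes "finite F" "V \<subseteq> span F" "B \<subseteq> V" "independent B"
  shows "finite B" "card B \<le> dim V"
proof -
  obtain D where D: "B \<subseteq> D" "D \<subseteq> V" "independent D" "V \<subseteq> span D"
    using maximal_independent_subset_extend[OF assms(3,4)] by metis
  have fD: "finite D"
    using independent_span_bound[OF assms(1) D(3)] D(2) assms(2) by auto
  show "finite B" using fD D(1) finite_subset by blast
  show "card B \<le> dim V"
    using basis_card_eq_dim[OF D(2,4,3)] card_mono[OF fD D(1)] by simp
qed

lemma dim_mono_span:
  assumes "finite F" "V \<subseteq> span F" "W \<subseteq> V"
  shows "dim W \<le> dim V"
proof -
  obtain B where B: "B \<subseteq> W" "independent B" "W \<subseteq> span B" "card B = dim W"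
    using basis_exists by metis
  then show ?thesis using independent_card_le_dim_span[OF assms(1,2), of B] assms(3) by auto
qed

lemma finite_basis_exists:
  assumes "finite F" "V \<subseteq> span F"
  obtains B where "finite B" "B \<subseteq> V" "independent B" "V \<subseteq> span B" "card B = dim V"
  using basis_exists[of V] independent_card_le_dim_span(1)[OF assms] by metis

lemma independent_Un_disjoint:
  assumes U: "subspace U" and W: "subspace W" and UW: "U \<inter> W \<subseteq> {0}"
    and A: "A \<subseteq> U" "independent A" "finite A" and B: "B \<subseteq> W" "independent B" "finite B"
  shows "independent (A \<union> B)" "A \<inter> B = {}"
proof -
  show dis: "A \<inter> B = {}"
    using A B UW dependent_zero by auto
  show "independent (A \<union> B)"
  proof (rule independent_if_scalars_zero)
    show "finite (A \<union> B)" using A B by simp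
    fix u x assume s: "(\<Sum>x\<in>A \<union> B. u x *s x) = 0" and x: "x \<in> A \<union> B"
    have s': "(\<Sum>x\<in>A. u x *s x) + (\<Sum>x\<in>B. u x *s x) = 0"
      using s A B dis by (simp add: sum.union_disjoint)
    have a: "(\<Sum>x\<in>A. u x *s x) \<in> U"
      using A U by (auto intro!: subspace_sum subspace_scale)
    have b: "(\<Sum>x\<in>B. u x *s x) \<in> W"
      using B W by (auto intro!: subspace_sum subspace_scale)
    have "(\<Sum>x\<in>A. u x *s x) = - (\<Sum>x\<in>B. u x *s x)"
      using s' by (simp add: eq_neg_iff_add_eq_0)
    then have "(\<Sum>x\<in>A. u x *s x) \<in> U \<inter> W"
      using a b subspace_neg[OF W b] by simp
    then have "(\<Sum>x\<in>A. u x *s x) = 0" using UW by auto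
    moreover from this have "(\<Sum>x\<in>B. u x *s x) = 0" using s' by simp
    ultimately show "u x = 0" using x A B independentD[OF A(2) A(3)] independentD[OF B(2) B(3)] by blast
  qed
qed

lemma dim_add_le:
  assumes "finite F" "V \<subseteq> span F"
    and U: "subspace U" "U \<subseteq> V" and W: "subspace W" "W \<subseteq> V" and UW: "U \<inter> W \<subseteq> {0}"
  shows "dim U + dim W \<le> dim V"
proof -
  have UF: "U \<subseteq> span F" and WF: "W \<subseteq> span F" using assms by auto
  obtain A where A: "finite A" "A \<subseteq> U" "independent A" "U \<subseteq> span A" "card A = dim U"
    using finite_basis_exists[OF assms(1) UF] .
  obtain B where B: "finite B" "B \<subseteq> W" "independent B" "W \<subseteq> span B" "card B = dim W"
    using finite_basis_exists[OF assms(1) WF] .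
  note i = independent_Un_disjoint[OF U(1) W(1) UW A(2,3,1) B(2,3,1)]
  have "card (A \<union> B) \<le> dim V"
    by (rule independent_card_le_dim_span(2)[OF assms(1,2) _ i(1)]) (use A B U W in auto)
  then show ?thesis using i(2) A B by (simp add: card_Un_disjoint)
qed

lemma dim_le_add:
  assumes "finite F" "U \<subseteq> span F" "W \<subseteq> span F"
    and V: "\<And>v. v \<in> V \<Longrightarrow> \<exists>u\<in>U. \<exists>w\<in>W. v = u + w"
  shows "dim V \<le> dim U + dim W"
proof -
  obtain A where A: "finite A" "A \<subseteq> U" "independent A" "U \<subseteq> span A" "card A = dim U"
    using finite_basis_exists[OF assms(1,2)] .
  obtain B where B: "finite B" "B \<subseteq> W" "independent B" "W \<subseteq> span B" "card B = dim W"
    using finite_basis_exists[OF assms(1,3)] .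
  have "V \<subseteq> span (A \<union> B)"
    using V A(4) B(4) unfolding span_Un by blast
  then have "dim V \<le> card (A \<union> B)" using A B by (simp add: dim_le_card)
  also have "\<dots> \<le> card A + card B" by (rule card_Un_le)
  finally show ?thesis using A B by simp
qed

text \<open>One condition lowers the dimension by at most one: if \<open>l i u\<close> is nonzero,
  every \<open>x\<close> is a multiple of \<open>u\<close> plus an element on which
  \<open>l i\<close> vanishes.\<close>

lemma dim_common_kernel:
  assumes "finite F" "V \<subseteq> span F" and V: "subspace V" and "finite I"
    and add: "\<And>i x y. l i (x + y) = l i x + l i y" and scl: "\<And>i c x. l i (c *s x) = c * l i x"
  shows "dim V \<le> dim {x\<in>V. \<forall>i\<in>I. l i x = 0} + card I"
  using \<open>finite I\<close>
proof (induction I)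
  case empty
  then show ?case by simp
next
  case (insert i I)
  let ?K = "{x\<in>V. \<forall>i\<in>I. l i x = 0}"
  let ?L = "{x\<in>V. \<forall>j\<in>insert i I. l j x = 0}"
  have KF: "?K \<subseteq> span F" and LF: "?L \<subseteq> span F" using assms(2) by auto
  show ?case
  proof (cases "\<forall>x\<in>?K. l i x = 0")
    case True
    then have "?L = ?K" by auto
    then show ?thesis using insert by auto
  next
    case False
    then obtain u where u: "u \<in> ?K" "l i u \<noteq> 0" by blast
    obtain B where B: "finite B" "B \<subseteq> ?L" "independent B" "?L \<subseteq> span B" "card B = dim ?L"
      using finite_basis_exists[OF assms(1) LF] .
    have "?K \<subseteq> span (insert u B)"
    proof
      fix x assume x: "x \<in> ?K"
      let ?c = "l i x / l i u"
      have sub: "l j (a - b) = l j a - l j b" for j a b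
        using add[of j "a - b" b] by simp
      have "x - ?c *s u \<in> ?L"
        using x u V by (auto simp: sub scl subspace_diff subspace_scale)
      then have "x - ?c *s u \<in> span B" using B by blast
      then show "x \<in> span (insert u B)" unfolding span_insert by blast
    qed
    then have "dim ?K \<le> card (insert u B)" using B by (simp add: dim_le_card)
    also have "\<dots> \<le> Suc (card B)" by (simp add: B(1) card_insert_if)
    finally show ?thesis using insert B by auto
  qed
qed

end

text \<open>Injectivity is asked only on \<open>V\<close>, because maps such as \<open>\<pi>\<close>
  and \<open>\<phi> z + \<nu> z\<close> below are injective on the kernels in question but not on
  all matrices.\<close>

lemma (in vector_space_pair) dim_le_of_inj_on:
  assumes T: "Vector_Spaces.linear s1 s2 T" and V: "vs1.subspace V" and inj: "inj_on T V"
    and "T ` V \<subseteq> W" "finite F" "W \<subseteq> vs2.span F"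
  shows "vs1.dim V \<le> vs2.dim W"
proof -
  obtain B where B: "B \<subseteq> V" "vs1.independent B" "V \<subseteq> vs1.span B" "card B = vs1.dim V"
    using vs1.basis_exists by metis
  have sB: "vs1.span B = V" by (rule vs1.span_subspace) (use B V in auto)
  have i: "vs2.independent (T ` B)"
    by (rule linear_independent_injective_image[OF T B(2)]) (simp add: sB inj)
  have "card (T ` B) \<le> vs2.dim W"
    by (rule vs2.independent_card_le_dim_span(2)[OF assms(5,6) _ i]) (use B assms in auto)
  moreover have "card (T ` B) = card B"
    by (rule card_image) (use inj B inj_on_subset in blast)
  ultimately show ?thesis using B by simp
qed

section \<open>Matrices supported on a pattern\<close>

interpretation mv: vector_space mscale
  by unfold_locales (auto simp: mscale_def fun_eq_iff algebra_simps)

interpretation mvp: vector_space_pair mscale mscale ..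

definition munit :: "nat \<Rightarrow> nat \<Rightarrow> cmat" where
  "munit i j = (\<lambda>k l. if k = i \<and> l = j then 1 else 0)"

definition pmat :: "(nat \<times> nat) set \<Rightarrow> cmat set" where
  "pmat P = {x. \<forall>i j. (i, j) \<notin> P \<longrightarrow> x i j = 0}"

lemma pmatD: "x \<in> pmat P \<Longrightarrow> (i, j) \<notin> P \<Longrightarrow> x i j = 0"
  by (auto simp: pmat_def)

lemma pmatI: "(\<And>i j. (i, j) \<notin> P \<Longrightarrow> x i j = 0) \<Longrightarrow> x \<in> pmat P"
  by (auto simp: pmat_def)

lemma munit_in_pmat: "(i, j) \<in> P \<Longrightarrow> munit i j \<in> pmat P"
  by (auto simp: pmat_def munit_def)

lemma pmat_mono: "P \<subseteq> Q \<Longrightarrow> pmat P \<subseteq> pmat Q"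
  by (auto simp: pmat_def)

lemma subspace_pmat: "mv.subspace (pmat P)"
  by (auto simp: mv.subspace_def pmat_def mscale_def)

lemma sum_cmat_apply: "(\<Sum>a\<in>I. (f a :: cmat)) i j = (\<Sum>a\<in>I. f a i j)"
  by (induction I rule: infinite_finite_induct) auto

lemma pmat_expand:
  assumes "finite P" "x \<in> pmat P"
  shows "x = (\<Sum>p\<in>P. mscale (x (fst p) (snd p)) (munit (fst p) (snd p)))"
proof (intro ext)
  fix i j
  have "(\<Sum>p\<in>P. mscale (x (fst p) (snd p)) (munit (fst p) (snd p))) i j
      = (\<Sum>p\<in>P. if p = (i, j) then x i j else 0)"
    unfolding sum_cmat_apply by (intro sum.cong) (auto simp: mscale_def munit_def)
  also have "\<dots> = x i j" using assms by (auto simp: pmat_def)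
  finally show "x i j = (\<Sum>p\<in>P. mscale (x (fst p) (snd p)) (munit (fst p) (snd p))) i j" by simp
qed

definition munits :: "(nat \<times> nat) set \<Rightarrow> cmat set" where
  "munits P = (\<lambda>p. munit (fst p) (snd p)) ` P"

lemma finite_munits: "finite P \<Longrightarrow> finite (munits P)"
  by (simp add: munits_def)

lemma pmat_span:
  assumes "finite P" shows "pmat P \<subseteq> mv.span (munits P)"
proof
  fix x assume "x \<in> pmat P"
  then have "x = (\<Sum>p\<in>P. mscale (x (fst p) (snd p)) (munit (fst p) (snd p)))"
    using assms pmat_expand by blast
  also have "\<dots> \<in> mv.span (munits P)"
    by (intro mv.span_sum mv.span_scale mv.span_base) (auto simp: munits_def)
  finally show "x \<in> mv.span (munits P)" .
qed

lemma dim_pmat: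
  assumes "finite P" shows "mv.dim (pmat P) = card P"
proof -
  have inj: "inj_on (\<lambda>p. munit (fst p) (snd p)) P"
  proof (rule inj_onI)
    fix p q assume "munit (fst p) (snd p) = munit (fst q) (snd q)"
    then have "munit (fst p) (snd p) (fst p) (snd p) = munit (fst q) (snd q) (fst p) (snd p)" by simp
    then show "p = q" by (auto simp: munit_def prod_eq_iff split: if_splits)
  qed
  have "mv.independent (munits P)"
  proof (rule mv.independent_if_scalars_zero)
    show "finite (munits P)" using assms by (simp add: munits_def)
    fix u x assume s: "(\<Sum>x\<in>munits P. mscale (u x) x) = 0" and x: "x \<in> munits P"
    obtain p where p: "p \<in> P" "x = munit (fst p) (snd p)" using x by (auto simp: munits_def)
    have "0 = (\<Sum>x\<in>munits P. mscale (u x) x) (fst p) (snd p)" using s by simp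
    also have "\<dots> = (\<Sum>q\<in>P. if q = p then u x else 0)"
      unfolding munits_def sum.reindex[OF inj] sum_cmat_apply o_def
      by (intro sum.cong) (auto simp: mscale_def munit_def p prod_eq_iff)
    also have "\<dots> = u x" using p assms by simp
    finally show "u x = 0" by simp
  qed
  moreover have "munits P \<subseteq> pmat P" by (auto simp: munits_def munit_in_pmat)
  ultimately have "mv.dim (pmat P) = card (munits P)"
    using mv.basis_card_eq_dim[OF _ pmat_span[OF assms]] by metis
  then show ?thesis using card_image[OF inj] by (simp add: munits_def)
qed

section \<open>Linear functionals and linear endomorphisms of the matrix space\<close>

abbreviation linf :: "(cmat \<Rightarrow> complex) \<Rightarrow> bool" where
  "linf f \<equiv> lin_functional UNIV f"

abbreviation mlinear :: "(cmat \<Rightarrow> cmat) \<Rightarrow> bool" where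
  "mlinear \<equiv> Vector_Spaces.linear mscale mscale"

lemma mlinearI:
  assumes "\<And>x y. T (x + y) = T x + T y" "\<And>c x. T (mscale c x) = mscale c (T x)"
  shows "mlinear T"
  using assms mv.vector_space_axioms by (auto simp: Vector_Spaces.linear_iff)

lemma linf_add: "linf f \<Longrightarrow> f (x + y) = f x + f y"
  and linf_scale: "linf f \<Longrightarrow> f (mscale c x) = c * f x"
  by (auto simp: lin_functional_def)

lemma linf_zero: "linf f \<Longrightarrow> f 0 = 0"
  using linf_scale[of f 0 0] by (simp add: mscale_def zero_fun_def)

lemma linf_diff: "linf f \<Longrightarrow> f (x - y) = f x - f y"
  using linf_add[of f "x - y" y] by simp

lemma linf_uminus: "linf f \<Longrightarrow> f (- x) = - f x"
  using linf_diff[of f 0 x] linf_zero[of f] by simp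

lemma linf_sum: "linf f \<Longrightarrow> f (sum g I) = (\<Sum>i\<in>I. f (g i))"
  by (induction I rule: infinite_finite_induct) (auto simp: linf_zero linf_add)

lemma linf_expand:
  assumes "linf f" "finite P" "x \<in> pmat P"
  shows "f x = (\<Sum>p\<in>P. x (fst p) (snd p) * f (munit (fst p) (snd p)))"
  using pmat_expand[OF assms(2,3)] assms(1)
  by (metis (mono_tags, lifting) linf_scale linf_sum sum.cong)

lemma linf_eq_on_pmat:
  assumes "linf f" "linf g" "finite P" "x \<in> pmat P" "\<And>i j. (i, j) \<in> P \<Longrightarrow> f (munit i j) = g (munit i j)"
  shows "f x = g x"
  using linf_expand[OF assms(1,3,4)] linf_expand[OF assms(2,3,4)] assms(5)
  by (metis (mono_tags, lifting) prod.collapse sum.cong)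

lemma linf_compose: "linf f \<Longrightarrow> mlinear T \<Longrightarrow> linf (\<lambda>x. f (T x))"
  by (auto simp: lin_functional_def Vector_Spaces.linear_iff)

lemma linf_plus: "linf f \<Longrightarrow> linf g \<Longrightarrow> linf (\<lambda>x. f x + g x)"
  by (auto simp: lin_functional_def algebra_simps)

lemma linf_times: "linf f \<Longrightarrow> linf (\<lambda>x. c * f x)"
  by (auto simp: lin_functional_def algebra_simps)

lemma linf_entry: "linf (\<lambda>x. x i j)"
  by (auto simp: lin_functional_def mscale_def)

lemma linf_Sum: "(\<And>i. i \<in> I \<Longrightarrow> linf (g i)) \<Longrightarrow> linf (\<lambda>x. \<Sum>i\<in>I. g i x)"
  by (auto simp: lin_functional_def sum.distrib sum_distrib_left)

section \<open>Matrix products and brackets\<close>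

lemma mmul_add_left: "mmul n (x + y) z = mmul n x z + mmul n y z"
  and mmul_add_right: "mmul n z (x + y) = mmul n z x + mmul n z y"
  and mmul_scale_left: "mmul n (mscale c x) z = mscale c (mmul n x z)"
  and mmul_scale_right: "mmul n z (mscale c x) = mscale c (mmul n z x)"
  by (auto simp: mmul_def mscale_def fun_eq_iff algebra_simps sum.distrib sum_distrib_left)

lemma mmul_diff_left: "mmul n (x - y) z = mmul n x z - mmul n y z"
  and mmul_diff_right: "mmul n z (x - y) = mmul n z x - mmul n z y"
  by (auto simp: mmul_def fun_eq_iff algebra_simps sum_subtractf)

lemma mmul_assoc: "mmul n (mmul n x y) z = mmul n x (mmul n y z)"
proof (intro ext)
  fix i j
  have "(\<Sum>k<n. (\<Sum>l<n. x i l * y l k) * z k j) = (\<Sum>k<n. \<Sum>l<n. x i l * y l k * z k j)"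
    by (simp add: sum_distrib_right)
  also have "\<dots> = (\<Sum>l<n. \<Sum>k<n. x i l * y l k * z k j)" by (rule sum.swap)
  also have "\<dots> = (\<Sum>l<n. x i l * (\<Sum>k<n. y l k * z k j))" by (simp add: sum_distrib_left mult.assoc)
  finally show "mmul n (mmul n x y) z i j = mmul n x (mmul n y z) i j" by (simp add: mmul_def)
qed

lemma bracket_add_left: "bracket n (x + y) z = bracket n x z + bracket n y z"
  and bracket_add_right: "bracket n z (x + y) = bracket n z x + bracket n z y"
  and bracket_scale_left: "bracket n (mscale c x) z = mscale c (bracket n x z)"
  and bracket_scale_right: "bracket n z (mscale c x) = mscale c (bracket n z x)"
  by (simp_all add: bracket_def mmul_add_left mmul_add_right mmul_scale_left mmul_scale_right
      mv.scale_right_diff_distrib)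

lemma bracket_diff_left: "bracket n (x - y) z = bracket n x z - bracket n y z"
  and bracket_diff_right: "bracket n z (x - y) = bracket n z x - bracket n z y"
  by (simp_all add: bracket_def mmul_diff_left mmul_diff_right)

lemma bracket_swap: "bracket n x y = - bracket n y x"
  by (simp add: bracket_def)

lemma linf_bracket_right: "linf f \<Longrightarrow> linf (\<lambda>y. f (bracket n x y))"
  and linf_bracket_left: "linf f \<Longrightarrow> linf (\<lambda>x. f (bracket n x y))"
  by (auto simp: lin_functional_def bracket_add_left bracket_add_right bracket_scale_left bracket_scale_right)

lemma mmul_munit_left: "j < n \<Longrightarrow> mmul n (munit i j) x = (\<lambda>k l. if k = i then x j l else 0)"
  by (auto simp: mmul_def munit_def fun_eq_iff if_distrib[of "\<lambda>a. a * _"] cong: if_cong)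

lemma mmul_munit_right: "i < n \<Longrightarrow> mmul n x (munit i j) = (\<lambda>k l. if l = j then x k i else 0)"
  by (auto simp: mmul_def munit_def fun_eq_iff if_distrib[of "\<lambda>a. _ * a"] cong: if_cong)

lemma mmul_pmat:
  assumes "trans P" "x \<in> pmat P" "y \<in> pmat P"
  shows "mmul n x y \<in> pmat P"
proof (rule pmatI)
  fix i j assume ij: "(i, j) \<notin> P"
  have "x i k * y k j = 0" for k
  proof (cases "(i, k) \<in> P")
    case True
    then have "(k, j) \<notin> P" using assms(1) ij by (meson transD)
    then show ?thesis using assms(3) by (simp add: pmat_def)
  qed (use assms(2) in \<open>simp add: pmat_def\<close>)
  then show "mmul n x y i j = 0" by (simp add: mmul_def)
qed

lemma bracket_pmat:
  assumes "trans P" "x \<in> pmat P" "y \<in> pmat P"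
  shows "bracket n x y \<in> pmat P"
  unfolding bracket_def by (intro mv.subspace_diff[OF subspace_pmat] mmul_pmat assms)

section \<open>The index of a pattern algebra\<close>

lemma subspace_kirillov_ker:
  assumes "linf f" "mv.subspace g"
  shows "mv.subspace (kirillov_ker n g f)"
proof -
  have "linf (\<lambda>x. f (bracket n x y))" for y by (rule linf_bracket_left[OF assms(1)])
  note l = linf_zero[OF this] linf_add[OF this] linf_scale[OF this]
  show ?thesis
    unfolding mv.subspace_def kirillov_ker_def using assms(2)
    by (auto simp: mv.subspace_0 mv.subspace_add mv.subspace_scale l)
qed

lemma kirillov_ker_subset: "kirillov_ker n g f \<subseteq> g"
  by (auto simp: kirillov_ker_def)

lemma kirillov_ker_span:
  "finite P \<Longrightarrow> kirillov_ker n (pmat P) f \<subseteq> mv.span (munits P)"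
  using pmat_span kirillov_ker_subset by blast

text \<open>Functionals live on all matrices, so that they can be composed with linear maps without
  domain conditions. The passage to functionals defined only on a subalgebra, as in
  \<open>lie_index\<close>, is made by \<open>linf_extension\<close>.\<close>

definition pindex :: "nat \<Rightarrow> (nat \<times> nat) set \<Rightarrow> nat" where
  "pindex n P = (LEAST k. \<exists>f. linf f \<and> mv.dim (kirillov_ker n (pmat P) f) = k)"

lemma pindex_le: "linf f \<Longrightarrow> pindex n P \<le> mv.dim (kirillov_ker n (pmat P) f)"
  unfolding pindex_def by (rule Least_le) blast

lemma linf_0: "linf (\<lambda>x. 0)"
  by (simp add: lin_functional_def)

lemma pindex_attained:
  obtains f where "linf f" "mv.dim (kirillov_ker n (pmat P) f) = pindex n P"
proof -
  have "\<exists>f. linf f \<and> mv.dim (kirillov_ker n (pmat P) f) = pindex n P"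
    unfolding pindex_def by (rule LeastI_ex) (use linf_0 in blast)
  then show ?thesis using that by blast
qed

section \<open>Semicontinuity of the kernel dimension\<close>

lemma det_nonzero_iff_trivial_kernel:
  fixes a :: "nat \<Rightarrow> nat \<Rightarrow> complex"
  shows "det (mat r r (\<lambda>(i, j). a i j)) \<noteq> 0 \<longleftrightarrow>
    (\<forall>c. (\<forall>i<r. (\<Sum>j<r. a i j * c j) = 0) \<longrightarrow> (\<forall>j<r. c j = 0))"
proof -
  let ?A = "mat r r (\<lambda>(i, j). a i j)"
  have A: "?A \<in> carrier_mat r r" by simp
  have mv: "(?A *\<^sub>v v = 0\<^sub>v r) \<longleftrightarrow> (\<forall>i<r. (\<Sum>j<r. a i j * (v $ j)) = 0)" if "v \<in> carrier_vec r" for v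
    using that by (auto simp: vec_eq_iff scalar_prod_def atLeast0LessThan)
  have "det ?A = 0 \<longleftrightarrow> (\<exists>c. (\<forall>i<r. (\<Sum>j<r. a i j * c j) = 0) \<and> (\<exists>j<r. c j \<noteq> 0))"
    unfolding det_0_iff_vec_prod_zero[OF A]
  proof (intro iffI; elim exE conjE)
    fix v assume v: "v \<in> carrier_vec r" "v \<noteq> 0\<^sub>v r" "?A *\<^sub>v v = 0\<^sub>v r"
    have "\<exists>j<r. v $ j \<noteq> 0" using v(1,2) by (auto simp: vec_eq_iff)
    then show "\<exists>c. (\<forall>i<r. (\<Sum>j<r. a i j * c j) = 0) \<and> (\<exists>j<r. c j \<noteq> 0)"
      using v(3) unfolding mv[OF v(1)] by (intro exI[of _ "\<lambda>j. v $ j"]) auto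
  next
    fix c j assume c: "\<forall>i<r. (\<Sum>j<r. a i j * c j) = 0" "j < r" "c j \<noteq> 0"
    have "vec r c \<noteq> 0\<^sub>v r" using c by (auto simp: vec_eq_iff)
    moreover have "?A *\<^sub>v vec r c = 0\<^sub>v r" using c(1) by (subst mv) (auto intro!: sum.neutral simp: sum.cong[OF refl, of "{..<r}" "\<lambda>j. a _ j * vec r c $ j" "\<lambda>j. a _ j * c j"])
    ultimately show "\<exists>v. v \<in> carrier_vec r \<and> v \<noteq> 0\<^sub>v r \<and> ?A *\<^sub>v v = 0\<^sub>v r"
      by (intro exI[of _ "vec r c"]) auto
  qed
  then show ?thesis by blast
qed

text \<open>The determinant is the value at \<open>t\<close> of the determinant of a matrix of
  linear polynomials, a polynomial that does not vanish at 0.\<close>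

lemma finite_det_line_zeros:
  fixes a b :: "nat \<Rightarrow> nat \<Rightarrow> complex"
  assumes "det (mat r r (\<lambda>(i, j). a i j)) \<noteq> 0"
  shows "finite {t. det (mat r r (\<lambda>(i, j). a i j + t * b i j)) = 0}"
proof -
  let ?M = "mat r r (\<lambda>(i, j). [: a i j, b i j :])"
  have ev: "det (mat r r (\<lambda>(i, j). a i j + t * b i j)) = poly (det ?M) t" for t
  proof -
    have ev: "comm_ring_hom (\<lambda>p. poly p t)" by unfold_locales auto
    have "mat r r (\<lambda>(i, j). a i j + t * b i j) = map_mat (\<lambda>p. poly p t) ?M"
      by (intro eq_matI) auto
    then show ?thesis using comm_ring_hom.hom_det[OF ev, of ?M] by simp
  qed
  have "det ?M \<noteq> 0"
  proof
    assume "det ?M = 0"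
    then show False using ev[of 0] assms by simp
  qed
  then show ?thesis unfolding ev by (rule poly_roots_finite)
qed

text \<open>Extend a basis \<open>B0\<close> of the kernel at \<open>t = 0\<close> by
  \<open>U\<close> to a basis of the algebra. The form at 0 is nondegenerate on the span of
  \<open>U\<close>, so its Gram determinant on \<open>U\<close> is a nonzero polynomial in
  \<open>t\<close>. Off its roots the kernel at \<open>t\<close> meets the span of \<open>U\<close>
  only in 0, and hence has dimension at most \<open>card B0\<close>.\<close>

lemma finite_kernel_jumps:
  assumes P: "finite P" and f: "linf f" and h: "linf h"
  shows "finite {t. mv.dim (kirillov_ker n (pmat P) f)
                    < mv.dim (kirillov_ker n (pmat P) (\<lambda>x. f x + t * h x))}"
proof -
  let ?g = "pmat P"
  let ?F = "\<lambda>t x. f x + t * h x"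
  let ?K = "\<lambda>t. kirillov_ker n ?g (?F t)"
  have F: "linf (?F t)" for t by (intro linf_plus f linf_times h)
  have fin: "finite (munits P)" and sp: "?g \<subseteq> mv.span (munits P)"
    using P pmat_span finite_munits by auto
  have Ksp: "?K 0 \<subseteq> mv.span (munits P)" using sp kirillov_ker_subset by blast
  obtain B0 where B0: "finite B0" "B0 \<subseteq> ?K 0" "mv.independent B0" "?K 0 \<subseteq> mv.span B0" "card B0 = mv.dim (?K 0)"
    using mv.finite_basis_exists[OF fin Ksp] .
  have B0g: "B0 \<subseteq> ?g" using B0 kirillov_ker_subset by blast
  obtain B where B: "B0 \<subseteq> B" "B \<subseteq> ?g" "mv.independent B" "?g \<subseteq> mv.span B"
    using mv.maximal_independent_subset_extend[OF B0g B0(3)] by metis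
  have fB: "finite B" using mv.independent_card_le_dim_span(1)[OF fin sp B(2,3)] .
  have cB: "card B = mv.dim ?g" using mv.basis_card_eq_dim B by blast
  define U where "U = B - B0"
  have fU: "finite U" using fB by (simp add: U_def)
  define r where "r = card U"
  obtain u where u: "bij_betw u {..<r} U"
    using ex_bij_betw_nat_finite[OF fU] by (auto simp: r_def atLeast0LessThan)
  have ug: "u i \<in> ?g" if "i < r" for i using u that B(2) by (auto simp: bij_betw_def U_def)
  define W where "W c = (\<Sum>j<r. mscale (c j) (u j))" for c :: "nat \<Rightarrow> complex"
  have Wg: "W c \<in> ?g" for c unfolding W_def
    by (intro mv.subspace_sum[OF subspace_pmat] mv.subspace_scale[OF subspace_pmat]) (auto simp: ug)
  have FW: "?F t (bracket n y (W c)) = (\<Sum>j<r. ?F t (bracket n y (u j)) * c j)" for t y c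
  proof -
    have l: "linf (\<lambda>x. ?F t (bracket n y x))" by (rule linf_bracket_right[OF F])
    show ?thesis unfolding W_def linf_sum[OF l] linf_scale[OF l] by (simp add: mult.commute)
  qed
  have WU: "W (\<lambda>i. d (u i)) = (\<Sum>x\<in>U. mscale (d x) x)" for d
    unfolding W_def by (rule sum.reindex_bij_betw[OF u])
  have Wex: "\<exists>c. w = W c" if w: "w \<in> mv.span U" for w
  proof -
    obtain d where "w = (\<Sum>x\<in>U. mscale (d x) x)" using w unfolding mv.span_finite[OF fU] by auto
    then show ?thesis using WU by metis
  qed
  define a where "a i j = f (bracket n (u i) (u j))" for i j
  define b where "b i j = h (bracket n (u i) (u j))" for i j
  \<comment> \<open>\<open>W c\<close> is orthogonal to \<open>U\<close> by assumption and to
    \<open>B0\<close> because \<open>B0\<close> lies in the kernel. So \<open>W c\<close> is in the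
    kernel itself, and thus in the spans of both \<open>B0\<close> and \<open>U\<close>.\<close>
  have ker0: "c j = 0" if c: "\<forall>i<r. (\<Sum>j<r. a i j * c j) = 0" and j: "j < r" for c j
  proof -
    have z: "?F 0 (bracket n y (W c)) = 0" if "y \<in> B" for y
    proof (cases "y \<in> B0")
      case True
      then show ?thesis using B0(2) Wg by (auto simp: kirillov_ker_def)
    next
      case False
      then have "y \<in> u ` {..<r}" using that u by (simp add: bij_betw_def U_def)
      then obtain i where "i < r" "y = u i" by auto
      then show ?thesis using c unfolding FW by (simp add: a_def)
    qed
    have l: "linf (\<lambda>y. ?F 0 (bracket n y (W c)))" by (rule linf_bracket_left[OF F])
    have "?F 0 (bracket n y (W c)) = 0" if "y \<in> ?g" for y
    proof -
      obtain e where "y = (\<Sum>x\<in>B. mscale (e x) x)"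
        using \<open>y \<in> ?g\<close> B(4) unfolding mv.span_finite[OF fB] by auto
      then show ?thesis using linf_sum[OF l, of "\<lambda>x. mscale (e x) x" B] linf_scale[OF l] z by simp
    qed
    then have "?F 0 (bracket n (W c) y) = 0" if "y \<in> ?g" for y
      unfolding bracket_swap[of n "W c" y] linf_uminus[OF F] using that by simp
    then have "W c \<in> ?K 0" using Wg by (simp add: kirillov_ker_def)
    then obtain e where e: "W c = (\<Sum>x\<in>B0. mscale (e x) x)"
      using B0(4) unfolding mv.span_finite[OF B0(1)] by auto
    define d where "d x = c (the_inv_into {..<r} u x)" for x
    have du: "d (u i) = c i" if "i < r" for i
      using u that by (simp add: d_def the_inv_into_f_f bij_betw_def)
    have "W c = W (\<lambda>i. d (u i))" unfolding W_def by (intro sum.cong) (auto simp: du)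
    then have Wd: "W c = (\<Sum>x\<in>U. mscale (d x) x)" using WU by simp
    \<comment> \<open>Difference of the expansions of \<open>W c\<close> over \<open>U\<close> and
      over \<open>B0\<close>: a vanishing combination of the basis \<open>B\<close>.\<close>
    let ?q = "\<lambda>x. if x \<in> B0 then - e x else d x"
    have "(\<Sum>x\<in>B. mscale (?q x) x) = (\<Sum>x\<in>B0. mscale (?q x) x) + (\<Sum>x\<in>U. mscale (?q x) x)"
      unfolding U_def sum.subset_diff[OF B(1) fB] by (rule add.commute)
    also have "(\<Sum>x\<in>B0. mscale (?q x) x) = - W c"
      unfolding e by (simp add: sum_negf)
    also have "(\<Sum>x\<in>U. mscale (?q x) x) = W c"
      unfolding Wd U_def by (intro sum.cong) auto
    finally have "(\<Sum>x\<in>B. mscale (?q x) x) = 0" by (simp only: add.left_inverse)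
    moreover have uj: "u j \<in> B - B0" using bij_betwE[OF u] j by (simp add: U_def)
    ultimately have "?q (u j) = 0"
      using mv.independentD[OF B(3) fB subset_refl, of ?q "u j"] by simp
    then show "c j = 0" using uj du[OF j] by simp
  qed
  have d0: "det (mat r r (\<lambda>(i, j). a i j)) \<noteq> 0"
    unfolding det_nonzero_iff_trivial_kernel using ker0 by blast
  have "mv.dim (?K t) \<le> mv.dim (?K 0)" if dt: "det (mat r r (\<lambda>(i, j). a i j + t * b i j)) \<noteq> 0" for t
  proof -
    have iU: "mv.independent U" using mv.independent_mono[OF B(3)] by (auto simp: U_def)
    have "mv.span U \<inter> ?K t \<subseteq> {0}"
    proof
      fix w assume w: "w \<in> mv.span U \<inter> ?K t"
      then obtain c where c: "w = W c" using Wex by blast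
      have "(\<Sum>j<r. (a i j + t * b i j) * c j) = 0" if "i < r" for i
      proof -
        have "?F t (bracket n w (u i)) = 0" using w ug[OF that] by (simp add: kirillov_ker_def)
        then have "?F t (bracket n (u i) (W c)) = 0"
          unfolding c[symmetric] bracket_swap[of n "u i" w] linf_uminus[OF F] by simp
        then show ?thesis unfolding FW by (simp add: a_def b_def)
      qed
      then have "\<forall>j<r. c j = 0" using dt unfolding det_nonzero_iff_trivial_kernel by blast
      then have "w = 0" unfolding c W_def by simp
      then show "w \<in> {0}" by simp
    qed
    moreover have "mv.span U \<subseteq> ?g" using B(2) by (intro mv.span_minimal subspace_pmat) (auto simp: U_def)
    ultimately have "mv.dim (mv.span U) + mv.dim (?K t) \<le> mv.dim ?g"
      using mv.dim_add_le[OF fin sp mv.subspace_span _ subspace_kirillov_ker[OF F subspace_pmat] kirillov_ker_subset]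
      by blast
    moreover have "mv.dim (mv.span U) = card B - card B0"
      using mv.dim_span_eq_card_independent[OF iU] card_Diff_subset[OF B0(1) B(1)] by (simp add: U_def)
    moreover have "card B0 \<le> card B" using card_mono[OF fB B(1)] .
    ultimately show ?thesis using cB B0(5) by linarith
  qed
  then have "{t. mv.dim (?K 0) < mv.dim (?K t)} \<subseteq> {t. det (mat r r (\<lambda>(i, j). a i j + t * b i j)) = 0}"
    by (auto simp: linorder_not_less[symmetric])
  from finite_subset[OF this finite_det_line_zeros[OF d0]] show ?thesis by simp
qed

text \<open>\<open>X\<close> shifted by \<open>t\<close> is singular only if \<open>t\<close> is an
  eigenvalue of \<open>- X\<close>, that is, a root of a characteristic polynomial. The inverse
  \<open>Y\<close> is expressed by sums over \<open>J\<close> because it is applied to a pairing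
  matrix indexed by a set of matrix positions.\<close>

lemma finite_singular_shifts:
  fixes X :: "nat \<Rightarrow> nat \<Rightarrow> complex"
  assumes "finite J"
  shows "finite {t. \<not> (\<exists>Y. \<forall>i\<in>J. \<forall>j\<in>J.
      (\<Sum>k\<in>J. (X i k + (if i = k then t else 0)) * Y k j) = (if i = j then 1 else 0) \<and>
      (\<Sum>k\<in>J. Y i k * (X k j + (if k = j then t else 0))) = (if i = j then 1 else 0))}"
    (is "finite {t. \<not> ?inv t}")
proof -
  define s where "s = card J"
  obtain \<sigma> where \<sigma>: "bij_betw \<sigma> {..<s} J"
    using ex_bij_betw_nat_finite[OF assms] by (auto simp: s_def atLeast0LessThan)
  have \<sigma>J: "J = \<sigma> ` {..<s}" using \<sigma> by (simp add: bij_betw_def)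
  have \<sigma>eq: "\<sigma> i = \<sigma> j \<longleftrightarrow> i = j" if "i < s" "j < s" for i j
    using \<sigma> that by (auto simp: bij_betw_def inj_on_def)
  define A where "A = mat s s (\<lambda>(i, j). - X (\<sigma> i) (\<sigma> j))"
  have A: "A \<in> carrier_mat s s" by (simp add: A_def)
  have inv: "?inv t" if t: "poly (char_poly A) t \<noteq> 0" for t
  proof -
    let ?M = "mat s s (\<lambda>(i, j). X (\<sigma> i) (\<sigma> j) + (if i = j then t else 0))"
    have M: "?M \<in> carrier_mat s s" by simp
    have "det ?M \<noteq> 0"
    proof
      assume "det ?M = 0"
      then obtain v where v: "v \<in> carrier_vec s" "v \<noteq> 0\<^sub>v s" "?M *\<^sub>v v = 0\<^sub>v s"
        using det_0_iff_vec_prod_zero[OF M] by blast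
      have "A *\<^sub>v v = t \<cdot>\<^sub>v v"
      proof (rule eq_vecI)
        fix i assume "i < dim_vec (t \<cdot>\<^sub>v v)"
        then have i: "i < s" using v(1) by auto
        have "0 = (?M *\<^sub>v v) $ i" using v(3) i by simp
        also have "\<dots> = (\<Sum>j\<in>{0..<s}. X (\<sigma> i) (\<sigma> j) * v $ j + (if i = j then t * v $ j else 0))"
          using i v(1) by (auto simp: scalar_prod_def distrib_right simp del: sum.delta sum.delta' intro!: sum.cong)
        also have "\<dots> = (\<Sum>j\<in>{0..<s}. X (\<sigma> i) (\<sigma> j) * v $ j) + t * v $ i"
          using i unfolding sum.distrib by simp
        finally show "(A *\<^sub>v v) $ i = (t \<cdot>\<^sub>v v) $ i"
          using i v(1) by (simp add: A_def scalar_prod_def sum_negf neg_eq_iff_add_eq_0)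
      qed (use v(1) in \<open>auto simp: A_def\<close>)
      then have "eigenvalue A t" using v A by (auto simp: eigenvalue_def eigenvector_def)
      then show False using eigenvalue_root_char_poly[OF A] t by simp
    qed
    then have "?M \<in> Units (ring_mat TYPE(complex) s ())" by (rule det_non_zero_imp_unit[OF M])
    then obtain Z where Z: "Z \<in> carrier_mat s s" "Z * ?M = 1\<^sub>m s" "?M * Z = 1\<^sub>m s"
      by (auto simp: Units_def ring_mat_simps)
    define Y where "Y i j = Z $$ (the_inv_into {..<s} \<sigma> i, the_inv_into {..<s} \<sigma> j)" for i j
    have Y: "Y (\<sigma> i) (\<sigma> j) = Z $$ (i, j)" if "i < s" "j < s" for i j
      using \<sigma> that by (simp add: Y_def the_inv_into_f_f bij_betw_def)
    show "?inv t"
    proof (intro exI[of _ Y] ballI)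
      fix i' j' assume "i' \<in> J" "j' \<in> J"
      then obtain i j where ij: "i' = \<sigma> i" "j' = \<sigma> j" "i < s" "j < s" by (auto simp: \<sigma>J)
      have "(\<Sum>k\<in>J. (X i' k + (if i' = k then t else 0)) * Y k j') = (?M * Z) $$ (i, j)"
        unfolding ij sum.reindex_bij_betw[OF \<sigma>, symmetric] using ij Z(1)
        by (auto simp: scalar_prod_def atLeast0LessThan Y \<sigma>eq intro!: sum.cong)
      moreover have "(\<Sum>k\<in>J. Y i' k * (X k j' + (if k = j' then t else 0))) = (Z * ?M) $$ (i, j)"
        unfolding ij sum.reindex_bij_betw[OF \<sigma>, symmetric] using ij Z(1)
        by (auto simp: scalar_prod_def atLeast0LessThan Y \<sigma>eq intro!: sum.cong)
      ultimately show "(\<Sum>k\<in>J. (X i' k + (if i' = k then t else 0)) * Y k j') = (if i' = j' then 1 else 0) \<and>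
        (\<Sum>k\<in>J. Y i' k * (X k j' + (if k = j' then t else 0))) = (if i' = j' then 1 else 0)"
        using Z ij by (simp add: \<sigma>eq)
    qed
  qed
  have "char_poly A \<noteq> 0" using degree_monic_char_poly[OF A] by auto
  then have "finite {t. poly (char_poly A) t = 0}" by (rule poly_roots_finite)
  moreover have "{t. \<not> ?inv t} \<subseteq> {t. poly (char_poly A) t = 0}" using inv by blast
  ultimately show ?thesis by (rule finite_subset[rotated])
qed

section \<open>Conjugation by invertible elements\<close>

text \<open>This is \<open>(1 + N) x (1 + N')\<close>, expanded so that no identity matrix is needed.\<close>
definition conj1 :: "nat \<Rightarrow> cmat \<Rightarrow> cmat \<Rightarrow> cmat \<Rightarrow> cmat" where
  "conj1 n N N' x = x + mmul n N x + mmul n x N' + mmul n (mmul n N x) N'"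

lemma mlinear_conj1: "mlinear (conj1 n N N')"
  by (rule mlinearI) (simp_all add: conj1_def mmul_add_left mmul_add_right mmul_scale_left
      mmul_scale_right mv.scale_right_distrib)

lemma conj1_pmat:
  "trans P \<Longrightarrow> N \<in> pmat P \<Longrightarrow> N' \<in> pmat P \<Longrightarrow> x \<in> pmat P \<Longrightarrow> conj1 n N N' x \<in> pmat P"
  unfolding conj1_def by (intro mv.subspace_add[OF subspace_pmat] mmul_pmat)

lemma mmul_zero: "mmul n 0 x = 0" "mmul n x 0 = 0"
  by (auto simp: mmul_def fun_eq_iff)

text \<open>The hypothesis says that \<open>1 + N'\<close> times \<open>1 + N\<close> is 1; this is
  the factor that meets in the middle when two conjugates are multiplied.\<close>

lemma conj1_mmul:
  assumes "N' + N + mmul n N' N = 0"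
  shows "conj1 n N N' (mmul n x y) = mmul n (conj1 n N N' x) (conj1 n N N' y)"
proof -
  define X where "X = x + mmul n N x"
  define Y where "Y = y + mmul n y N'"
  have x: "conj1 n N N' x = X + mmul n X N'"
    by (simp add: conj1_def X_def mmul_add_left add.assoc)
  have y: "conj1 n N N' y = Y + mmul n N Y"
    by (simp add: conj1_def Y_def mmul_add_right mmul_assoc add.assoc add.commute add.left_commute)
  have "mmul n (conj1 n N N' x) (conj1 n N N' y)
      = mmul n X Y + mmul n X (mmul n (N' + N + mmul n N' N) Y)"
    unfolding x y by (simp add: mmul_add_left mmul_add_right mmul_assoc algebra_simps)
  also have "\<dots> = mmul n X Y" by (simp add: assms mmul_zero)
  also have "\<dots> = conj1 n N N' (mmul n x y)"
    by (simp add: conj1_def X_def Y_def mmul_add_left mmul_add_right mmul_assoc algebra_simps)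
  finally show ?thesis by simp
qed

lemma conj1_inverse:
  assumes "N' + N + mmul n N' N = 0"
  shows "conj1 n N' N (conj1 n N N' x) = x"
proof -
  define Z where "Z = x + mmul n x N'"
  have 1: "conj1 n N N' x = Z + mmul n N Z"
    by (simp add: conj1_def Z_def mmul_add_right mmul_assoc add.assoc add.commute add.left_commute)
  have 2: "conj1 n N' N w = (w + mmul n N' w) + mmul n (w + mmul n N' w) N" for w
    by (simp add: conj1_def mmul_add_left add.assoc)
  have "(Z + mmul n N Z) + mmul n N' (Z + mmul n N Z) = Z + mmul n (N' + N + mmul n N' N) Z"
    by (simp add: mmul_add_left mmul_add_right mmul_assoc algebra_simps)
  then have "conj1 n N' N (conj1 n N N' x) = Z + mmul n Z N"
    unfolding 1 2 by (simp only: assms mmul_zero add_0_right)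
  also have "\<dots> = x + mmul n x (N' + N + mmul n N' N)"
    by (simp add: Z_def mmul_add_left mmul_add_right mmul_assoc algebra_simps)
  finally show ?thesis by (simp add: assms mmul_zero)
qed

text \<open>Conjugation respects brackets, so it maps the kernel of the pulled back functional
  injectively into that of \<open>f\<close>. The first identity gives injectivity and
  multiplicativity; the second makes every \<open>y\<close> in \<open>pmat P\<close> a
  conjugate.\<close>

lemma dim_ker_conj1_le:
  assumes P: "finite P" "trans P" and N: "N \<in> pmat P" "N' \<in> pmat P"
    and inv: "N' + N + mmul n N' N = 0" "N + N' + mmul n N N' = 0" and f: "linf f"
  shows "mv.dim (kirillov_ker n (pmat P) (\<lambda>x. f (conj1 n N N' x))) \<le> mv.dim (kirillov_ker n (pmat P) f)"
proof (rule mvp.dim_le_of_inj_on[OF mlinear_conj1])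
  have f': "linf (\<lambda>x. f (conj1 n N N' x))" by (rule linf_compose[OF f mlinear_conj1])
  show "mv.subspace (kirillov_ker n (pmat P) (\<lambda>x. f (conj1 n N N' x)))"
    by (rule subspace_kirillov_ker[OF f' subspace_pmat])
  show "inj_on (conj1 n N N') (kirillov_ker n (pmat P) (\<lambda>x. f (conj1 n N N' x)))"
    by (rule inj_on_inverseI[of _ "conj1 n N' N"]) (rule conj1_inverse[OF inv(1)])
  have br: "conj1 n N N' (bracket n x y) = bracket n (conj1 n N N' x) (conj1 n N N' y)" for x y
    using module_hom.diff[OF mlinear_conj1[unfolded Vector_Spaces.linear_def, THEN conjunct2, THEN conjunct2]]
    by (simp add: bracket_def conj1_mmul[OF inv(1)])
  show "conj1 n N N' ` kirillov_ker n (pmat P) (\<lambda>x. f (conj1 n N N' x)) \<subseteq> kirillov_ker n (pmat P) f"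
  proof clarify
    fix x assume x: "x \<in> kirillov_ker n (pmat P) (\<lambda>x. f (conj1 n N N' x))"
    show "conj1 n N N' x \<in> kirillov_ker n (pmat P) f"
      unfolding kirillov_ker_def
    proof (intro CollectI conjI ballI)
      show "conj1 n N N' x \<in> pmat P" using x conj1_pmat[OF P(2) N] by (auto simp: kirillov_ker_def)
      fix y assume "y \<in> pmat P"
      then have y: "conj1 n N' N y \<in> pmat P" by (rule conj1_pmat[OF P(2) N(2,1)])
      have "f (bracket n (conj1 n N N' x) (conj1 n N N' (conj1 n N' N y))) = 0"
        using x y unfolding kirillov_ker_def by (simp add: br)
      then show "f (bracket n (conj1 n N N' x) y) = 0" by (simp add: conj1_inverse[OF inv(2)])
    qed
  qed
  show "finite (munits P)" using P by (simp add: finite_munits)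
  show "kirillov_ker n (pmat P) f \<subseteq> mv.span (munits P)" by (rule kirillov_ker_span[OF P(1)])
qed

section \<open>Panyushev's reduction step\<close>

lemma linf_zero_on_pmat:
  assumes "linf f" "finite P" "x \<in> pmat P" "\<And>i j. (i, j) \<in> P \<Longrightarrow> f (munit i j) = 0"
  shows "f x = 0"
  using linf_eq_on_pmat[OF assms(1) linf_0 assms(2,3)] assms(4) by blast

lemma kirillov_ker_cong:
  assumes "trans P" "\<And>x. x \<in> pmat P \<Longrightarrow> f x = g x"
  shows "kirillov_ker n (pmat P) f = kirillov_ker n (pmat P) g"
  unfolding kirillov_ker_def using bracket_pmat[OF assms(1)] assms(2) by (auto simp: assms(2))

lemma mlinear_add: "mlinear T \<Longrightarrow> T (x + y) = T x + T y"
  and mlinear_scale: "mlinear T \<Longrightarrow> T (mscale c x) = mscale c (T x)"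
  by (auto simp: Vector_Spaces.linear_iff)

lemma mlinear_diff: "mlinear T \<Longrightarrow> T (x - y) = T x - T y"
  using mlinear_add[of T "x - y" y] by simp

lemma sum_restrict:
  fixes n :: nat and h :: "nat \<Rightarrow> complex"
  assumes "B \<subseteq> {..<n}" "\<And>k. k < n \<Longrightarrow> k \<notin> B \<Longrightarrow> h k = 0"
  shows "(\<Sum>k<n. h k) = (\<Sum>k\<in>B. h k)"
  by (rule sum.mono_neutral_right) (use assms in auto)

text \<open>In \<open>A \<times> A \<union> A \<times> R \<union> Q\<close> the positions \<open>A \<times> R\<close> form the abelian ideal.  The standard
  functional on it is a partial matching \<open>\<tau>\<close> between \<open>A\<close> and \<open>R\<close> that exhausts one of the two sides;
  its orbit is open because of \<open>cover\<close> and \<open>SQ\<close>.\<close>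
locale reduction_step =
  fixes n :: nat and A R T J :: "nat set" and Q :: "(nat \<times> nat) set" and \<tau> :: "nat \<Rightarrow> nat"
  assumes A_less: "A \<subseteq> {..<n}" and R_less: "R \<subseteq> {..<n}" and T_less: "T \<subseteq> {..<n}"
    and AR: "A \<inter> R = {}" and AT: "A \<inter> T = {}" and RT: "R \<inter> T = {}"
    and Q_sub: "Q \<subseteq> (R \<union> T) \<times> (R \<union> T)" and Q_trans: "trans Q" and Q_RT: "Q \<inter> R \<times> T = {}"
    and J_sub: "J \<subseteq> A" and tau_inj: "inj_on \<tau> J" and tau_R: "\<tau> ` J \<subseteq> R"
    and cover: "J = A \<or> \<tau> ` J = R"
    and SQ: "(R - \<tau> ` J) \<times> \<tau> ` J \<subseteq> Q"
begin

definition K where "K = A - J"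
definition J' where "J' = \<tau> ` J"
definition S where "S = R - J'"
definition P where "P = A \<times> A \<union> A \<times> R \<union> Q"
text \<open>Since \<open>cover\<close> makes \<open>K\<close> or \<open>S\<close> empty, this is
  either \<open>Q - S \<times> J'\<close> or
  \<open>K \<times> K \<union> K \<times> R \<union> Q\<close>. The matched indices of
  \<open>A\<close> disappear because their rows in the stabilizer are determined by those of their
  partners; the positions \<open>S \<times> J'\<close> are removed because they move the standard
  functional.\<close>

definition P' where "P' = K \<times> K \<union> K \<times> R \<union> (Q - S \<times> J')"
definition \<iota> where "\<iota> = the_inv_into J \<tau>"
text \<open>In the stabilizer a matched index behaves like its partner, so the block on
  \<open>A\<close> is a copy of the one on \<open>K \<union> J'\<close>; this is the
  relabelling.\<close>

definition \<tau>' where "\<tau>' i = (if i \<in> J then \<tau> i else i)"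

lemma iota_tau [simp]: "j \<in> J \<Longrightarrow> \<iota> (\<tau> j) = j"
  by (simp add: \<iota>_def the_inv_into_f_f tau_inj)

lemma tau_iota [simp]: "r \<in> J' \<Longrightarrow> \<tau> (\<iota> r) = r"
  by (auto simp: J'_def)

lemma iota_J [simp]: "r \<in> J' \<Longrightarrow> \<iota> r \<in> J"
  by (auto simp: J'_def)

lemma tau_J' [simp]: "j \<in> J \<Longrightarrow> \<tau> j \<in> J'"
  by (simp add: J'_def)

lemma J'_R: "J' \<subseteq> R" and SQ': "S \<times> J' \<subseteq> Q" and cover': "K = {} \<or> S = {}"
  using tau_R SQ cover J_sub by (auto simp: J'_def S_def K_def)

lemma in_J: "a \<in> J \<Longrightarrow> a \<in> A" and in_K: "a \<in> K \<Longrightarrow> a \<in> A" and in_J': "r \<in> J' \<Longrightarrow> r \<in> R"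
  and in_S: "r \<in> S \<Longrightarrow> r \<in> R"
  using J_sub J'_R by (auto simp: K_def S_def)

lemma A_cases: "a \<in> A \<Longrightarrow> (a \<in> J \<Longrightarrow> thesis) \<Longrightarrow> (a \<in> K \<Longrightarrow> a \<notin> J \<Longrightarrow> thesis) \<Longrightarrow> thesis"
  and R_cases: "r \<in> R \<Longrightarrow> (r \<in> J' \<Longrightarrow> thesis) \<Longrightarrow> (r \<in> S \<Longrightarrow> r \<notin> J' \<Longrightarrow> thesis) \<Longrightarrow> thesis"
  by (auto simp: K_def S_def)

lemma disj: "a \<in> A \<Longrightarrow> a \<notin> R" "a \<in> A \<Longrightarrow> a \<notin> T" "r \<in> R \<Longrightarrow> r \<notin> T"
  and disj': "r \<in> R \<Longrightarrow> r \<notin> A" "t \<in> T \<Longrightarrow> t \<notin> A" "t \<in> T \<Longrightarrow> t \<notin> R"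
  using AR AT RT by auto

lemma less_n: "a \<in> A \<Longrightarrow> a < n" "r \<in> R \<Longrightarrow> r < n" "t \<in> T \<Longrightarrow> t < n"
  using A_less R_less T_less by auto

lemma Q_D: "(i, j) \<in> Q \<Longrightarrow> i \<in> R \<union> T" "(i, j) \<in> Q \<Longrightarrow> j \<in> R \<union> T" "(i, j) \<in> Q \<Longrightarrow> i \<in> R \<Longrightarrow> j \<in> R"
  using Q_sub Q_RT by auto

lemma P_sub: "P \<subseteq> {..<n} \<times> {..<n}"
  using Q_sub A_less R_less T_less unfolding P_def by blast

lemma P'_sub: "P' \<subseteq> {..<n} \<times> {..<n}"
  using Q_sub A_less R_less T_less unfolding P'_def K_def by blast

lemma finite_P: "finite P" and finite_P': "finite P'" and finite_AR: "finite (A \<times> R)"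
  using finite_subset[OF P_sub] finite_subset[OF P'_sub] finite_subset[OF A_less] finite_subset[OF R_less]
  by simp_all

lemma finite_J: "finite J"
  by (rule finite_subset[of _ "{..<n}"]) (use J_sub A_less in auto)

lemma trans_P: "trans P"
proof (rule transI)
  fix x y z assume xy: "(x, y) \<in> P" and yz: "(y, z) \<in> P"
  then consider "(x, y) \<in> Q" "(y, z) \<in> Q" | "x \<in> A" "y \<in> A" "(y, z) \<in> P" | "x \<in> A" "y \<in> R" "(y, z) \<in> Q"
    using Q_D disj unfolding P_def by blast
  then show "(x, z) \<in> P"
  proof cases
    case 1
    then show ?thesis using Q_trans by (auto simp: P_def dest: transD)
  next
    case 2
    then show ?thesis using Q_D disj unfolding P_def by blast
  next
    case 3
    then show ?thesis using Q_D(3) unfolding P_def by blast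
  qed
qed

lemma trans_P': "trans P'"
proof (rule transI)
  fix x y z assume xy: "(x, y) \<in> P'" and yz: "(y, z) \<in> P'"
  then consider "(x, y) \<in> Q" "(y, z) \<in> Q" | "x \<in> K" "y \<in> K" | "x \<in> K" "y \<in> R" "(y, z) \<in> Q"
    using Q_D disj in_K unfolding P'_def by blast
  then show "(x, z) \<in> P'"
  proof cases
    case 1
    then have "(x, z) \<in> Q" using Q_trans by (auto dest: transD)
    moreover have "(x, z) \<notin> S \<times> J'"
    proof
      assume "(x, z) \<in> S \<times> J'"
      then have xz: "x \<in> S" "z \<in> J'" by auto
      then have "y \<in> R" using 1 Q_D(3) in_S by blast
      then have "x \<notin> K" "y \<notin> K" using disj(1) in_K in_S[OF xz(1)] by blast+
      then have "(x, y) \<notin> S \<times> J'" "(y, z) \<notin> S \<times> J'" using xy yz unfolding P'_def by blast+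
      then show False using xz \<open>y \<in> R\<close> unfolding S_def by blast
    qed
    ultimately show ?thesis by (simp add: P'_def)
  next
    case 2
    then have "y \<notin> R \<union> T" using in_K disj by blast
    then have "(y, z) \<notin> Q" using Q_D by blast
    then show ?thesis using 2 yz unfolding P'_def by blast
  next
    case 3
    then show ?thesis using Q_D(3) unfolding P'_def by blast
  qed
qed

text \<open>\<open>\<phi>\<close> embeds the smaller algebra into the stabilizer of the standard functional, \<open>\<pi>\<close> is a
  retraction of it that kills the ideal.\<close>
definition \<phi> :: "cmat \<Rightarrow> cmat" where
  "\<phi> z = (\<lambda>i j. if i \<in> A \<and> j \<in> A then z (\<tau>' i) (\<tau>' j)
               else if i \<in> R \<union> T \<and> j \<in> R \<union> T then z i j else 0)"

definition \<pi> :: "cmat \<Rightarrow> cmat" where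
  "\<pi> x = (\<lambda>i j. if (i, j) \<in> P' then (if i \<in> K \<and> j \<in> R then x i (\<iota> j) else x i j) else 0)"

definition std :: "cmat \<Rightarrow> complex" where
  "std x = (\<Sum>j\<in>J. x j (\<tau> j))"

lemma mlinear_phi: "mlinear \<phi>"
  by (rule mlinearI) (auto simp: \<phi>_def mscale_def fun_eq_iff)

lemma mlinear_pi: "mlinear \<pi>"
  by (rule mlinearI) (auto simp: \<pi>_def mscale_def fun_eq_iff)

lemma linf_std: "linf std"
  unfolding std_def by (rule linf_Sum) (rule linf_entry)

lemma phi_pmat: "z \<in> pmat P' \<Longrightarrow> \<phi> z \<in> pmat P"
proof (rule pmatI)
  fix i j assume z: "z \<in> pmat P'" and ij: "(i, j) \<notin> P"
  have "z i j = 0" if "i \<in> R \<union> T"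
  proof -
    have "i \<notin> K" using that disj in_K by blast
    then have "(i, j) \<notin> P'" using ij unfolding P_def P'_def by blast
    then show ?thesis by (rule pmatD[OF z])
  qed
  then show "\<phi> z i j = 0" using ij by (auto simp: \<phi>_def P_def)
qed

lemma pi_pmat: "\<pi> x \<in> pmat P'"
  by (rule pmatI) (simp add: \<pi>_def)

lemma tau'_A: "a \<in> A \<Longrightarrow> \<tau>' a \<in> K \<union> J'"
  by (auto simp: \<tau>'_def K_def)

lemma P'_KR: "(i, j) \<in> P' \<Longrightarrow> i \<in> K \<Longrightarrow> j \<in> R \<Longrightarrow> j \<in> J'"
  using cover' by (auto simp: S_def)

lemma P'_mem: "(i, j) \<in> P' \<Longrightarrow> (i \<in> K \<and> j \<in> K) \<or> (i \<in> K \<and> j \<in> J') \<or> ((i, j) \<in> Q \<and> \<not> (i \<in> S \<and> j \<in> J'))"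
  using P'_KR[of i j] unfolding P'_def by blast

lemma pi_phi:
  assumes z: "z \<in> pmat P'" shows "\<pi> (\<phi> z) = z"
proof (intro ext)
  fix i j
  show "\<pi> (\<phi> z) i j = z i j"
  proof (cases "(i, j) \<in> P'")
    case False
    then show ?thesis using z by (simp add: \<pi>_def pmatD)
  next
    case True
    from P'_mem[OF True] consider "i \<in> K" "j \<in> K" | "i \<in> K" "j \<in> J'" | "(i, j) \<in> Q" by blast
    then show ?thesis
    proof cases
      case 1
      then have "i \<in> A" "j \<in> A" "i \<notin> J" "j \<notin> J" "j \<notin> R" using disj in_K by (auto simp: K_def)
      then show ?thesis using True 1 by (simp add: \<pi>_def \<phi>_def \<tau>'_def)
    next
      case 2
      then have "i \<in> A" "\<iota> j \<in> A" "i \<notin> J" "\<iota> j \<in> J" "j \<in> R" using in_K in_J in_J' by (auto simp: K_def)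
      then show ?thesis using True 2 by (simp add: \<pi>_def \<phi>_def \<tau>'_def)
    next
      case 3
      then have "i \<in> R \<union> T" "j \<in> R \<union> T" "i \<notin> A" "i \<notin> K" using Q_D disj in_K by blast+
      then show ?thesis using True 3 by (simp add: \<pi>_def \<phi>_def)
    qed
  qed
qed

lemma inj_tau': "inj_on \<tau>' A"
proof (rule inj_onI)
  fix a b assume ab: "a \<in> A" "b \<in> A" "\<tau>' a = \<tau>' b"
  show "a = b"
  proof (cases "a \<in> J"; cases "b \<in> J")
    assume "a \<in> J" "b \<in> J" then show ?thesis using ab tau_inj by (auto simp: \<tau>'_def inj_on_def)
  next
    assume "a \<in> J" "b \<notin> J" then show ?thesis using ab in_J'[OF tau_J'] disj by (auto simp: \<tau>'_def)
  next
    assume "a \<notin> J" "b \<in> J" then show ?thesis using ab in_J'[OF tau_J'] disj by (auto simp: \<tau>'_def)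
  next
    assume "a \<notin> J" "b \<notin> J" then show ?thesis using ab by (auto simp: \<tau>'_def)
  qed
qed

lemma tau'_image: "\<tau>' ` A = K \<union> J'"
  using J_sub by (force simp: \<tau>'_def K_def J'_def)

text \<open>In the block on \<open>A\<close>, reindexing by \<open>\<tau>'\<close> yields a sum over
  \<open>K \<union> J'\<close> only. A further index \<open>l\<close> could contribute only between
  two indices of \<open>J'\<close>; then \<open>Q_RT\<close> puts \<open>l\<close> into
  \<open>R\<close>, so into \<open>S\<close>, and the removal of \<open>S \<times> J'\<close> from
  \<open>Q\<close> excludes it.\<close>

lemma phi_mmul:
  assumes z: "z \<in> pmat P'" and w: "w \<in> pmat P'"
  shows "\<phi> (mmul n z w) = mmul n (\<phi> z) (\<phi> w)"
proof (intro ext)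
  fix i j
  consider (AA) "i \<in> A" "j \<in> A" | (RT) "i \<in> R \<union> T" "j \<in> R \<union> T"
    | (none) "\<not> (i \<in> A \<and> j \<in> A)" "\<not> (i \<in> R \<union> T \<and> j \<in> R \<union> T)" by blast
  then show "\<phi> (mmul n z w) i j = mmul n (\<phi> z) (\<phi> w) i j"
  proof cases
    case AA
    have "mmul n (\<phi> z) (\<phi> w) i j = (\<Sum>k\<in>A. \<phi> z i k * \<phi> w k j)"
      unfolding mmul_def by (rule sum_restrict[OF A_less]) (use AA disj in \<open>auto simp: \<phi>_def\<close>)
    also have "\<dots> = (\<Sum>k\<in>A. z (\<tau>' i) (\<tau>' k) * w (\<tau>' k) (\<tau>' j))"
      using AA by (intro sum.cong) (auto simp: \<phi>_def)
    also have "\<dots> = (\<Sum>l\<in>K \<union> J'. z (\<tau>' i) l * w l (\<tau>' j))"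
      using sum.reindex[OF inj_tau', of "\<lambda>l. z (\<tau>' i) l * w l (\<tau>' j)"] by (simp add: tau'_image)
    also have "\<dots> = (\<Sum>l<n. z (\<tau>' i) l * w l (\<tau>' j))"
    proof (rule sum_restrict[symmetric])
      show "K \<union> J' \<subseteq> {..<n}" using less_n in_K in_J' by auto
      fix l assume l: "l \<notin> K \<union> J'"
      show "z (\<tau>' i) l * w l (\<tau>' j) = 0"
      proof (cases "(\<tau>' i, l) \<in> P' \<and> (l, \<tau>' j) \<in> P'")
        case True
        then have q: "(\<tau>' i, l) \<in> Q" "(l, \<tau>' j) \<in> Q" "\<not> (l \<in> S \<and> \<tau>' j \<in> J')"
          using P'_mem l by blast+
        have "\<tau>' i \<notin> K" "\<tau>' j \<notin> K"
          using Q_D(1)[OF q(1)] Q_D(2)[OF q(2)] in_K disj by blast+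
        then have "\<tau>' i \<in> J'" "\<tau>' j \<in> J'"
          using tau'_A[OF AA(1)] tau'_A[OF AA(2)] by blast+
        then have "l \<in> R" using q Q_D(3) in_J' by blast
        then have False using q l \<open>\<tau>' j \<in> J'\<close> by (auto simp: S_def)
        then show ?thesis ..
      qed (use z w in \<open>auto simp: pmat_def\<close>)
    qed
    also have "\<dots> = \<phi> (mmul n z w) i j" using AA by (simp add: \<phi>_def mmul_def)
    finally show ?thesis by simp
  next
    case RT
    then have nA: "i \<notin> A" "j \<notin> A" "i \<notin> K" using disj in_K by auto
    have RTn: "R \<union> T \<subseteq> {..<n}" using less_n by auto
    have "mmul n (\<phi> z) (\<phi> w) i j = (\<Sum>k\<in>R \<union> T. \<phi> z i k * \<phi> w k j)"
      unfolding mmul_def by (rule sum_restrict[OF RTn]) (use nA in \<open>auto simp: \<phi>_def\<close>)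
    also have "\<dots> = (\<Sum>k\<in>R \<union> T. z i k * w k j)"
      using RT nA by (intro sum.cong) (auto simp: \<phi>_def)
    also have "\<dots> = (\<Sum>k<n. z i k * w k j)"
    proof (rule sum_restrict[symmetric, OF RTn])
      fix k assume "k \<notin> R \<union> T"
      then have "(i, k) \<notin> P'" using nA Q_D by (auto simp: P'_def)
      then show "z i k * w k j = 0" using z by (simp add: pmatD)
    qed
    also have "\<dots> = \<phi> (mmul n z w) i j" using RT nA by (simp add: \<phi>_def mmul_def)
    finally show ?thesis by simp
  next
    case none
    have "\<phi> z i k * \<phi> w k j = 0" for k
    proof (cases "k \<in> A")
      case True
      then have "k \<notin> R \<union> T" using disj by blast
      then have "i \<in> A \<or> \<phi> z i k = 0" "j \<in> A \<or> \<phi> w k j = 0" by (simp_all add: \<phi>_def)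
      then show ?thesis using none(1) by auto
    next
      case False
      then have "i \<in> R \<union> T \<or> \<phi> z i k = 0" "j \<in> R \<union> T \<or> \<phi> w k j = 0" by (auto simp: \<phi>_def)
      then show ?thesis using none(2) by auto
    qed
    then show ?thesis using none by (auto simp: \<phi>_def mmul_def)
  qed
qed

lemma phi_bracket:
  "z \<in> pmat P' \<Longrightarrow> w \<in> pmat P' \<Longrightarrow> \<phi> (bracket n z w) = bracket n (\<phi> z) (\<phi> w)"
  by (simp add: bracket_def mlinear_diff[OF mlinear_phi] phi_mmul)

lemma std_phi: "std (\<phi> z) = 0"
proof -
  have "\<phi> z j (\<tau> j) = 0" if "j \<in> J" for j
    using that disj in_J in_J'[OF tau_J'[OF that]] by (auto simp: \<phi>_def)
  then show ?thesis by (simp add: std_def)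
qed

lemma pi_V: assumes "v \<in> pmat (A \<times> R)" shows "\<pi> v = 0"
proof (intro ext)
  fix i j
  have "v i j = 0" if "(i, j) \<in> P'" "\<not> (i \<in> K \<and> j \<in> R)"
    using P'_mem[OF that(1)] that(2) disj in_K in_J' Q_D by (intro pmatD[OF assms]) blast
  moreover have "v i (\<iota> j) = 0" if "(i, j) \<in> P'" "i \<in> K" "j \<in> R"
    using P'_KR[OF that] disj in_J by (intro pmatD[OF assms]) auto
  ultimately show "\<pi> v i j = 0 i j" by (auto simp: \<pi>_def)
qed

text \<open>Besides the ideal, only \<open>J \<times> A\<close> and \<open>S \<times> J'\<close> are
  missed by \<open>\<phi>\<close>. By \<open>cover\<close> these are together as many positions as
  \<open>A \<times> R\<close>, and the standard functional will pair them perfectly with the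
  ideal.\<close>

lemma phi_pi_complement:
  assumes y: "y \<in> pmat P"
  shows "y - \<phi> (\<pi> y) \<in> pmat (A \<times> R \<union> J \<times> A \<union> S \<times> J')"
proof (rule pmatI)
  fix i j assume ij: "(i, j) \<notin> A \<times> R \<union> J \<times> A \<union> S \<times> J'"
  consider (KA) "i \<in> K" "j \<in> A" | (Q) "(i, j) \<in> P'" "(i, j) \<in> Q" | (none) "(i, j) \<notin> P"
    using ij by (auto simp: P_def P'_def K_def)
  then show "(y - \<phi> (\<pi> y)) i j = 0"
  proof cases
    case KA
    then have i: "i \<in> A" "i \<notin> J" by (auto simp: K_def)
    show ?thesis
    proof (cases "j \<in> J")
      case True
      then have "(i, \<tau> j) \<in> P'" using KA in_J'[OF tau_J'] by (simp add: P'_def)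
      then show ?thesis using KA i True in_J'[OF tau_J'] by (simp add: \<phi>_def \<pi>_def \<tau>'_def)
    next
      case False
      then have "(i, j) \<in> P'" using KA by (simp add: P'_def K_def)
      then show ?thesis using KA i False disj by (simp add: \<phi>_def \<pi>_def \<tau>'_def)
    qed
  next
    case Q
    then have "i \<in> R \<union> T" "j \<in> R \<union> T" "i \<notin> A" "i \<notin> K" using Q_D disj in_K by blast+
    then show ?thesis using Q by (simp add: \<phi>_def \<pi>_def)
  next
    case none
    then have "y i j = 0" using y by (simp add: pmatD)
    moreover have "\<phi> (\<pi> y) i j = 0" using phi_pmat[OF pi_pmat] none by (rule pmatD)
    ultimately show ?thesis by simp
  qed
qed

end

section \<open>Functionals that are standard on the ideal\<close>

locale standard_functional = reduction_step +
  fixes f :: "cmat \<Rightarrow> complex"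
  assumes f: "linf f" and f_std: "\<And>v. v \<in> pmat (A \<times> R) \<Longrightarrow> f v = std v"
begin

text \<open>The \<open>munit a r\<close> span the ideal, so the vanishing of these differences is
  the system of equations for the stabilizer: rows of matched indices agree with the rows of their
  partners, and terms without a partner are read as 0.\<close>

lemma f_bracket_V:
  assumes x: "x \<in> pmat P" and a: "a \<in> A" and r: "r \<in> R"
  shows "f (bracket n x (munit a r)) =
    (if r \<in> J' then x (\<iota> r) a else 0) - (if a \<in> J then x r (\<tau> a) else 0)"
proof -
  let ?u = "\<lambda>k l. if l = r then x k a else 0" and ?w = "\<lambda>k l. if k = a then x r l else 0"
  have b: "bracket n x (munit a r) = ?u - ?w"
    using mmul_munit_right[of a n x r] mmul_munit_left[of r n a x] less_n a r by (simp add: bracket_def)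
  have "?u \<in> pmat (A \<times> R)"
  proof (rule pmatI)
    fix k l assume kl: "(k, l) \<notin> A \<times> R"
    show "?u k l = 0"
    proof (cases "l = r")
      case True
      then have "(k, a) \<notin> P" using kl a r disj Q_D unfolding P_def by blast
      then show ?thesis using x by (simp add: pmatD)
    qed simp
  qed
  moreover have "?w \<in> pmat (A \<times> R)"
  proof (rule pmatI)
    fix k l assume kl: "(k, l) \<notin> A \<times> R"
    show "?w k l = 0"
    proof (cases "k = a")
      case True
      then have "(r, l) \<notin> P" using kl a r disj Q_D unfolding P_def by blast
      then show ?thesis using x by (simp add: pmatD)
    qed simp
  qed
  moreover have "std ?u = (if r \<in> J' then x (\<iota> r) a else 0)"
  proof (cases "r \<in> J'")
    case True
    have "std ?u = (\<Sum>j\<in>J. if j = \<iota> r then x j a else 0)"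
      unfolding std_def using True by (intro sum.cong) auto
    then show ?thesis using True finite_J by simp
  next
    case False
    then show ?thesis by (auto simp: std_def intro!: sum.neutral)
  qed
  moreover have "std ?w = (if a \<in> J then x r (\<tau> a) else 0)"
    using finite_J by (simp add: std_def)
  ultimately show ?thesis unfolding b linf_diff[OF f] by (simp add: f_std)
qed

lemma f_bracket_phi_V:
  assumes z: "z \<in> pmat P'" and v: "v \<in> pmat (A \<times> R)"
  shows "f (bracket n (\<phi> z) v) = 0"
proof (rule linf_zero_on_pmat[OF linf_bracket_right[OF f] finite_AR v])
  fix a r assume "(a, r) \<in> A \<times> R"
  then have a: "a \<in> A" and r: "r \<in> R" by auto
  have [simp]: "r \<notin> A" using r disj' by simp
  have "(if r \<in> J' then \<phi> z (\<iota> r) a else 0) = (if a \<in> J then \<phi> z r (\<tau> a) else 0)"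
  proof (rule R_cases[OF r]; rule A_cases[OF a])
    assume "r \<in> J'" "a \<in> J"
    then show ?thesis using a r in_J[OF iota_J] in_J'[OF tau_J'] by (simp add: \<phi>_def \<tau>'_def)
  next
    assume ra: "r \<in> J'" "a \<in> K" "a \<notin> J"
    then have "(r, a) \<notin> P'" using disj in_K r a Q_D unfolding P'_def by blast
    then show ?thesis using ra a in_J[OF iota_J] z by (simp add: \<phi>_def \<tau>'_def pmatD)
  next
    assume ra: "r \<in> S" "r \<notin> J'" "a \<in> J"
    then have "(r, \<tau> a) \<notin> P'" using disj in_K r by (auto simp: P'_def)
    then show ?thesis using ra z by (simp add: \<phi>_def pmatD)
  qed auto
  then show "f (bracket n (\<phi> z) (munit a r)) = 0"
    unfolding f_bracket_V[OF phi_pmat[OF z] a r] by simp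
qed

text \<open>The equations of \<open>f_bracket_V\<close> express the entries at
  \<open>J \<times> A\<close> through the rows of the partners and force those at
  \<open>S \<times> J'\<close> to be 0. These are exactly the positions left open by
  \<open>phi_pi_complement\<close>.\<close>

lemma stabilizer_decomposition:
  assumes x: "x \<in> pmat P" and st: "\<And>v. v \<in> pmat (A \<times> R) \<Longrightarrow> f (bracket n x v) = 0"
  shows "x - \<phi> (\<pi> x) \<in> pmat (A \<times> R)"
proof (rule pmatI)
  have e: "(if r \<in> J' then x (\<iota> r) a else 0) = (if a \<in> J then x r (\<tau> a) else 0)"
    if "a \<in> A" "r \<in> R" for a r
    using f_bracket_V[OF x that] st[of "munit a r"] that by (simp add: munit_in_pmat)
  fix i j assume ij: "(i, j) \<notin> A \<times> R"
  consider "i \<in> J" "j \<in> A" | "i \<in> S" "j \<in> J'" | "(i, j) \<notin> A \<times> R \<union> J \<times> A \<union> S \<times> J'"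
    using ij by blast
  then show "(x - \<phi> (\<pi> x)) i j = 0"
  proof cases
    case 1
    have ti: "\<tau> i \<in> R" using 1 in_J'[OF tau_J'] by simp
    have tn: "\<tau> i \<notin> S" "\<tau> i \<notin> K" "i \<in> A" using 1 disj in_K in_J ti by (auto simp: S_def)
    have "x i j = (if j \<in> J then x (\<tau> i) (\<tau> j) else 0)"
      using e[OF 1(2) ti] 1 by simp
    also have "\<dots> = \<pi> x (\<tau> i) (\<tau>' j)"
    proof (cases "j \<in> J")
      case True
      have "(\<tau> i, \<tau> j) \<in> P \<longleftrightarrow> (\<tau> i, \<tau> j) \<in> P'"
        using ti tn in_J'[OF tau_J'[OF True]] disj by (auto simp: P_def P'_def)
      then show ?thesis using True tn x by (auto simp: \<pi>_def \<tau>'_def pmatD)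
    next
      case False
      then have "(\<tau> i, j) \<notin> P'" using tn 1 Q_D disj ti unfolding P'_def by blast
      then show ?thesis using False by (simp add: \<pi>_def \<tau>'_def)
    qed
    finally show ?thesis using 1 tn by (simp add: \<phi>_def \<tau>'_def)
  next
    case 2
    have "x i j = 0" using e[of "\<iota> j" i] 2 in_J[OF iota_J] in_S by (simp add: S_def)
    moreover have "\<phi> (\<pi> x) i j = 0"
    proof -
      have "i \<notin> A" using disj'(1) in_S 2 by blast
      moreover from this have "(i, j) \<notin> P'" using in_K 2 unfolding P'_def by blast
      ultimately show ?thesis by (simp add: \<phi>_def \<pi>_def)
    qed
    ultimately show ?thesis by simp
  next
    case 3
    then show ?thesis using pmatD[OF phi_pi_complement[OF x]] by blast
  qed
qed

text \<open>Together with \<open>f_V_munit_SJ'\<close> this is the perfect pairing: each coordinate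
  of an element of the ideal is read off, up to sign, by one matrix unit. Columns in
  \<open>J'\<close> are read by \<open>J \<times> A\<close>, columns in \<open>S\<close> by
  \<open>S \<times> J'\<close>.\<close>

lemma f_V_munit_JA:
  assumes v: "v \<in> pmat (A \<times> R)" and j: "j \<in> J" and a: "a \<in> A"
  shows "f (bracket n v (munit j a)) = - v a (\<tau> j)"
proof -
  let ?w = "\<lambda>k l. if k = j then v a l else 0"
  have z: "v k j = 0" for k using v j in_J disj by (intro pmatD[OF v]) auto
  have "bracket n v (munit j a) = - ?w"
    using mmul_munit_right[of j n v a] mmul_munit_left[of a n j v] less_n in_J[OF j] a z
    by (auto simp: bracket_def fun_eq_iff)
  moreover have "?w \<in> pmat (A \<times> R)" using v in_J[OF j] by (auto simp: pmat_def)
  moreover have "std ?w = v a (\<tau> j)" using finite_J j by (simp add: std_def)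
  ultimately show ?thesis by (simp add: linf_uminus[OF f] f_std)
qed

lemma f_V_munit_SJ':
  assumes v: "v \<in> pmat (A \<times> R)" and s: "s \<in> S" and r: "r \<in> J'"
  shows "f (bracket n v (munit s r)) = v (\<iota> r) s"
proof -
  let ?u = "\<lambda>k l. if l = r then v k s else 0"
  have rR: "r \<in> R" and sR: "s \<in> R" using r s in_J' in_S by auto
  have z: "v r k = 0" for k using v rR disj by (intro pmatD[OF v]) auto
  have "bracket n v (munit s r) = ?u"
    using mmul_munit_right[of s n v r] mmul_munit_left[of r n s v] less_n rR sR z
    by (auto simp: bracket_def fun_eq_iff)
  moreover have "?u \<in> pmat (A \<times> R)" using v rR sR by (auto simp: pmat_def)
  moreover have "std ?u = v (\<iota> r) s"
  proof -
    have "std ?u = (\<Sum>j\<in>J. if j = \<iota> r then v j s else 0)"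
      unfolding std_def using r by (intro sum.cong) auto
    then show ?thesis using r finite_J by simp
  qed
  ultimately show ?thesis by (simp add: f_std)
qed

lemma bracket_V_V:
  assumes v: "v \<in> pmat (A \<times> R)" and w: "w \<in> pmat (A \<times> R)" shows "bracket n v w = 0"
proof -
  have "v i k * w k j = 0" "w i k * v k j = 0" for i k j
    using v w disj by (cases "k \<in> A"; auto simp: pmat_def)+
  then show ?thesis by (simp add: bracket_def mmul_def zero_fun_def fun_eq_iff)
qed

lemma ker_V_trivial:
  assumes v: "v \<in> pmat (A \<times> R)" and k: "v \<in> kirillov_ker n (pmat P) f" shows "v = 0"
proof (intro ext)
  fix a r
  have kz: "f (bracket n v (munit i j)) = 0" if "(i, j) \<in> P" for i j
    using k munit_in_pmat[OF that] by (simp add: kirillov_ker_def)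
  show "v a r = 0 a r"
  proof (cases "(a, r) \<in> A \<times> R")
    case True
    then have a: "a \<in> A" and r: "r \<in> R" by auto
    have "v a r = 0"
    proof (rule R_cases[OF r])
      assume r: "r \<in> J'"
      have "(\<iota> r, a) \<in> P" using a r in_J[OF iota_J] by (simp add: P_def)
      from kz[OF this] show ?thesis using f_V_munit_JA[OF v iota_J[OF r] a] r by simp
    next
      assume s: "r \<in> S"
      then have aJ: "a \<in> J" using cover' a by (auto simp: K_def)
      then have "(r, \<tau> a) \<in> P" using s SQ' tau_J' unfolding P_def by blast
      from kz[OF this] show ?thesis using f_V_munit_SJ'[OF v s tau_J'[OF aJ]] aJ by simp
    qed
    then show ?thesis by simp
  next
    case False
    then show ?thesis using v by (simp add: pmatD)
  qed
qed

lemma linf_f_phi: "linf (\<lambda>z. f (\<phi> z))"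
  by (rule linf_compose[OF f mlinear_phi])

text \<open>A kernel element is \<open>\<phi> (\<pi> x)\<close> plus an element of the ideal. Since
  the kernel meets the ideal only in 0, \<open>\<pi>\<close> is injective on it; since the ideal is
  orthogonal to the image of \<open>\<phi>\<close>, the image under \<open>\<pi>\<close> lies in the
  smaller kernel.\<close>

lemma dim_ker_le_reduced:
  "mv.dim (kirillov_ker n (pmat P) f) \<le> mv.dim (kirillov_ker n (pmat P') (\<lambda>z. f (\<phi> z)))"
proof (rule mvp.dim_le_of_inj_on[OF mlinear_pi])
  let ?K = "kirillov_ker n (pmat P) f"
  show sK: "mv.subspace ?K" by (rule subspace_kirillov_ker[OF f subspace_pmat])
  have V_sub: "pmat (A \<times> R) \<subseteq> pmat P" by (rule pmat_mono) (auto simp: P_def)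
  have dec: "x - \<phi> (\<pi> x) \<in> pmat (A \<times> R)" if "x \<in> ?K" for x
    by (rule stabilizer_decomposition) (use that V_sub in \<open>auto simp: kirillov_ker_def\<close>)
  show "inj_on \<pi> ?K"
  proof (rule inj_onI)
    fix x y assume x: "x \<in> ?K" and y: "y \<in> ?K" and xy: "\<pi> x = \<pi> y"
    have d: "x - y \<in> ?K" using mv.subspace_diff[OF sK x y] .
    have "\<pi> (x - y) = 0" using xy by (simp add: mlinear_diff[OF mlinear_pi])
    then have "\<phi> (\<pi> (x - y)) = 0" by (auto simp: \<phi>_def fun_eq_iff)
    then have "x - y \<in> pmat (A \<times> R)" using dec[OF d] by simp
    then show "x = y" using ker_V_trivial d by force
  qed
  show "\<pi> ` ?K \<subseteq> kirillov_ker n (pmat P') (\<lambda>z. f (\<phi> z))"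
  proof clarify
    fix x assume x: "x \<in> ?K"
    show "\<pi> x \<in> kirillov_ker n (pmat P') (\<lambda>z. f (\<phi> z))"
      unfolding kirillov_ker_def
    proof (intro CollectI conjI ballI)
      show "\<pi> x \<in> pmat P'" by (rule pi_pmat)
      fix z assume z: "z \<in> pmat P'"
      let ?w = "x - \<phi> (\<pi> x)"
      have "f (bracket n ?w (\<phi> z)) = 0"
        unfolding bracket_swap[of n ?w] linf_uminus[OF f] using f_bracket_phi_V[OF z dec[OF x]] by simp
      moreover have "f (bracket n x (\<phi> z)) = 0"
        using x phi_pmat[OF z] by (simp add: kirillov_ker_def)
      ultimately show "f (\<phi> (bracket n (\<pi> x) z)) = 0"
        unfolding phi_bracket[OF pi_pmat z] by (simp add: bracket_diff_left linf_diff[OF f])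
    qed
  qed
  show "finite (munits P')" by (rule finite_munits[OF finite_P'])
  show "kirillov_ker n (pmat P') (\<lambda>z. f (\<phi> z)) \<subseteq> mv.span (munits P')"
    by (rule kirillov_ker_span[OF finite_P'])
qed

text \<open>The unique correction in the ideal that makes \<open>\<phi> z + \<nu> z\<close> orthogonal also to a complement
  of the stabilizer.\<close>
definition \<nu> :: "cmat \<Rightarrow> cmat" where
  "\<nu> z = (\<lambda>a r. if a \<in> A \<and> r \<in> R then
       (if r \<in> J' then f (bracket n (\<phi> z) (munit (\<iota> r) a)) else - f (bracket n (\<phi> z) (munit r (\<tau> a))))
     else 0)"

lemma nu_V: "\<nu> z \<in> pmat (A \<times> R)"
  by (rule pmatI) (auto simp: \<nu>_def)

lemma mlinear_phi_nu: "mlinear (\<lambda>z. \<phi> z + \<nu> z)"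
proof (rule mlinearI)
  have l: "linf (\<lambda>z. f (bracket n (\<phi> z) y))" for y
    by (rule linf_compose[OF linf_bracket_left[OF f] mlinear_phi])
  have "\<nu> (x + y) = \<nu> x + \<nu> y" for x y
    using linf_add[OF l] by (auto simp: \<nu>_def fun_eq_iff)
  then show "\<phi> (x + y) + \<nu> (x + y) = \<phi> x + \<nu> x + (\<phi> y + \<nu> y)" for x y
    by (simp add: mlinear_add[OF mlinear_phi])
  have "\<nu> (mscale c x) = mscale c (\<nu> x)" for c x
  proof (intro ext)
    fix a r show "\<nu> (mscale c x) a r = mscale c (\<nu> x) a r"
      unfolding \<nu>_def linf_scale[OF l] by (simp add: mscale_def)
  qed
  then show "\<phi> (mscale c x) + \<nu> (mscale c x) = mscale c (\<phi> x + \<nu> x)" for c x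
    by (simp add: mlinear_scale[OF mlinear_phi] mv.scale_right_distrib)
qed

lemma dim_reduced_le_ker:
  "mv.dim (kirillov_ker n (pmat P') (\<lambda>z. f (\<phi> z))) \<le> mv.dim (kirillov_ker n (pmat P) f)"
proof (rule mvp.dim_le_of_inj_on[OF mlinear_phi_nu])
  let ?K = "kirillov_ker n (pmat P') (\<lambda>z. f (\<phi> z))"
  show "mv.subspace ?K" by (rule subspace_kirillov_ker[OF linf_f_phi subspace_pmat])
  have V_sub: "pmat (A \<times> R) \<subseteq> pmat P" by (rule pmat_mono) (auto simp: P_def)
  show "inj_on (\<lambda>z. \<phi> z + \<nu> z) ?K"
  proof (rule inj_onI)
    fix x y assume x: "x \<in> ?K" and y: "y \<in> ?K" and xy: "\<phi> x + \<nu> x = \<phi> y + \<nu> y"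
    have "\<pi> (\<phi> x + \<nu> x) = x" "\<pi> (\<phi> y + \<nu> y) = y"
      using x y by (simp_all add: mlinear_add[OF mlinear_pi] pi_V[OF nu_V] pi_phi kirillov_ker_def)
    then show "x = y" using xy by metis
  qed
  show "(\<lambda>z. \<phi> z + \<nu> z) ` ?K \<subseteq> kirillov_ker n (pmat P) f"
  proof clarify
    fix z assume zK: "z \<in> ?K"
    then have z: "z \<in> pmat P'" by (simp add: kirillov_ker_def)
    let ?x = "\<phi> z + \<nu> z"
    have l: "linf (\<lambda>y. f (bracket n ?x y))" by (rule linf_bracket_right[OF f])
    have V0: "f (bracket n ?x w) = 0" if "w \<in> pmat (A \<times> R)" for w
      using f_bracket_phi_V[OF z that] bracket_V_V[OF nu_V that]
      by (simp add: bracket_add_left linf_add[OF f] linf_zero[OF f])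
    have phi0: "f (bracket n ?x (\<phi> w)) = 0" if w: "w \<in> pmat P'" for w
    proof -
      have "f (bracket n (\<phi> z) (\<phi> w)) = 0"
        using zK w unfolding kirillov_ker_def by (simp flip: phi_bracket[OF z w])
      moreover have "f (bracket n (\<nu> z) (\<phi> w)) = 0"
        unfolding bracket_swap[of n "\<nu> z"] linf_uminus[OF f] using f_bracket_phi_V[OF w nu_V] by simp
      ultimately show ?thesis by (simp add: bracket_add_left linf_add[OF f])
    qed
    have JA0: "f (bracket n ?x (munit j a)) = 0" if "j \<in> J" "a \<in> A" for j a
      using f_V_munit_JA[OF nu_V that] that in_J'[OF tau_J']
      by (simp add: bracket_add_left linf_add[OF f] \<nu>_def)
    have SJ0: "f (bracket n ?x (munit s r)) = 0" if s: "s \<in> S" and r: "r \<in> J'" for s r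
      using f_V_munit_SJ'[OF nu_V s r] r s in_J[OF iota_J[OF r]] in_S[OF s]
      by (simp add: bracket_add_left linf_add[OF f] \<nu>_def S_def)
    have D: "finite (A \<times> R \<union> J \<times> A \<union> S \<times> J')"
      using finite_J finite_subset[OF A_less] finite_subset[OF R_less] by (simp add: S_def J'_def)
    have "f (bracket n ?x y) = 0" if y: "y \<in> pmat P" for y
    proof -
      have "f (bracket n ?x (y - \<phi> (\<pi> y))) = 0"
      proof (rule linf_zero_on_pmat[OF l D phi_pi_complement[OF y]])
        fix i j assume "(i, j) \<in> A \<times> R \<union> J \<times> A \<union> S \<times> J'"
        then consider "(i, j) \<in> A \<times> R" | "i \<in> J" "j \<in> A" | "i \<in> S" "j \<in> J'" by blast
        then show "f (bracket n ?x (munit i j)) = 0"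
          by cases (use V0[OF munit_in_pmat] JA0 SJ0 in simp_all)
      qed
      then show ?thesis using phi0[OF pi_pmat] by (simp add: bracket_diff_right linf_diff[OF f])
    qed
    moreover have "?x \<in> pmat P"
      using mv.subspace_add[OF subspace_pmat phi_pmat[OF z]] nu_V V_sub by blast
    ultimately show "?x \<in> kirillov_ker n (pmat P) f" by (simp add: kirillov_ker_def)
  qed
  show "finite (munits P)" by (rule finite_munits[OF finite_P])
  show "kirillov_ker n (pmat P) f \<subseteq> mv.span (munits P)" by (rule kirillov_ker_span[OF finite_P])
qed

end

section \<open>Equality of the indices before and after the reduction\<close>

context reduction_step
begin

lemma standard_functionalI:
  assumes "linf f" "\<And>k i. k \<in> A \<Longrightarrow> i \<in> J \<Longrightarrow> f (munit k (\<tau> i)) = (if k = i then 1 else 0)"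
    and "\<And>a s. a \<in> A \<Longrightarrow> s \<in> S \<Longrightarrow> f (munit a s) = 0"
  shows "standard_functional n A R T J Q \<tau> f"
proof unfold_locales
  show "linf f" by fact
  fix v assume v: "v \<in> pmat (A \<times> R)"
  show "f v = std v"
  proof (rule linf_eq_on_pmat[OF assms(1) linf_std finite_AR v])
    fix a r assume "(a, r) \<in> A \<times> R"
    then have a: "a \<in> A" and r: "r \<in> R" by auto
    show "f (munit a r) = std (munit a r)"
    proof (rule R_cases[OF r])
      assume r: "r \<in> J'"
      have "std (munit a r) = (\<Sum>j\<in>J. if j = \<iota> r then (if j = a then 1 else 0) else 0)"
        unfolding std_def munit_def using r by (intro sum.cong) auto
      also have "\<dots> = (if a = \<iota> r then 1 else 0)" using r finite_J by simp
      finally show ?thesis using assms(2)[OF a iota_J[OF r]] r by simp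
    next
      assume s: "r \<in> S" "r \<notin> J'"
      then have "std (munit a r) = 0"
        unfolding std_def munit_def by (intro sum.neutral) auto
      then show ?thesis using assms(3)[OF a s(1)] by simp
    qed
  qed
qed

text \<open>An optimal functional of the smaller algebra is pulled back along \<open>\<pi>\<close>
  and \<open>std\<close> is added. The two summands do not interfere: \<open>\<pi>\<close> kills the
  ideal and \<open>std\<close> kills the image of \<open>\<phi>\<close>.\<close>

lemma pindex_le_reduced: "pindex n P \<le> pindex n P'"
proof -
  obtain f' where f': "linf f'" "mv.dim (kirillov_ker n (pmat P') f') = pindex n P'"
    using pindex_attained .
  define f where "f x = f' (\<pi> x) + std x" for x
  have "linf f" unfolding f_def by (intro linf_plus linf_compose[OF f'(1) mlinear_pi] linf_std)
  then interpret standard_functional n A R T J Q \<tau> f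
    by unfold_locales (auto simp: f_def pi_V linf_zero[OF f'(1)])
  have "kirillov_ker n (pmat P') (\<lambda>z. f (\<phi> z)) = kirillov_ker n (pmat P') f'"
    by (rule kirillov_ker_cong[OF trans_P']) (simp add: f_def pi_phi std_phi)
  then show ?thesis using pindex_le[OF \<open>linf f\<close>, of n P] dim_ker_le_reduced f'(2) by simp
qed

lemma conj1_munit:
  assumes "a < n" "r < n"
  shows "conj1 n N N' (munit a r) =
    (\<lambda>k l. ((if k = a then 1 else 0) + N k a) * ((if l = r then 1 else 0) + N' r l))"
proof -
  have "mmul n (mmul n N (munit a r)) N' = (\<lambda>k l. N k a * N' r l)"
    unfolding mmul_munit_right[OF assms(1)] using assms(2)
    by (auto simp: mmul_def fun_eq_iff if_distrib[of "\<lambda>a. a * _"] cong: if_cong)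
  then show ?thesis
    unfolding conj1_def mmul_munit_right[OF assms(1)] mmul_munit_left[OF assms(2)]
    by (auto simp: munit_def fun_eq_iff algebra_simps)
qed

text \<open>\<open>Y\<close> is the inverse of the pairing matrix between \<open>J\<close> and
  \<open>J'\<close>. Conjugating with \<open>Y\<close> on the block \<open>J \<times> J\<close>
  turns that pairing into the identity. A second conjugation by \<open>1 - W\<close> with
  \<open>W\<close> of square zero then clears the values of the functional on
  \<open>K \<times> J'\<close> or on \<open>A \<times> S\<close>, of which \<open>cover\<close>
  leaves at most one nonempty.\<close>

lemma exists_standard_conjugate:
  assumes f: "linf f"
    and Y: "\<forall>i\<in>J. \<forall>j\<in>J. (\<Sum>k\<in>J. f (munit k (\<tau> i)) * Y k j) = (if i = j then 1 else 0) \<and>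
      (\<Sum>k\<in>J. Y i k * f (munit j (\<tau> k))) = (if i = j then 1 else 0)"
  obtains g where "standard_functional n A R T J Q \<tau> g"
    "mv.dim (kirillov_ker n (pmat P) g) \<le> mv.dim (kirillov_ker n (pmat P) f)"
proof -
  have Jn: "J \<subseteq> {..<n}" using J_sub A_less by auto
  define X where "X i k = f (munit k (\<tau> i))" for i k
  define N where "N = (\<lambda>i j. if i \<in> J \<and> j \<in> J then Y i j - (if i = j then 1 else 0) else 0)"
  define N' where "N' = (\<lambda>i j. if i \<in> J \<and> j \<in> J then X i j - (if i = j then 1 else 0) else 0)"
  have NP: "N \<in> pmat P" "N' \<in> pmat P"
    using in_J by (auto simp: pmat_def N_def N'_def P_def)
  have mm: "mmul n U W i j = (if i \<in> J \<and> j \<in> J then \<Sum>k\<in>J. U i k * W k j else 0)"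
    if "U \<in> pmat (J \<times> J)" "W \<in> pmat (J \<times> J)" for U W i j
  proof -
    have "mmul n U W i j = (\<Sum>k\<in>J. U i k * W k j)"
      unfolding mmul_def by (rule sum_restrict[OF Jn]) (use that in \<open>auto simp: pmat_def\<close>)
    moreover have "\<dots> = 0" if "\<not> (i \<in> J \<and> j \<in> J)"
      using \<open>U \<in> _\<close> \<open>W \<in> _\<close> that by (intro sum.neutral) (auto simp: pmat_def)
    ultimately show ?thesis by auto
  qed
  have NJ: "N \<in> pmat (J \<times> J)" "N' \<in> pmat (J \<times> J)" by (auto simp: pmat_def N_def N'_def)
  have expand: "(\<Sum>k\<in>J. (U i k - (if i = k then 1 else 0)) * (W k j - (if k = j then 1 else 0)))
      = (\<Sum>k\<in>J. U i k * W k j) - U i j - W i j + (if i = j then 1 else 0)"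
    if "i \<in> J" "j \<in> J" for U W :: cmat and i j
  proof -
    have "(\<Sum>k\<in>J. (U i k - (if i = k then 1 else 0)) * (W k j - (if k = j then 1 else 0)))
      = (\<Sum>k\<in>J. U i k * W k j - (if k = j then U i k else 0) - (if i = k then W k j else 0)
          + (if i = k then if i = j then 1 else 0 else 0))"
      by (intro sum.cong) (auto simp: algebra_simps)
    also have "\<dots> = (\<Sum>k\<in>J. U i k * W k j) - U i j - W i j + (if i = j then 1 else 0)"
      unfolding sum.distrib sum_subtractf using that finite_J by simp
    finally show ?thesis .
  qed
  have i1: "N' + N + mmul n N' N = 0"
  proof (intro ext)
    fix i j show "(N' + N + mmul n N' N) i j = 0 i j"
      using Y expand[of i j X Y] by (simp add: mm[OF NJ(2,1)]) (auto simp: N_def N'_def X_def)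
  qed
  have i2: "N + N' + mmul n N N' = 0"
  proof (intro ext)
    fix i j show "(N + N' + mmul n N N') i j = 0 i j"
      using Y expand[of i j Y X] by (simp add: mm[OF NJ]) (auto simp: N_def N'_def X_def)
  qed
  define f2 where "f2 x = f (conj1 n N N' x)" for x
  have f2: "linf f2" unfolding f2_def by (rule linf_compose[OF f mlinear_conj1])
  have d2: "mv.dim (kirillov_ker n (pmat P) f2) \<le> mv.dim (kirillov_ker n (pmat P) f)"
    using dim_ker_conj1_le[OF finite_P trans_P NP i1 i2 f] by (simp add: f2_def[abs_def])
  have f2J: "f2 (munit k (\<tau> i)) = (if k = i then 1 else 0)" if k: "k \<in> J" and i: "i \<in> J" for k i
  proof -
    have ti: "\<tau> i \<in> R" using i in_J'[OF tau_J'] by simp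
    then have tJ: "\<tau> i \<notin> J" using disj'(1) in_J by blast
    \<comment> \<open>\<open>\<tau> i\<close> lies outside \<open>J\<close>, so the right factor
      fixes the column and only multiplication by \<open>Y\<close> from the left is visible.\<close>
    have c: "conj1 n N N' (munit k (\<tau> i)) = (\<lambda>a l. if a \<in> J \<and> l = \<tau> i then Y a k else 0)"
      using conj1_munit[OF less_n(1)[OF in_J[OF k]] less_n(2)[OF ti], of N N'] k tJ
      by (auto simp: N_def N'_def fun_eq_iff)
    have "conj1 n N N' (munit k (\<tau> i)) \<in> pmat (J \<times> {\<tau> i})" unfolding c by (auto simp: pmat_def)
    from linf_expand[OF f _ this] have "f2 (munit k (\<tau> i)) = (\<Sum>p\<in>J \<times> {\<tau> i}. conj1 n N N' (munit k (\<tau> i)) (fst p) (snd p) * f (munit (fst p) (snd p)))"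
      using finite_J by (simp add: f2_def)
    also have "\<dots> = (\<Sum>a\<in>J. Y a k * f (munit a (\<tau> i)))"
      proof -
      have "(\<Sum>p\<in>J \<times> {\<tau> i}. h p) = (\<Sum>a\<in>J. h (a, \<tau> i))" for h :: "nat \<times> nat \<Rightarrow> complex"
        by (rule sum.reindex_bij_witness[of _ "\<lambda>a. (a, \<tau> i)" fst]) auto
      then show ?thesis unfolding c by simp
    qed
    also have "\<dots> = (if k = i then 1 else 0)" using Y k i by (simp add: mult.commute)
    finally show ?thesis .
  qed
  \<comment> \<open>Elimination against the identity block. The first branch clears rows in
    \<open>K\<close> and acts through the left factor \<open>1 - W\<close>; the second clears
    columns in \<open>S\<close> through the right factor \<open>1 + W\<close>, whence the opposite
    sign.\<close>
  define W where "W = (\<lambda>i j. if i \<in> J \<and> j \<in> K then f2 (munit j (\<tau> i))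
      else if i \<in> S \<and> j \<in> J' then - f2 (munit (\<iota> j) i) else 0)"
  have WP: "W \<in> pmat P"
    using in_J in_K SQ' by (auto simp: pmat_def W_def P_def)
  then have WP': "- W \<in> pmat P" by (rule mv.subspace_neg[OF subspace_pmat])
  have WW: "mmul n W W = 0"
  proof (intro ext)
    fix i j
    have "W i k * W k j = 0" for k
    proof -
      have "k \<in> K \<Longrightarrow> k \<notin> J" "k \<in> K \<Longrightarrow> k \<notin> S" "k \<in> J' \<Longrightarrow> k \<notin> J" "k \<in> J' \<Longrightarrow> k \<notin> S"
        using in_K in_S in_J in_J' disj by (auto simp: K_def S_def)
      then show ?thesis by (auto simp: W_def)
    qed
    then show "mmul n W W i j = 0 i j" by (simp add: mmul_def)
  qed
  have neg: "mmul n (- W) W = - mmul n W W" "mmul n W (- W) = - mmul n W W"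
    by (simp_all add: mmul_def fun_eq_iff sum_negf)
  have i3: "W + - W + mmul n W (- W) = 0" and i4: "- W + W + mmul n (- W) W = 0"
    by (simp_all add: neg WW)
  define f3 where "f3 x = f2 (conj1 n (- W) W x)" for x
  have f3: "linf f3" unfolding f3_def by (rule linf_compose[OF f2 mlinear_conj1])
  have d3: "mv.dim (kirillov_ker n (pmat P) f3) \<le> mv.dim (kirillov_ker n (pmat P) f2)"
    using dim_ker_conj1_le[OF finite_P trans_P WP' WP i3 i4 f2] by (simp add: f3_def[abs_def])
  have rowJ': "W r l = 0" if "r \<in> J'" for r l
    using that in_J in_J'[OF that] disj' by (auto simp: W_def S_def)
  have colJ: "W k a = 0" if "a \<in> J" for k a
    using that in_J[OF that] in_J' disj by (auto simp: W_def K_def)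
  have "standard_functional n A R T J Q \<tau> f3"
  proof (rule standard_functionalI[OF f3])
    fix k i assume k: "k \<in> A" and i: "i \<in> J"
    have ti: "\<tau> i \<in> R" using i in_J'[OF tau_J'] by auto
    have c: "conj1 n (- W) W (munit k (\<tau> i)) = (\<lambda>a l. ((if a = k then 1 else 0) - W a k) * (if l = \<tau> i then 1 else 0))"
      using conj1_munit[OF less_n(1)[OF k] less_n(2)[OF ti], of "- W" W] rowJ'[OF tau_J'[OF i]]
      by (auto simp: fun_eq_iff)
    show "f3 (munit k (\<tau> i)) = (if k = i then 1 else 0)"
    proof (rule A_cases[OF k])
      assume kJ: "k \<in> J"
      then have "conj1 n (- W) W (munit k (\<tau> i)) = munit k (\<tau> i)"
        unfolding c colJ[OF kJ] by (auto simp: munit_def fun_eq_iff)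
      then show ?thesis using f2J[OF kJ i] by (simp add: f3_def)
    next
      assume kK: "k \<in> K" "k \<notin> J"
      have "conj1 n (- W) W (munit k (\<tau> i)) = munit k (\<tau> i) - (\<Sum>j\<in>J. mscale (f2 (munit k (\<tau> j))) (munit j (\<tau> i)))"
      proof (intro ext)
        fix a l
        have "(\<Sum>j\<in>J. mscale (f2 (munit k (\<tau> j))) (munit j (\<tau> i))) a l
            = (\<Sum>j\<in>J. if j = a then (if l = \<tau> i then f2 (munit k (\<tau> a)) else 0) else 0)"
          unfolding sum_cmat_apply by (intro sum.cong) (auto simp: mscale_def munit_def)
        also have "\<dots> = (if a \<in> J \<and> l = \<tau> i then f2 (munit k (\<tau> a)) else 0)" using finite_J by simp
        also have "\<dots> = W a k * (if l = \<tau> i then 1 else 0)"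
          using kK in_K[OF kK(1)] in_J' disj by (auto simp: W_def)
        finally show "conj1 n (- W) W (munit k (\<tau> i)) a l
            = (munit k (\<tau> i) - (\<Sum>j\<in>J. mscale (f2 (munit k (\<tau> j))) (munit j (\<tau> i)))) a l"
          unfolding c by (auto simp: munit_def)
      qed
      then have "f3 (munit k (\<tau> i)) = f2 (munit k (\<tau> i)) - (\<Sum>j\<in>J. f2 (munit k (\<tau> j)) * f2 (munit j (\<tau> i)))"
        by (simp add: f3_def linf_diff[OF f2] linf_sum[OF f2] linf_scale[OF f2])
      also have "(\<Sum>j\<in>J. f2 (munit k (\<tau> j)) * f2 (munit j (\<tau> i))) = (\<Sum>j\<in>J. if j = i then f2 (munit k (\<tau> i)) else 0)"
        using i by (intro sum.cong) (auto simp: f2J)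
      finally show ?thesis using i kK finite_J by auto
    qed
  next
    fix a s assume a: "a \<in> A" and s: "s \<in> S"
    then have aJ: "a \<in> J" using cover' by (auto simp: K_def)
    have "conj1 n (- W) W (munit a s) = munit a s - (\<Sum>j\<in>J. mscale (f2 (munit j s)) (munit a (\<tau> j)))"
    proof (intro ext)
      fix k l
      have "(\<Sum>j\<in>J. mscale (f2 (munit j s)) (munit a (\<tau> j))) k l
          = (\<Sum>j\<in>J. if j = \<iota> l \<and> l \<in> J' then (if k = a then f2 (munit j s) else 0) else 0)"
        unfolding sum_cmat_apply by (intro sum.cong) (auto simp: mscale_def munit_def)
      also have "\<dots> = (if l \<in> J' \<and> k = a then f2 (munit (\<iota> l) s) else 0)"
        using finite_J by (cases "l \<in> J'") auto
      also have "\<dots> = - (if k = a then 1 else 0) * W s l"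
        using s disj' in_S[OF s] in_J by (auto simp: W_def)
      finally have e: "(\<Sum>j\<in>J. mscale (f2 (munit j s)) (munit a (\<tau> j))) k l = - (if k = a then 1 else 0) * W s l" .
      show "conj1 n (- W) W (munit a s) k l = (munit a s - (\<Sum>j\<in>J. mscale (f2 (munit j s)) (munit a (\<tau> j)))) k l"
        unfolding conj1_munit[OF less_n(1)[OF a] less_n(2)[OF in_S[OF s]]] fun_diff_def e
        using colJ[OF aJ] by (auto simp: munit_def)
    qed
    then have "f3 (munit a s) = f2 (munit a s) - (\<Sum>j\<in>J. f2 (munit j s) * f2 (munit a (\<tau> j)))"
      by (simp add: f3_def linf_diff[OF f2] linf_sum[OF f2] linf_scale[OF f2])
    also have "(\<Sum>j\<in>J. f2 (munit j s) * f2 (munit a (\<tau> j))) = (\<Sum>j\<in>J. if j = a then f2 (munit a s) else 0)"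
      using aJ by (intro sum.cong) (auto simp: f2J)
    finally show "f3 (munit a s) = 0" using aJ finite_J by simp
  qed
  then show ?thesis using that[of f3] d2 d3 by linarith
qed

lemma pindex_reduced_le: "pindex n P' \<le> pindex n P"
proof -
  obtain f1 where f1: "linf f1" "mv.dim (kirillov_ker n (pmat P) f1) = pindex n P"
    using pindex_attained .
  define X where "X i k = f1 (munit k (\<tau> i))" for i k
  let ?ft = "\<lambda>t x. f1 x + t * std x"
  let ?inv = "\<lambda>t. \<exists>Y. \<forall>i\<in>J. \<forall>j\<in>J.
      (\<Sum>k\<in>J. (X i k + (if i = k then t else 0)) * Y k j) = (if i = j then 1 else 0) \<and>
      (\<Sum>k\<in>J. Y i k * (X k j + (if k = j then t else 0))) = (if i = j then 1 else 0)"
  \<comment> \<open>Adding \<open>t * std\<close> shifts the pairing matrix \<open>X\<close> by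
    \<open>t\<close> on the diagonal. A \<open>t\<close> outside both finite sets makes the pairing
    invertible without enlarging the kernel.\<close>
  have "finite ({t. mv.dim (kirillov_ker n (pmat P) f1) < mv.dim (kirillov_ker n (pmat P) (?ft t))} \<union> {t. \<not> ?inv t})"
    by (intro finite_UnI finite_kernel_jumps[OF finite_P f1(1) linf_std] finite_singular_shifts[OF finite_J])
  then obtain t where t: "t \<notin> {t. mv.dim (kirillov_ker n (pmat P) f1) < mv.dim (kirillov_ker n (pmat P) (?ft t))} \<union> {t. \<not> ?inv t}"
    using ex_new_if_finite[OF infinite_UNIV_char_0[where 'a = complex]] by blast
  then obtain Y where Y: "\<forall>i\<in>J. \<forall>j\<in>J.
      (\<Sum>k\<in>J. (X i k + (if i = k then t else 0)) * Y k j) = (if i = j then 1 else 0) \<and>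
      (\<Sum>k\<in>J. Y i k * (X k j + (if k = j then t else 0))) = (if i = j then 1 else 0)"
    by blast
  have le: "mv.dim (kirillov_ker n (pmat P) (?ft t)) \<le> pindex n P" using t f1(2) by simp
  have ft: "linf (?ft t)" by (intro linf_plus f1 linf_times linf_std)
  have Xt: "?ft t (munit k (\<tau> i)) = X i k + (if i = k then t else 0)" if "i \<in> J" "k \<in> J" for i k
  proof -
    have "std (munit k (\<tau> i)) = (\<Sum>j\<in>J. if j = i then (if i = k then 1 else 0) else 0)"
      unfolding std_def munit_def using that tau_inj by (intro sum.cong) (auto simp: inj_on_def)
    then show ?thesis using that finite_J by (simp add: X_def)
  qed
  have "\<forall>i\<in>J. \<forall>j\<in>J. (\<Sum>k\<in>J. ?ft t (munit k (\<tau> i)) * Y k j) = (if i = j then 1 else 0) \<and>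
      (\<Sum>k\<in>J. Y i k * ?ft t (munit j (\<tau> k))) = (if i = j then 1 else 0)"
    using Y Xt by (simp cong: sum.cong)
  from exists_standard_conjugate[OF ft this] obtain g where
    g: "standard_functional n A R T J Q \<tau> g"
    "mv.dim (kirillov_ker n (pmat P) g) \<le> mv.dim (kirillov_ker n (pmat P) (?ft t))" .
  interpret standard_functional n A R T J Q \<tau> g by (rule g(1))
  show ?thesis using pindex_le[OF linf_f_phi, of n P'] dim_reduced_le_ker g(2) le by linarith
qed

theorem pindex_reduction: "pindex n P = pindex n P'"
  using pindex_le_reduced pindex_reduced_le by (rule antisym)

end

section \<open>Direct sums, transposes and the full matrix algebra\<close>

definition restr :: "(nat \<times> nat) set \<Rightarrow> cmat \<Rightarrow> cmat" where
  "restr P x = (\<lambda>i j. if (i, j) \<in> P then x i j else 0)"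

lemma mlinear_restr: "mlinear (restr P)"
  by (rule mlinearI) (auto simp: restr_def mscale_def fun_eq_iff)

lemma restr_pmat: "restr P x \<in> pmat P"
  by (auto simp: restr_def pmat_def)

lemma restr_id: "x \<in> pmat P \<Longrightarrow> restr P x = x"
  by (auto simp: restr_def pmat_def fun_eq_iff)

lemma bracket_disjoint:
  assumes "P1 \<subseteq> A \<times> A" "P2 \<subseteq> I \<times> I" "A \<inter> I = {}" "x \<in> pmat P1" "y \<in> pmat P2"
  shows "bracket n x y = 0"
proof -
  have "x i k * y k j = 0" "y i k * x k j = 0" for i k j
    using assms by (cases "k \<in> A"; force simp: pmat_def)+
  then show ?thesis by (simp add: bracket_def mmul_def fun_eq_iff)
qed

context
  fixes n :: nat and P1 P2 :: "(nat \<times> nat) set" and A I :: "nat set"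
  assumes P1: "P1 \<subseteq> A \<times> A" "finite P1" "trans P1" and P2: "P2 \<subseteq> I \<times> I" "finite P2" "trans P2"
    and AI: "A \<inter> I = {}"
begin

lemma P12_disj: "P1 \<inter> P2 = {}"
  using P1(1) P2(1) AI by blast

lemma split_pmat: "x \<in> pmat (P1 \<union> P2) \<Longrightarrow> x = restr P1 x + restr P2 x"
  using P12_disj by (auto simp: restr_def pmat_def fun_eq_iff)

lemma pmat_Un: "pmat P1 \<subseteq> pmat (P1 \<union> P2)" "pmat P2 \<subseteq> pmat (P1 \<union> P2)"
  by (auto intro!: pmat_mono)

lemma f_bracket_split:
  assumes f: "linf f" and x: "x \<in> pmat (P1 \<union> P2)" and y: "y \<in> pmat (P1 \<union> P2)"
  shows "f (bracket n x y) = f (bracket n (restr P1 x) (restr P1 y)) + f (bracket n (restr P2 x) (restr P2 y))"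
proof -
  have z: "bracket n (restr P1 u) (restr P2 v) = 0" for u v
    by (rule bracket_disjoint[OF P1(1) P2(1) AI restr_pmat restr_pmat])
  have z': "bracket n (restr P2 u) (restr P1 v) = 0" for u v
    unfolding bracket_swap[of n "restr P2 u"] z by simp
  have "bracket n x y = bracket n (restr P1 x + restr P2 x) (restr P1 y + restr P2 y)"
    using split_pmat[OF x] split_pmat[OF y] by simp
  also have "\<dots> = bracket n (restr P1 x) (restr P1 y) + bracket n (restr P2 x) (restr P2 y)"
    by (simp add: bracket_add_left bracket_add_right z z')
  finally show ?thesis by (simp add: linf_add[OF f])
qed

lemma dim_ker_direct_sum:
  assumes f: "linf f"
  shows "mv.dim (kirillov_ker n (pmat (P1 \<union> P2)) f) =
    mv.dim (kirillov_ker n (pmat P1) f) + mv.dim (kirillov_ker n (pmat P2) f)"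
proof (rule antisym)
  let ?K = "kirillov_ker n (pmat (P1 \<union> P2)) f"
  let ?K1 = "kirillov_ker n (pmat P1) f" and ?K2 = "kirillov_ker n (pmat P2) f"
  let ?F = "munits (P1 \<union> P2)"
  have F: "finite ?F" using P1 P2 by (simp add: finite_munits)
  have sp: "?K \<subseteq> mv.span ?F" by (rule kirillov_ker_span) (use P1 P2 in simp)
  have "pmat P1 \<subseteq> mv.span ?F" "pmat P2 \<subseteq> mv.span ?F"
    using pmat_Un pmat_span[of "P1 \<union> P2"] P1 P2 by auto
  then have sp1: "?K1 \<subseteq> mv.span ?F" and sp2: "?K2 \<subseteq> mv.span ?F"
    using kirillov_ker_subset by blast+
  have r1: "restr P1 y = y" "restr P2 y = 0" if "y \<in> pmat P1" for y
    using that P12_disj by (auto simp: restr_def pmat_def fun_eq_iff)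
  have r2: "restr P2 y = y" "restr P1 y = 0" if "y \<in> pmat P2" for y
    using that P12_disj by (auto simp: restr_def pmat_def fun_eq_iff)
  have z: "bracket n 0 y = 0" "bracket n x 0 = 0" for x y
    by (simp_all add: bracket_def mmul_zero)
  show "mv.dim ?K \<le> mv.dim ?K1 + mv.dim ?K2"
  proof (rule mv.dim_le_add[OF F sp1 sp2])
    fix x assume x: "x \<in> ?K"
    then have xp: "x \<in> pmat (P1 \<union> P2)" by (simp add: kirillov_ker_def)
    have fz: "f (bracket n x y) = 0" if "y \<in> pmat (P1 \<union> P2)" for y
      using x that by (simp add: kirillov_ker_def)
    have "f (bracket n (restr P1 x) y) = 0" if "y \<in> pmat P1" for y
      using fz[of y] f_bracket_split[OF f xp, of y] r1[OF that] that pmat_Un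
      by (auto simp: z linf_zero[OF f])
    then have "restr P1 x \<in> ?K1" by (simp add: kirillov_ker_def restr_pmat)
    moreover have "f (bracket n (restr P2 x) y) = 0" if "y \<in> pmat P2" for y
      using fz[of y] f_bracket_split[OF f xp, of y] r2[OF that] that pmat_Un
      by (auto simp: z linf_zero[OF f])
    then have "restr P2 x \<in> ?K2" by (simp add: kirillov_ker_def restr_pmat)
    ultimately show "\<exists>u\<in>?K1. \<exists>w\<in>?K2. x = u + w" using split_pmat[OF xp] by blast
  qed
  have sub1: "?K1 \<subseteq> ?K"
  proof
    fix x assume x: "x \<in> ?K1"
    then have x1: "x \<in> pmat P1" by (simp add: kirillov_ker_def)
    then have xp: "x \<in> pmat (P1 \<union> P2)" using pmat_Un by blast
    have "f (bracket n x y) = 0" if "y \<in> pmat (P1 \<union> P2)" for y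
      unfolding f_bracket_split[OF f xp that] r1[OF x1]
      using x restr_pmat[of P1 y] by (simp add: z linf_zero[OF f] kirillov_ker_def)
    then show "x \<in> ?K" using xp by (simp add: kirillov_ker_def)
  qed
  have sub2: "?K2 \<subseteq> ?K"
  proof
    fix x assume x: "x \<in> ?K2"
    then have x1: "x \<in> pmat P2" by (simp add: kirillov_ker_def)
    then have xp: "x \<in> pmat (P1 \<union> P2)" using pmat_Un by blast
    have "f (bracket n x y) = 0" if "y \<in> pmat (P1 \<union> P2)" for y
      unfolding f_bracket_split[OF f xp that] r2[OF x1]
      using x restr_pmat[of P2 y] by (simp add: z linf_zero[OF f] kirillov_ker_def)
    then show "x \<in> ?K" using xp by (simp add: kirillov_ker_def)
  qed
  have "?K1 \<inter> ?K2 \<subseteq> {0}"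
  proof
    fix x assume "x \<in> ?K1 \<inter> ?K2"
    then have "x \<in> pmat P1" "x \<in> pmat P2" by (auto simp: kirillov_ker_def)
    then have "x = 0" using r1(2) r2(1) by metis
    then show "x \<in> {0}" by simp
  qed
  then show "mv.dim ?K1 + mv.dim ?K2 \<le> mv.dim ?K"
    by (intro mv.dim_add_le[OF F sp subspace_kirillov_ker[OF f subspace_pmat] sub1
          subspace_kirillov_ker[OF f subspace_pmat] sub2])
qed

lemma pindex_direct_sum: "pindex n (P1 \<union> P2) = pindex n P1 + pindex n P2"
proof (rule antisym)
  obtain f1 where f1: "linf f1" "mv.dim (kirillov_ker n (pmat P1) f1) = pindex n P1"
    using pindex_attained .
  obtain f2 where f2: "linf f2" "mv.dim (kirillov_ker n (pmat P2) f2) = pindex n P2"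
    using pindex_attained .
  define f where "f x = f1 (restr P1 x) + f2 (restr P2 x)" for x
  have f: "linf f" unfolding f_def by (intro linf_plus linf_compose[OF _ mlinear_restr] f1 f2)
  have e1: "f x = f1 x" if "x \<in> pmat P1" for x
  proof -
    have "restr P2 x = 0" using that P12_disj by (auto simp: restr_def pmat_def fun_eq_iff)
    then show ?thesis using that by (simp add: f_def restr_id linf_zero[OF f2(1)])
  qed
  have e2: "f x = f2 x" if "x \<in> pmat P2" for x
  proof -
    have "restr P1 x = 0" using that P12_disj by (auto simp: restr_def pmat_def fun_eq_iff)
    then show ?thesis using that by (simp add: f_def restr_id linf_zero[OF f1(1)])
  qed
  have "kirillov_ker n (pmat P1) f = kirillov_ker n (pmat P1) f1"
    and "kirillov_ker n (pmat P2) f = kirillov_ker n (pmat P2) f2"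
    by (rule kirillov_ker_cong[OF P1(3) e1], assumption) (rule kirillov_ker_cong[OF P2(3) e2])
  then show "pindex n (P1 \<union> P2) \<le> pindex n P1 + pindex n P2"
    using pindex_le[OF f, of n "P1 \<union> P2"] dim_ker_direct_sum[OF f] f1 f2 by simp
  obtain g where g: "linf g" "mv.dim (kirillov_ker n (pmat (P1 \<union> P2)) g) = pindex n (P1 \<union> P2)"
    using pindex_attained .
  show "pindex n P1 + pindex n P2 \<le> pindex n (P1 \<union> P2)"
    using pindex_le[OF g(1), of n P1] pindex_le[OF g(1), of n P2] g(2) dim_ker_direct_sum[OF g(1)] by linarith
qed

end

text \<open>Transposition reverses brackets, and the resulting sign does not affect kernels.\<close>

lemma pindex_converse_le:
  assumes P: "finite P"
  shows "pindex n (P\<inverse>) \<le> pindex n P"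
proof -
  let ?T = "\<lambda>(x :: cmat) i j. x j i"
  have T: "mlinear ?T" by (rule mlinearI) (auto simp: mscale_def fun_eq_iff)
  have br: "bracket n (?T x) (?T y) = ?T (bracket n y x)" for x y
    by (simp add: bracket_def mmul_def fun_eq_iff mult.commute)
  obtain f where f: "linf f" "mv.dim (kirillov_ker n (pmat P) f) = pindex n P"
    using pindex_attained .
  have fT: "linf (\<lambda>x. f (?T x))" by (rule linf_compose[OF f(1) T])
  have "mv.dim (kirillov_ker n (pmat (P\<inverse>)) (\<lambda>x. f (?T x))) \<le> mv.dim (kirillov_ker n (pmat P) f)"
  proof (rule mvp.dim_le_of_inj_on[OF T])
    show "mv.subspace (kirillov_ker n (pmat (P\<inverse>)) (\<lambda>x. f (?T x)))"
      by (rule subspace_kirillov_ker[OF fT subspace_pmat])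
    show "inj_on ?T (kirillov_ker n (pmat (P\<inverse>)) (\<lambda>x. f (?T x)))"
      by (rule inj_on_inverseI[of _ ?T]) simp
    show "?T ` kirillov_ker n (pmat (P\<inverse>)) (\<lambda>x. f (?T x)) \<subseteq> kirillov_ker n (pmat P) f"
    proof clarify
      fix x assume x: "x \<in> kirillov_ker n (pmat (P\<inverse>)) (\<lambda>x. f (?T x))"
      have "f (bracket n (?T x) y) = 0" if "y \<in> pmat P" for y
      proof -
        have "?T y \<in> pmat (P\<inverse>)" using that by (simp add: pmat_def)
        then have "f (?T (bracket n x (?T y))) = 0" using x unfolding kirillov_ker_def by simp
        then have "f (bracket n y (?T x)) = 0" using br[of "?T y" x] by simp
        then show ?thesis unfolding bracket_swap[of n "?T x"] linf_uminus[OF f(1)] by simp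
      qed
      moreover have "?T x \<in> pmat P" using x by (simp add: pmat_def kirillov_ker_def)
      ultimately show "?T x \<in> kirillov_ker n (pmat P) f" by (simp add: kirillov_ker_def)
    qed
    show "finite (munits P)" by (rule finite_munits[OF P])
    show "kirillov_ker n (pmat P) f \<subseteq> mv.span (munits P)" by (rule kirillov_ker_span[OF P])
  qed
  then show ?thesis using pindex_le[OF fT, of n "P\<inverse>"] f(2) by linarith
qed

lemma pindex_converse: "finite P \<Longrightarrow> pindex n (P\<inverse>) = pindex n P"
  using pindex_converse_le[of P n] pindex_converse_le[of "P\<inverse>" n] by simp

lemma pindex_empty: "pindex n {} = 0"
proof -
  have "mv.dim (kirillov_ker n (pmat {}) (\<lambda>x. 0)) \<le> mv.dim (pmat {})"
    by (rule mv.dim_mono_span[OF _ pmat_span kirillov_ker_subset]) (simp_all add: finite_munits)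
  then show ?thesis using pindex_le[OF linf_0, of n "{}"] dim_pmat[of "{}"] by simp
qed

text \<open>The diagonal weights \<open>of_nat a\<close> are distinct, so the bracket with
  \<open>munit a b\<close> forces \<open>(b - a) * x b a = 0\<close>, and the kernel consists of
  diagonal matrices.\<close>

lemma pindex_full_le:
  assumes A: "A \<subseteq> {..<n}"
  shows "pindex n (A \<times> A) \<le> card A"
proof -
  have fA: "finite A" using A finite_subset by blast
  define f where "f x = (\<Sum>a\<in>A. of_nat a * x a a)" for x :: cmat
  have f: "linf f" unfolding f_def by (intro linf_Sum linf_times linf_entry)
  let ?D = "(\<lambda>a. (a, a)) ` A"
  have "kirillov_ker n (pmat (A \<times> A)) f \<subseteq> pmat ?D"
  proof
    fix x assume x: "x \<in> kirillov_ker n (pmat (A \<times> A)) f"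
    show "x \<in> pmat ?D"
    proof (rule pmatI)
      fix b a assume ba: "(b, a) \<notin> ?D"
      show "x b a = 0"
      proof (cases "a \<in> A \<and> b \<in> A")
        case True
        then have ab: "a \<noteq> b" "a < n" "b < n" using ba A by auto
        have "bracket n x (munit a b) = (\<lambda>k l. if l = b then x k a else 0) - (\<lambda>k l. if k = a then x b l else 0)"
          using mmul_munit_right[of a n x b] mmul_munit_left[of b n a x] ab by (simp add: bracket_def)
        then have "bracket n x (munit a b) k k = (if k = b then x k a else 0) - (if k = a then x b k else 0)" for k
          by (simp only: fun_diff_def)
        then have "f (bracket n x (munit a b)) =
            (\<Sum>k\<in>A. (if k = b then of_nat k * x k a else 0) - (if k = a then of_nat k * x b k else 0))"
          unfolding f_def by (intro sum.cong) (simp_all add: right_diff_distrib)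
        also have "\<dots> = (of_nat b - of_nat a) * x b a"
          unfolding sum_subtractf using True fA by (simp add: algebra_simps)
        finally have "(of_nat b - of_nat a) * x b a = 0"
          using x True munit_in_pmat[of a b "A \<times> A"] by (simp add: kirillov_ker_def)
        then show ?thesis using ab by simp
      next
        case False
        then show ?thesis using x by (auto simp: kirillov_ker_def pmat_def)
      qed
    qed
  qed
  then have "mv.dim (kirillov_ker n (pmat (A \<times> A)) f) \<le> mv.dim (pmat ?D)"
    by (intro mv.dim_mono_span[OF _ pmat_span]) (use fA in \<open>auto simp: finite_munits\<close>)
  also have "\<dots> = card A" using fA by (subst dim_pmat) (auto simp: card_image inj_on_def)
  finally show ?thesis using pindex_le[OF f, of n "A \<times> A"] by linarith
qed

text \<open>On the block \<open>f\<close> is the trace form against a matrix \<open>M\<close>.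
  Conjugating the functional conjugates \<open>M\<close>, which a Schur decomposition makes
  triangular.\<close>

lemma exists_triangular_conjugate:
  assumes op: "o' + p \<le> n" and f: "linf f"
  obtains g where "linf g" "\<And>a b. a \<in> {o'..<o'+p} \<Longrightarrow> b \<in> {o'..<o'+p} \<Longrightarrow> a < b \<Longrightarrow> g (munit a b) = 0"
    "mv.dim (kirillov_ker n (pmat ({o'..<o'+p} \<times> {o'..<o'+p})) g) \<le>
     mv.dim (kirillov_ker n (pmat ({o'..<o'+p} \<times> {o'..<o'+p})) f)"
proof -
  let ?A = "{o'..<o'+p}"
  have An: "?A \<subseteq> {..<n}" using op by auto
  \<comment> \<open>The indices are swapped so that \<open>f x\<close> is the trace of
    \<open>M\<close> times \<open>x\<close>. Then \<open>g (munit a b)\<close> is the entry of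
    \<open>B\<close> in row \<open>b\<close> and column \<open>a\<close>, below the diagonal if
    \<open>a < b\<close>.\<close>
  define M where "M = mat p p (\<lambda>(i, j). f (munit (o' + j) (o' + i)))"
  have M: "M \<in> carrier_mat p p" by (simp add: M_def)
  obtain es where es: "char_poly M = (\<Prod>a\<leftarrow>es. [:- a, 1:])" using char_poly_factorized[OF M] by blast
  obtain B S S' where sd: "schur_decomposition M es = (B, S, S')" by (metis prod_cases3)
  have wit: "similar_mat_wit M B S S'" and up: "upper_triangular B"
    using schur_decomposition[OF M es sd] by auto
  have c: "B \<in> carrier_mat p p" "S \<in> carrier_mat p p" "S' \<in> carrier_mat p p"
    and SS: "S * S' = 1\<^sub>m p" "S' * S = 1\<^sub>m p" and MB: "M = S * B * S'"
    using similar_mat_witD2[OF M wit] by auto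
  have B: "B = S' * M * S"
  proof -
    have "S' * M * S = S' * (S * B * S') * S" by (simp add: MB)
    also have "\<dots> = (S' * S) * B * (S' * S)" using c by (simp add: assoc_mult_mat[of _ p p _ p _ p])
    finally show ?thesis using SS c by simp
  qed
  define N where "N = (\<lambda>i j. if i \<in> ?A \<and> j \<in> ?A then S $$ (i - o', j - o') - (if i = j then 1 else 0) else 0)"
  define N' where "N' = (\<lambda>i j. if i \<in> ?A \<and> j \<in> ?A then S' $$ (i - o', j - o') - (if i = j then 1 else 0) else 0)"
  have NP: "N \<in> pmat (?A \<times> ?A)" "N' \<in> pmat (?A \<times> ?A)" by (auto simp: pmat_def N_def N'_def)
  have sh: "(\<Sum>k\<in>?A. h k) = (\<Sum>k\<in>{0..<p}. h (k + o'))" for h :: "nat \<Rightarrow> complex"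
    using sum.shift_bounds_nat_ivl[of h 0 o' p] by (simp add: add.commute)
  have mm: "mmul n U W i j = (\<Sum>k\<in>?A. U i k * W k j)" if "U \<in> pmat (?A \<times> ?A)" for U W i j
    unfolding mmul_def by (rule sum_restrict[OF An]) (use that in \<open>auto simp: pmat_def\<close>)
  have inv: "U + W + mmul n U W = 0"
    if U: "U = (\<lambda>i j. if i \<in> ?A \<and> j \<in> ?A then X $$ (i - o', j - o') - (if i = j then 1 else 0) else 0)"
      and W: "W = (\<lambda>i j. if i \<in> ?A \<and> j \<in> ?A then Y $$ (i - o', j - o') - (if i = j then 1 else 0) else 0)"
      and XY: "X \<in> carrier_mat p p" "Y \<in> carrier_mat p p" "X * Y = 1\<^sub>m p" for U W X Y
  proof (intro ext)
    fix i j
    have UP: "U \<in> pmat (?A \<times> ?A)" unfolding U by (auto simp: pmat_def)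
    show "(U + W + mmul n U W) i j = 0 i j"
    proof (cases "i \<in> ?A \<and> j \<in> ?A")
      case True
      then obtain i' j' where ij: "i = i' + o'" "j = j' + o'" "i' < p" "j' < p"
        by (metis add.commute add_less_cancel_left atLeastLessThan_iff le_add_diff_inverse)
      have "(\<Sum>k\<in>?A. U i k * W k j) = (\<Sum>k\<in>{0..<p}. (X $$ (i', k) - (if i' = k then 1 else 0)) * (Y $$ (k, j') - (if k = j' then 1 else 0)))"
        unfolding sh by (intro sum.cong) (auto simp: U W ij)
      also have "\<dots> = (\<Sum>k\<in>{0..<p}. X $$ (i', k) * Y $$ (k, j') - (if k = j' then X $$ (i', k) else 0)
          - (if i' = k then Y $$ (k, j') else 0) + (if i' = k then if i' = j' then 1 else 0 else 0))"
        by (intro sum.cong) (auto simp: algebra_simps)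
      also have "\<dots> = (\<Sum>k\<in>{0..<p}. X $$ (i', k) * Y $$ (k, j')) - X $$ (i', j') - Y $$ (i', j') + (if i' = j' then 1 else 0)"
        unfolding sum.distrib sum_subtractf using ij by simp
      also have "(\<Sum>k\<in>{0..<p}. X $$ (i', k) * Y $$ (k, j')) = (X * Y) $$ (i', j')"
        using XY(1,2) ij by (simp add: scalar_prod_def)
      finally have "mmul n U W i j = 2 * (if i' = j' then 1 else 0) - X $$ (i', j') - Y $$ (i', j')"
        unfolding mm[OF UP] using ij XY(3) by simp
      then show ?thesis using True by (simp add: U W ij)
    next
      case False
      then have "mmul n U W i j = 0"
        unfolding mm[OF UP] by (intro sum.neutral) (auto simp: U W)
      then show ?thesis using False by (auto simp: U W)
    qed
  qed
  have i1: "N' + N + mmul n N' N = 0" by (rule inv[OF N'_def N_def c(3,2) SS(2)])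
  have i2: "N + N' + mmul n N N' = 0" by (rule inv[OF N_def N'_def c(2,3) SS(1)])
  define g where "g x = f (conj1 n N N' x)" for x
  have g: "linf g" unfolding g_def by (rule linf_compose[OF f mlinear_conj1])
  have fin: "finite (?A \<times> ?A)" by simp
  have tr: "trans (?A \<times> ?A)" by (auto simp: trans_def)
  have "g (munit a b) = 0" if a: "a \<in> ?A" and b: "b \<in> ?A" and ab: "a < b" for a b
  proof -
    have an: "a < n" "b < n" using a b op by auto
    have ma: "munit a b \<in> pmat (?A \<times> ?A)" using a b by (intro munit_in_pmat) auto
    have e: "conj1 n N N' (munit a b) k l = S $$ (k - o', a - o') * S' $$ (b - o', l - o')"
      if "k \<in> ?A" "l \<in> ?A" for k l
    proof -
      have "mmul n (mmul n N (munit a b)) N' k l = N k a * N' b l"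
        unfolding mmul_munit_right[OF an(1)] using an
        by (simp add: mmul_def if_distrib[of "\<lambda>a. a * _"] cong: if_cong)
      then show ?thesis
        unfolding conj1_def mmul_munit_right[OF an(1)] mmul_munit_left[OF an(2)]
        using that a b by (auto simp: munit_def N_def N'_def algebra_simps)
    qed
    have "g (munit a b) = (\<Sum>q\<in>?A \<times> ?A. conj1 n N N' (munit a b) (fst q) (snd q) * f (munit (fst q) (snd q)))"
      unfolding g_def by (rule linf_expand[OF f fin conj1_pmat[OF tr NP ma]])
    also have "\<dots> = (\<Sum>k\<in>?A. \<Sum>l\<in>?A. S $$ (k - o', a - o') * S' $$ (b - o', l - o') * f (munit k l))"
      unfolding sum.cartesian_product by (intro sum.cong) (auto simp: e)
    also have "\<dots> = (\<Sum>k\<in>{0..<p}. \<Sum>l\<in>{0..<p}. S $$ (k, a - o') * S' $$ (b - o', l) * M $$ (l, k))"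
      unfolding sh by (intro sum.cong) (auto simp: M_def add.commute)
    also have "\<dots> = (\<Sum>k\<in>{0..<p}. (\<Sum>l\<in>{0..<p}. S' $$ (b - o', l) * M $$ (l, k)) * S $$ (k, a - o'))"
      by (simp add: sum_distrib_left mult.commute mult.left_commute)
    also have "\<dots> = (S' * M * S) $$ (b - o', a - o')"
    proof -
      have "a - o' < p" "b - o' < p" using a b by auto
      then show ?thesis
        using carrier_matD[OF c(2)] carrier_matD[OF c(3)] carrier_matD[OF M]
        by (simp add: scalar_prod_def del: assoc_mult_mat)
    qed
    also have "\<dots> = 0"
      unfolding B[symmetric] using upper_triangularD[OF up, of "a - o'" "b - o'"] a b ab c by auto
    finally show ?thesis .
  qed
  moreover have "mv.dim (kirillov_ker n (pmat (?A \<times> ?A)) g) \<le> mv.dim (kirillov_ker n (pmat (?A \<times> ?A)) f)"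
    using dim_ker_conj1_le[OF fin tr NP i1 i2 f] by (simp add: g_def[abs_def])
  ultimately show ?thesis using that g by blast
qed

text \<open>For the lower bound only upper triangular \<open>x\<close> are considered, a space of
  dimension \<open>card L + p\<close>. For \<open>a \<le> b\<close> the bracket of \<open>x\<close>
  with \<open>munit a b\<close> is strictly upper triangular, as its diagonal entries cancel, so
  \<open>g\<close> kills it. Only the \<open>card L\<close> conditions from \<open>b < a\<close>
  remain, and the kernel keeps dimension at least \<open>p\<close>.\<close>

lemma pindex_full:
  assumes op: "o' + p \<le> n"
  shows "pindex n ({o'..<o'+p} \<times> {o'..<o'+p}) = p"
proof (rule antisym)
  let ?A = "{o'..<o'+p}"
  have "?A \<subseteq> {..<n}" using op by auto
  from pindex_full_le[OF this] show "pindex n (?A \<times> ?A) \<le> p" by simp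
  obtain f where f: "linf f" "mv.dim (kirillov_ker n (pmat (?A \<times> ?A)) f) = pindex n (?A \<times> ?A)"
    using pindex_attained .
  obtain g where g: "linf g" "\<And>a b. a \<in> ?A \<Longrightarrow> b \<in> ?A \<Longrightarrow> a < b \<Longrightarrow> g (munit a b) = 0"
    and gf: "mv.dim (kirillov_ker n (pmat (?A \<times> ?A)) g) \<le> mv.dim (kirillov_ker n (pmat (?A \<times> ?A)) f)"
    using exists_triangular_conjugate[OF op f(1)] by metis
  define U where "U = {(a, b). a \<in> ?A \<and> b \<in> ?A \<and> a \<le> b}"
  define L where "L = {(a, b). a \<in> ?A \<and> b \<in> ?A \<and> b < a}"
  define U' where "U' = {(a, b). a \<in> ?A \<and> b \<in> ?A \<and> a < b}"
  have UA: "U \<subseteq> ?A \<times> ?A" "L \<subseteq> ?A \<times> ?A" "U' \<subseteq> ?A \<times> ?A" by (auto simp: U_def L_def U'_def)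
  then have fin: "finite U" "finite L" "finite U'" using finite_subset[OF _ finite_cartesian_product] by blast+
  have "U = U' \<union> (\<lambda>a. (a, a)) ` ?A" by (auto simp: U_def U'_def)
  moreover have "U' \<inter> (\<lambda>a. (a, a)) ` ?A = {}" by (auto simp: U'_def)
  moreover have "card ((\<lambda>a. (a, a)) ` ?A) = p" by (subst card_image) (auto simp: inj_on_def)
  moreover have "U' = prod.swap ` L" by (auto simp: U'_def L_def image_def)
  moreover have "card (prod.swap ` L) = card L" by (rule card_image) (auto simp: inj_on_def)
  ultimately have cU: "card U = card L + p" using fin by (simp add: card_Un_disjoint)
  let ?C = "{x \<in> pmat U. \<forall>q\<in>L. g (bracket n x (munit (fst q) (snd q))) = 0}"
  have "mv.dim (pmat U) \<le> mv.dim ?C + card L"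
    by (rule mv.dim_common_kernel[OF finite_munits[OF fin(1)] pmat_span[OF fin(1)] subspace_pmat fin(2)])
      (simp_all add: linf_add[OF linf_bracket_left[OF g(1)]] linf_scale[OF linf_bracket_left[OF g(1)]])
  then have "p \<le> mv.dim ?C" using dim_pmat[OF fin(1)] cU by simp
  also have "mv.dim ?C \<le> mv.dim (kirillov_ker n (pmat (?A \<times> ?A)) g)"
  proof (rule mv.dim_mono_span[of "munits (?A \<times> ?A)"])
    show "finite (munits (?A \<times> ?A))" by (simp add: finite_munits)
    show "kirillov_ker n (pmat (?A \<times> ?A)) g \<subseteq> mv.span (munits (?A \<times> ?A))" by (rule kirillov_ker_span) simp
    show "?C \<subseteq> kirillov_ker n (pmat (?A \<times> ?A)) g"
    proof
      fix x assume x: "x \<in> ?C"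
      then have xU: "x \<in> pmat U" by simp
      have "g (bracket n x y) = 0" if y: "y \<in> pmat (?A \<times> ?A)" for y
      proof (rule linf_zero_on_pmat[OF linf_bracket_right[OF g(1)] _ y])
        show "finite (?A \<times> ?A)" by simp
        fix a b assume "(a, b) \<in> ?A \<times> ?A"
        then have ab: "a \<in> ?A" "b \<in> ?A" "a < n" "b < n" using op by auto
        show "g (bracket n x (munit a b)) = 0"
        proof (cases "b < a")
          case True
          then have "(a, b) \<in> L" using ab by (simp add: L_def)
          then show ?thesis using x by force
        next
          case False
          have br: "bracket n x (munit a b) = (\<lambda>k l. if l = b then x k a else 0) - (\<lambda>k l. if k = a then x b l else 0)"
            using mmul_munit_right[of a n x b] mmul_munit_left[of b n a x] ab by (simp add: bracket_def)
          have "bracket n x (munit a b) \<in> pmat U'"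
          proof (rule pmatI)
            fix k l assume kl: "(k, l) \<notin> U'"
            have x0: "x i j = 0" if "\<not> (i \<in> ?A \<and> j \<in> ?A \<and> i \<le> j)" for i j
              using that by (intro pmatD[OF xU]) (simp add: U_def)
            have 1: "(if l = b then x k a else 0) = (if k = l \<and> k = a \<and> k = b then x a a else 0)"
            proof (cases "l = b \<and> k \<in> ?A \<and> k \<le> a")
              case True
              then have "k = a" "k = l" "k = b" using kl ab False by (auto simp: U'_def)
              then show ?thesis by simp
            qed (use x0[of k a] ab in auto)
            have 2: "(if k = a then x b l else 0) = (if k = l \<and> k = a \<and> k = b then x a a else 0)"
            proof (cases "k = a \<and> l \<in> ?A \<and> b \<le> l")
              case True
              then have "k = a" "k = l" "k = b" using kl ab False by (auto simp: U'_def)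
              then show ?thesis using True by simp
            qed (use x0[of b l] ab in auto)
            show "bracket n x (munit a b) k l = 0" unfolding br using 1 2 by simp
          qed
          then show ?thesis
            by (rule linf_zero_on_pmat[OF g(1) fin(3)]) (use g(2) in \<open>auto simp: U'_def\<close>)
        qed
      qed
      moreover have "x \<in> pmat (?A \<times> ?A)" using xU pmat_mono[OF UA(1)] by blast
      ultimately show "x \<in> kirillov_ker n (pmat (?A \<times> ?A)) g" by (simp add: kirillov_ker_def)
    qed
  qed
  finally show "p \<le> pindex n (?A \<times> ?A)" using gf f(2) by linarith
qed

section \<open>The index of a seaweed pattern\<close>

text \<open>The block upper triangular pattern of the ascending flag; its converse serves the
  descending one. The offset \<open>m\<close> is there because a reduction removes leading indices
  while the matrix size \<open>n\<close> stays fixed.\<close>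

fun upat :: "nat \<Rightarrow> nat list \<Rightarrow> (nat \<times> nat) set" where
  "upat m [] = {}"
| "upat m (p # as) = {m..<m+p} \<times> {m..<m+p+sum_list as} \<union> upat (m+p) as"

definition seapat :: "nat \<Rightarrow> nat list \<Rightarrow> nat list \<Rightarrow> (nat \<times> nat) set" where
  "seapat m a b = upat m a \<inter> (upat m b)\<inverse>"

lemma upat_range: "(i, j) \<in> upat m a \<Longrightarrow> m \<le> i \<and> m \<le> j \<and> i < m + sum_list a \<and> j < m + sum_list a"
  by (induction a arbitrary: m) force+

lemma upat_le: "m \<le> i \<Longrightarrow> i \<le> j \<Longrightarrow> j < m + sum_list a \<Longrightarrow> (i, j) \<in> upat m a"
proof (induction a arbitrary: m)
  case (Cons p a)
  then show ?case by (cases "i < m + p") auto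
qed simp

lemma trans_upat: "trans (upat m a)"
proof (induction a arbitrary: m)
  case (Cons p a)
  show ?case
  proof (rule transI)
    fix x y z assume xy: "(x, y) \<in> upat m (p # a)" and yz: "(y, z) \<in> upat m (p # a)"
    show "(x, z) \<in> upat m (p # a)"
      using xy yz upat_range[OF xy] upat_range[OF yz] upat_range[of x y "m + p" a]
        transD[OF Cons[of "m + p"], of x y z]
      by (cases "x < m + p") auto
  qed
qed simp

lemma trans_seapat: "trans (seapat m a b)"
  unfolding seapat_def by (intro trans_Int trans_upat) (simp add: trans_upat)

lemma seapat_range: "(i, j) \<in> seapat m a b \<Longrightarrow> m \<le> i \<and> m \<le> j \<and> i < m + sum_list a \<and> j < m + sum_list a"
  unfolding seapat_def using upat_range by blast

lemma seapat_sub: "seapat m a b \<subseteq> {m..<m+sum_list a} \<times> {m..<m+sum_list a}"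
  using seapat_range by fastforce

lemma finite_seapat: "finite (seapat m a b)"
  by (rule finite_subset[OF seapat_sub]) simp

lemma seapat_converse: "(seapat m a b)\<inverse> = seapat m b a"
  by (auto simp: seapat_def)

lemma seapat_zero [simp]: "seapat m (0 # a) b = seapat m a b" "seapat m a (0 # b) = seapat m a b"
  by (simp_all add: seapat_def)

text \<open>Brings the pattern into the shape
  \<open>A \<times> A \<union> A \<times> R \<union> Q\<close> of \<open>reduction_step\<close>,
  where \<open>Q\<close> is again a seaweed pattern.\<close>

lemma seapat_Cons:
  assumes pq: "p \<le> q" and s: "p + sum_list as = q + sum_list bs"
  shows "seapat m (p # as) (q # bs) =
    {m..<m+p} \<times> {m..<m+p} \<union> {m..<m+p} \<times> {m+p..<m+q} \<union> seapat (m+p) as ((q-p) # bs)"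
    (is "?L = ?R")
proof (rule Set.set_eqI)
  fix x :: "nat \<times> nat"
  obtain i j where x: "x = (i, j)" by force
  have r1: "(i, j) \<in> upat (m+p) as \<Longrightarrow> m + p \<le> i \<and> m + p \<le> j" using upat_range by blast
  have r2: "(j, i) \<in> upat (m+q) bs \<Longrightarrow> m + q \<le> i \<and> m + q \<le> j" using upat_range by blast
  have r1': "(i, j) \<in> upat (m+p) as \<Longrightarrow> i < m + q + sum_list bs"
    using upat_range[of i j "m+p" as] s by simp
  show "x \<in> ?L \<longleftrightarrow> x \<in> ?R"
    unfolding x seapat_def using pq s r1 r2 r1' by auto
qed

text \<open>Each summand is the amount by which the total size drops in a reduction that preserves
  the index. Equal first parts add nothing, since size and index then drop together. First parts 0
  must be allowed because \<open>q = 2 * p\<close> produces one.\<close>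

fun defect :: "nat list \<Rightarrow> nat list \<Rightarrow> nat" where
  "defect (p # as) (q # bs) =
    (if p = 0 then defect as (q # bs)
     else if q = 0 then defect (p # as) bs
     else if p = q then defect as bs
     else if p < q then
       (if 2 * p \<le> q then p + defect as ((q - 2 * p) # p # bs)
        else (q - p) + defect ((2 * p - q) # as) (p # bs))
     else
       (if 2 * q \<le> p then q + defect ((p - 2 * q) # q # as) bs
        else (p - q) + defect (q # as) ((2 * q - p) # bs)))"
| "defect [] b = 0"
| "defect (p # as) [] = 0"

text \<open>The matching is chosen so that the result is again a seaweed pattern. If
  \<open>2 * p \<le> q\<close>, the set \<open>A\<close> is matched with the last \<open>p\<close>
  indices of \<open>R\<close>, and removing \<open>S \<times> J'\<close> cuts the block of size
  \<open>q - p\<close> into \<open>q - 2 * p\<close> and \<open>p\<close>. Otherwise the first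
  \<open>q - p\<close> indices of \<open>A\<close> are matched with all of \<open>R\<close>, and the
  remaining ones stay adjacent to \<open>R\<close>.\<close>

lemma pindex_seapat_less:
  assumes p: "0 < p" "p < q" and s: "p + sum_list as = q + sum_list bs" and n: "m + p + sum_list as \<le> n"
  shows "pindex n (seapat m (p # as) (q # bs)) =
    (if 2 * p \<le> q then pindex n (seapat (m+p) as ((q - 2 * p) # p # bs))
     else pindex n (seapat (m+q-p) ((2 * p - q) # as) (p # bs)))"
proof -
  let ?A = "{m..<m+p}" and ?R = "{m+p..<m+q}" and ?T = "{m+q..<m+p+sum_list as}"
  let ?Q = "seapat (m+p) as ((q-p) # bs)"
  have Qsub: "?Q \<subseteq> (?R \<union> ?T) \<times> (?R \<union> ?T)"
  proof -
    have "{m+p..<m+p+sum_list as} = ?R \<union> ?T" using p s by auto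
    then show ?thesis using seapat_sub[of "m+p" as] by metis
  qed
  have QRT: "?Q \<inter> ?R \<times> ?T = {}"
  proof -
    have "(j, i) \<notin> upat (m + p) ((q - p) # bs)" if "i \<in> ?R" "j \<in> ?T" for i j
      using that p upat_range[of j i "m+q" bs] by auto
    then show ?thesis by (auto simp: seapat_def)
  qed
  have low: "(j, i) \<in> upat (m+p) ((q-p) # bs)" if "i \<in> ?R \<union> ?T" "j \<in> ?R" for i j
    using that p s by auto
  show ?thesis
  proof (cases "2 * p \<le> q")
    case True
    have SQ: "(?R - (\<lambda>j. j + (q - p)) ` ?A) \<times> (\<lambda>j. j + (q - p)) ` ?A \<subseteq> ?Q"
    proof (rule Set.subsetI)
      fix y assume "y \<in> (?R - (\<lambda>j. j + (q - p)) ` ?A) \<times> (\<lambda>j. j + (q - p)) ` ?A"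
      then obtain i j where y: "y = (i, j + (q - p))" and i: "i \<in> ?R" "i \<notin> (\<lambda>j. j + (q - p)) ` ?A"
        and j: "j \<in> ?A" by blast
      have "i < m + (q - p)"
      proof (rule ccontr)
        assume "\<not> i < m + (q - p)"
        then have "i = (i - (q - p)) + (q - p)" "i - (q - p) \<in> ?A" using i(1) p by auto
        then show False using i(2) by blast
      qed
      moreover have "j + (q - p) \<in> ?R" using j p True by auto
      ultimately show "y \<in> ?Q"
        unfolding y seapat_def using low[of i "j + (q - p)"] i(1) j p s
        by (auto intro!: upat_le)
    qed
    interpret st: reduction_step n ?A ?R ?T ?A ?Q "\<lambda>j. j + (q - p)"
      by unfold_locales (use Qsub QRT SQ trans_seapat p n True s in \<open>auto simp: inj_on_def\<close>)
    have J': "(\<lambda>j. j + (q - p)) ` ?A = {m+(q-p)..<m+q}"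
      using p image_add_atLeastLessThan'[of "q - p" m "m + p"] by (simp add: add.commute add.left_commute)
    have "st.P' = ?Q - {m+p..<m+(q-p)} \<times> {m+(q-p)..<m+q}"
      unfolding st.P'_def st.K_def st.S_def st.J'_def J' using p True by auto
    also have "\<dots> = seapat (m+p) as ((q - 2 * p) # p # bs)"
    proof (rule Set.set_eqI)
      fix x :: "nat \<times> nat"
      obtain i j where x: "x = (i, j)" by force
      have r1: "(i, j) \<in> upat (m+p) as \<Longrightarrow> m + p \<le> i \<and> m + p \<le> j \<and> i < m + q + sum_list bs"
        using upat_range[of i j "m+p" as] s by simp
      have r2: "(j, i) \<in> upat (m+q) bs \<Longrightarrow> m + q \<le> i \<and> m + q \<le> j" using upat_range by blast
      have e: "m + p + (q - p) = m + q" "m + p + (q - 2 * p) = m + (q - p)" "m + p + (q - 2 * p) + p = m + q"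
        using p True by auto
      show "x \<in> ?Q - {m+p..<m+(q-p)} \<times> {m+(q-p)..<m+q} \<longleftrightarrow> x \<in> seapat (m+p) as ((q - 2 * p) # p # bs)"
        unfolding x seapat_def upat.simps e using r1 r2 p True by auto
    qed
    finally have "st.P' = seapat (m+p) as ((q - 2 * p) # p # bs)" .
    moreover have "st.P = seapat m (p # as) (q # bs)"
      unfolding st.P_def using seapat_Cons[of p q as bs m] p s by simp
    ultimately show ?thesis using st.pindex_reduction True by simp
  next
    case False
    let ?J = "{m..<m+(q-p)}"
    have J': "(\<lambda>j. j + p) ` ?J = ?R"
      using p image_add_atLeastLessThan'[of p m "m + (q - p)"] by (simp add: add.commute add.left_commute)
    interpret st: reduction_step n ?A ?R ?T ?J ?Q "\<lambda>j. j + p"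
      by unfold_locales (use Qsub QRT trans_seapat p n False s J' in \<open>auto simp: inj_on_def\<close>)
    have K: "st.K = {m+q-p..<m+p}" unfolding st.K_def using p False by auto
    have "st.P' = st.K \<times> st.K \<union> st.K \<times> ?R \<union> ?Q"
      unfolding st.P'_def st.S_def st.J'_def J' by auto
    also have "\<dots> = seapat (m+q-p) ((2 * p - q) # as) (p # bs)"
    proof -
      have "m + q - p + (2 * p - q) = m + p" "m + q - p + p = m + q" "p - (2 * p - q) = q - p"
        using p False by auto
      then show ?thesis unfolding K using seapat_Cons[of "2 * p - q" p as bs "m+q-p"] p s False
        by (simp add: add.commute)
    qed
    finally have "st.P' = seapat (m+q-p) ((2 * p - q) # as) (p # bs)" .
    moreover have "st.P = seapat m (p # as) (q # bs)"
      unfolding st.P_def using seapat_Cons[of p q as bs m] p s by simp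
    ultimately show ?thesis using st.pindex_reduction False by simp
  qed
qed

lemma pindex_seapat_equal:
  assumes s: "sum_list as = sum_list bs" and n: "m + p + sum_list as \<le> n"
  shows "pindex n (seapat m (p # as) (p # bs)) = p + pindex n (seapat (m+p) as bs)"
proof -
  let ?A = "{m..<m+p}" and ?I = "{m+p..<m+p+sum_list as}"
  have "seapat m (p # as) (p # bs) = ?A \<times> ?A \<union> seapat (m+p) as bs"
    using seapat_Cons[of p p as bs m] s by simp
  moreover have "pindex n (?A \<times> ?A \<union> seapat (m+p) as bs) = pindex n (?A \<times> ?A) + pindex n (seapat (m+p) as bs)"
    by (rule pindex_direct_sum[of _ ?A _ ?I])
      (use seapat_sub[of "m+p" as bs] finite_seapat trans_seapat in \<open>auto simp: trans_def\<close>)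
  moreover have "pindex n (?A \<times> ?A) = p" by (rule pindex_full) (use n in simp)
  ultimately show ?thesis by simp
qed

lemma pindex_seapat_swap: "pindex n (seapat m a b) = pindex n (seapat m b a)"
  using pindex_converse[OF finite_seapat, of n m b a] by (simp add: seapat_converse)

theorem pindex_seapat:
  "sum_list a = sum_list b \<Longrightarrow> m + sum_list a \<le> n \<Longrightarrow> pindex n (seapat m a b) + defect a b = sum_list a"
proof (induction a b arbitrary: m rule: defect.induct)
  case (1 p as q bs)
  note s = "1.prems"(1) and n = "1.prems"(2)
  consider "p = 0" | "0 < p" "q = 0" | "0 < p" "p = q" | "0 < p" "p < q" "2 * p \<le> q" | "0 < p" "p < q" "\<not> 2 * p \<le> q"
    | "0 < q" "q < p" "2 * q \<le> p" | "0 < q" "q < p" "\<not> 2 * q \<le> p" by linarith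
  then show ?case
  proof cases
    case 1
    then show ?thesis using "1.IH"(1)[of m] s n by simp
  next
    case 2
    then show ?thesis using "1.IH"(2)[of m] s n by simp
  next
    case 3
    then show ?thesis using "1.IH"(3)[of "m + p"] pindex_seapat_equal[of as bs m p n] s n by simp
  next
    case 4
    have s': "sum_list (as) = sum_list ((q - 2 * p) # p # bs)" using 4 s by simp
    have "pindex n (seapat (m + p) (as) ((q - 2 * p) # p # bs)) + defect (as) ((q - 2 * p) # p # bs) = sum_list (as)"
      by (rule "1.IH"(4)) (use 4 s' n s in auto)
    moreover have "pindex n (seapat m (p # as) (q # bs)) = pindex n (seapat (m + p) (as) ((q - 2 * p) # p # bs))"
      using pindex_seapat_less[of p q as bs m n] 4 s n by simp
    moreover have "defect (p # as) (q # bs) = p + defect (as) ((q - 2 * p) # p # bs)" using 4 by simp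
    moreover have "p + sum_list (as) = p + sum_list as" using 4 s by simp
    ultimately show ?thesis unfolding sum_list.Cons by linarith
  next
    case 5
    have s': "sum_list ((2 * p - q) # as) = sum_list (p # bs)" using 5 s by simp
    have "pindex n (seapat (m + q - p) ((2 * p - q) # as) (p # bs)) + defect ((2 * p - q) # as) (p # bs) = sum_list ((2 * p - q) # as)"
      by (rule "1.IH"(5)) (use 5 s' n s in auto)
    moreover have "pindex n (seapat m (p # as) (q # bs)) = pindex n (seapat (m + q - p) ((2 * p - q) # as) (p # bs))"
      using pindex_seapat_less[of p q as bs m n] 5 s n by simp
    moreover have "defect (p # as) (q # bs) = (q - p) + defect ((2 * p - q) # as) (p # bs)" using 5 by simp
    moreover have "(q - p) + sum_list ((2 * p - q) # as) = p + sum_list as" using 5 s by simp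
    ultimately show ?thesis unfolding sum_list.Cons by linarith
  next
    case 6
    have s': "sum_list ((p - 2 * q) # q # as) = sum_list (bs)" using 6 s by simp
    have "pindex n (seapat (m + q) ((p - 2 * q) # q # as) (bs)) + defect ((p - 2 * q) # q # as) (bs) = sum_list ((p - 2 * q) # q # as)"
      by (rule "1.IH"(6)) (use 6 s' n s in auto)
    moreover have "pindex n (seapat m (p # as) (q # bs)) = pindex n (seapat (m + q) ((p - 2 * q) # q # as) (bs))"
      using pindex_seapat_less[of q p bs as m n] 6 s n
      by (subst (1 2) pindex_seapat_swap) simp
    moreover have "defect (p # as) (q # bs) = q + defect ((p - 2 * q) # q # as) (bs)" using 6 by simp
    moreover have "q + sum_list ((p - 2 * q) # q # as) = p + sum_list as" using 6 s by simp
    ultimately show ?thesis unfolding sum_list.Cons by linarith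
  next
    case 7
    have s': "sum_list (q # as) = sum_list ((2 * q - p) # bs)" using 7 s by simp
    have "pindex n (seapat (m + p - q) (q # as) ((2 * q - p) # bs)) + defect (q # as) ((2 * q - p) # bs) = sum_list (q # as)"
      by (rule "1.IH"(7)) (use 7 s' n s in auto)
    moreover have "pindex n (seapat m (p # as) (q # bs)) = pindex n (seapat (m + p - q) (q # as) ((2 * q - p) # bs))"
      using pindex_seapat_less[of q p bs as m n] 7 s n
      by (subst (1 2) pindex_seapat_swap) simp
    moreover have "defect (p # as) (q # bs) = (p - q) + defect (q # as) ((2 * q - p) # bs)" using 7 by simp
    moreover have "(p - q) + sum_list (q # as) = p + sum_list as" using 7 s by simp
    ultimately show ?thesis unfolding sum_list.Cons by linarith
  qed
next
  case (2 b)
  then show ?case by (simp add: seapat_def pindex_empty)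
next
  case (3 p as)
  then show ?case by (simp add: seapat_def pindex_empty)
qed

section \<open>The index of a seaweed subalgebra of the special linear algebra\<close>

text \<open>Non-recursive form of the pattern, needed to compare it with flags: every flag member
  that contains basis vector \<open>j\<close> also contains basis vector \<open>i\<close>.\<close>

lemma mem_upat_iff:
  "(i, j) \<in> upat m a \<longleftrightarrow> m \<le> i \<and> m \<le> j \<and> i < m + sum_list a \<and> j < m + sum_list a \<and>
    (\<forall>k\<le>length a. j < m + psum a k \<longrightarrow> i < m + psum a k)"
proof (induction a arbitrary: m)
  case Nil
  then show ?case by (simp add: psum_def)
next
  case (Cons p a)
  have all: "(\<forall>k\<le>length (p # a). Q k) \<longleftrightarrow> Q 0 \<and> (\<forall>k\<le>length a. Q (Suc k))" for Q
  proof safe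
    fix k assume "Q 0" "\<forall>k\<le>length a. Q (Suc k)" "k \<le> length (p # a)"
    then show "Q k" by (cases k) auto
  qed auto
  have ps: "psum (p # a) 0 = 0" "psum (p # a) (Suc k) = p + psum a k" for k
    by (simp_all add: psum_def)
  have p0: "psum a 0 = 0" by (simp add: psum_def)
  show ?case
  proof (cases "i < m + p")
    case True
    then show ?thesis unfolding all ps using upat_range[of i j "m + p" a] by auto
  next
    case False
    have "(\<forall>k\<le>length a. j < m + (p + psum a k) \<longrightarrow> i < m + (p + psum a k)) \<Longrightarrow> m + p \<le> j"
      using False p0 by (metis add.right_neutral linorder_not_less zero_le)
    then show ?thesis unfolding all ps upat.simps using Cons[of "m + p"] False by (auto simp: add.assoc)
  qed
qed

lemma preserves_iff:
  assumes "S \<subseteq> {..<n}"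
  shows "preserves n x S \<longleftrightarrow> (\<forall>r c. r < n \<longrightarrow> r \<notin> S \<longrightarrow> c \<in> S \<longrightarrow> x r c = 0)"
proof
  assume p: "preserves n x S"
  show "\<forall>r c. r < n \<longrightarrow> r \<notin> S \<longrightarrow> c \<in> S \<longrightarrow> x r c = 0"
  proof (intro allI impI)
    fix r c assume rc: "r < n" "r \<notin> S" "c \<in> S"
    then have "(\<Sum>k<n. x r k * (if k = c then 1 else 0)) = 0"
      using p unfolding preserves_def by (auto dest!: spec[of _ "\<lambda>k. if k = c then 1 else 0"])
    moreover have "c < n" using rc assms by auto
    ultimately show "x r c = 0" by (simp add: if_distrib[of "\<lambda>a. _ * a"] cong: if_cong)
  qed
next
  assume z: "\<forall>r c. r < n \<longrightarrow> r \<notin> S \<longrightarrow> c \<in> S \<longrightarrow> x r c = 0"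
  show "preserves n x S"
    unfolding preserves_def
  proof (intro allI impI sum.neutral ballI; elim conjE)
    fix v r k assume "\<forall>k. k \<notin> S \<longrightarrow> (v k :: complex) = 0" "r < n" "r \<notin> S"
    then show "x r k * v k = 0" using z by (cases "k \<in> S") auto
  qed
qed

lemma psum_le: "psum a k \<le> sum_list a"
  unfolding psum_def using sum_list_append[of "take k a" "drop k a"] by simp

lemma seaweed_eq:
  assumes a: "is_composition n a" and b: "is_composition n b"
  shows "seaweed n a b = {x \<in> pmat (seapat 0 a b). mtrace n x = 0}"
proof -
  have sa: "sum_list a = n" and sb: "sum_list b = n" using a b by (auto simp: is_composition_def)
  have "is_mat n x \<and> (\<forall>i\<in>{1..length a}. preserves n x {0..<psum a i}) \<and>
      (\<forall>j\<in>{0..length b}. preserves n x {psum b j..<n}) \<longleftrightarrow> x \<in> pmat (seapat 0 a b)" (is "?L \<longleftrightarrow> ?R") for x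
  proof -
    have p1: "preserves n x {0..<psum a i} \<longleftrightarrow> (\<forall>r c. r < n \<longrightarrow> c < psum a i \<longrightarrow> \<not> r < psum a i \<longrightarrow> x r c = 0)" for i
      using psum_le[of a i] sa by (subst preserves_iff) auto
    have p2: "preserves n x {psum b j..<n} \<longleftrightarrow> (\<forall>r c. r < n \<longrightarrow> c < n \<longrightarrow> r < psum b j \<longrightarrow> \<not> c < psum b j \<longrightarrow> x r c = 0)" for j
      using psum_le[of b j] sb by (subst preserves_iff) auto
    show ?thesis
    proof
      assume L: ?L
      show ?R
      proof (rule pmatI)
        fix r c assume "(r, c) \<notin> seapat 0 a b"
        then consider "n \<le> r \<or> n \<le> c"
          | k where "r < n" "k \<le> length a" "c < psum a k" "\<not> r < psum a k"
          | k where "c < n" "k \<le> length b" "r < psum b k" "\<not> c < psum b k"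
          unfolding seapat_def using sa sb
          by (cases "n \<le> r \<or> n \<le> c") (auto simp: mem_upat_iff linorder_not_less)
        then show "x r c = 0"
        proof cases
          case 1
          then show ?thesis using L by (auto simp: is_mat_def)
        next
          case 2
          \<comment> \<open>The definition of \<open>seaweed\<close> quantifies over flag members
            from 1 on; \<open>k = 0\<close> would give the empty initial segment, which contains no
            \<open>c\<close>.\<close>
          then have "k \<noteq> 0" by (auto simp: psum_def intro: ccontr)
          then have "k \<in> {1..length a}" using 2 by auto
          then show ?thesis using L 2 unfolding p1 by blast
        next
          case 3
          have "r < n" using 3 psum_le[of b k] sb by simp
          moreover have "k \<in> {0..length b}" using 3 by auto
          ultimately show ?thesis using L 3 unfolding p2 by blast
        qed
      qed
    next
      assume R: ?R
      have "x r c = 0" if "n \<le> r \<or> n \<le> c" for r c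
        using that sa by (intro pmatD[OF R]) (auto simp: seapat_def mem_upat_iff)
      moreover have "x r c = 0" if "i \<le> length a" "c < psum a i" "\<not> r < psum a i" for i r c
        using that by (intro pmatD[OF R]) (auto simp: seapat_def mem_upat_iff)
      moreover have "x r c = 0" if "j \<le> length b" "r < psum b j" "\<not> c < psum b j" for j r c
        using that by (intro pmatD[OF R]) (auto simp: seapat_def mem_upat_iff)
      ultimately show ?L unfolding p1 p2 is_mat_def by auto
    qed
  qed
  then show ?thesis unfolding seaweed_def by blast
qed

lemma mtrace_bracket: "mtrace n (bracket n x y) = 0"
proof -
  have "(\<Sum>i<n. \<Sum>k<n. x i k * y k i) = (\<Sum>i<n. \<Sum>k<n. y i k * x k i)"
    by (subst sum.swap) (simp add: mult.commute)
  then show ?thesis by (simp add: mtrace_def bracket_def mmul_def sum_subtractf)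
qed

lemma linf_mtrace: "linf (mtrace n)"
  unfolding mtrace_def by (intro linf_Sum linf_entry)

locale traceless_pattern =
  fixes n :: nat and P :: "(nat \<times> nat) set"
  assumes n: "0 < n" and P_sub: "P \<subseteq> {..<n} \<times> {..<n}" and P_trans: "trans P"
    and P_diag: "\<And>i. i < n \<Longrightarrow> (i, i) \<in> P"
begin

definition unit_mat :: cmat where "unit_mat = (\<lambda>i j. if i = j \<and> i < n then 1 else 0)"

definition sl :: "cmat set" where "sl = {x \<in> pmat P. mtrace n x = 0}"

definition tless :: "cmat \<Rightarrow> cmat" where "tless x = x - mscale (mtrace n x / of_nat n) unit_mat"

lemma finite_P: "finite P"
  using P_sub finite_subset by blast

lemma unit_pmat: "unit_mat \<in> pmat P"
  using P_diag by (auto simp: unit_mat_def pmat_def)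

lemma mtrace_unit: "mtrace n unit_mat = of_nat n"
  by (simp add: mtrace_def unit_mat_def)

lemma bracket_unit: "x \<in> pmat P \<Longrightarrow> bracket n unit_mat x = 0" "x \<in> pmat P \<Longrightarrow> bracket n x unit_mat = 0"
proof -
  assume x: "x \<in> pmat P"
  have z: "x i j = 0" if "n \<le> i \<or> n \<le> j" for i j
    using that P_sub by (intro pmatD[OF x]) auto
  have l: "mmul n unit_mat x = x"
  proof (intro ext)
    fix i j
    have "mmul n unit_mat x i j = (\<Sum>k<n. if k = i then x i j else 0)"
      unfolding mmul_def unit_mat_def by (intro sum.cong) auto
    then show "mmul n unit_mat x i j = x i j" using z[of i j] by auto
  qed
  have r: "mmul n x unit_mat = x"
  proof (intro ext)
    fix i j
    have "mmul n x unit_mat i j = (\<Sum>k<n. if k = j then x i j else 0)"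
      unfolding mmul_def unit_mat_def by (intro sum.cong) auto
    then show "mmul n x unit_mat i j = x i j" using z[of i j] by auto
  qed
  show "bracket n unit_mat x = 0" "bracket n x unit_mat = 0" by (simp_all add: bracket_def l r)
qed

lemma tless_sl: assumes "x \<in> pmat P" shows "tless x \<in> sl"
  using assms n mv.subspace_diff[OF subspace_pmat assms mv.subspace_scale[OF subspace_pmat unit_pmat]]
  by (simp add: sl_def tless_def linf_diff[OF linf_mtrace] linf_scale[OF linf_mtrace] mtrace_unit)

lemma tless_id: "x \<in> sl \<Longrightarrow> tless x = x"
  by (simp add: sl_def tless_def)

lemma bracket_tless: "x \<in> pmat P \<Longrightarrow> bracket n x (tless y) = bracket n x y"
  by (simp add: tless_def bracket_diff_right bracket_scale_right bracket_unit)

lemma bracket_tless_left: "x \<in> pmat P \<Longrightarrow> bracket n (tless y) x = bracket n y x"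
  by (simp add: tless_def bracket_diff_left bracket_scale_left bracket_unit)

lemma subspace_sl: "mv.subspace sl"
  using subspace_pmat[of P] unfolding mv.subspace_def sl_def
  by (auto simp: linf_add[OF linf_mtrace] linf_scale[OF linf_mtrace] linf_zero[OF linf_mtrace])

text \<open>The unit matrix is central, hence lies in every kernel, and subtracting a multiple of it
  changes no bracket. So the kernel in \<open>pmat P\<close> is the direct sum of the kernel in
  \<open>sl\<close> and the line of scalar matrices.\<close>

lemma dim_ker_sl:
  assumes f: "linf f"
  shows "mv.dim (kirillov_ker n (pmat P) f) = mv.dim (kirillov_ker n sl f) + 1"
proof (rule antisym)
  let ?K = "kirillov_ker n (pmat P) f" and ?L = "kirillov_ker n sl f" and ?F = "munits P"
  have F: "finite ?F" by (rule finite_munits[OF finite_P])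
  have sp: "?K \<subseteq> mv.span ?F" by (rule kirillov_ker_span[OF finite_P])
  have LK: "?L \<subseteq> ?K"
  proof
    fix x assume x: "x \<in> ?L"
    then have xs: "x \<in> pmat P" by (simp add: kirillov_ker_def sl_def)
    have "f (bracket n x y) = 0" if "y \<in> pmat P" for y
      using x tless_sl[OF that] bracket_tless[OF xs, of y] by (auto simp: kirillov_ker_def)
    then show "x \<in> ?K" using xs by (simp add: kirillov_ker_def)
  qed
  have unit0: "unit_mat \<noteq> 0" using mtrace_unit n linf_zero[OF linf_mtrace, of n] by auto
  have "unit_mat \<in> ?K" by (simp add: kirillov_ker_def unit_pmat bracket_unit linf_zero[OF f])
  then have UK: "mv.span {unit_mat} \<subseteq> ?K"
    by (intro mv.span_minimal subspace_kirillov_ker[OF f subspace_pmat]) simp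
  have dU: "mv.dim (mv.span {unit_mat}) = 1"
    using mv.dim_span_eq_card_independent[of "{unit_mat}"] unit0 by simp
  have "?L \<inter> mv.span {unit_mat} \<subseteq> {0}"
  proof
    fix x assume x: "x \<in> ?L \<inter> mv.span {unit_mat}"
    then obtain c where c: "x = mscale c unit_mat" unfolding mv.span_singleton by auto
    have "mtrace n x = 0" using x by (simp add: kirillov_ker_def sl_def)
    then have "c = 0" using n by (simp add: c linf_scale[OF linf_mtrace] mtrace_unit)
    then show "x \<in> {0}" by (simp add: c)
  qed
  then show "mv.dim ?L + 1 \<le> mv.dim ?K"
    using mv.dim_add_le[OF F sp subspace_kirillov_ker[OF f subspace_sl] LK mv.subspace_span UK] dU by simp
  have "mv.dim ?K \<le> mv.dim ?L + mv.dim (mv.span {unit_mat})"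
  proof (rule mv.dim_le_add[OF F subset_trans[OF LK sp] subset_trans[OF UK sp]])
    fix x assume x: "x \<in> ?K"
    then have xP: "x \<in> pmat P" by (simp add: kirillov_ker_def)
    have "f (bracket n (tless x) y) = 0" if "y \<in> sl" for y
      using x that bracket_tless_left[of y x] by (simp add: kirillov_ker_def sl_def)
    then have "tless x \<in> ?L" using tless_sl[OF xP] by (simp add: kirillov_ker_def)
    moreover have "mscale (mtrace n x / of_nat n) unit_mat \<in> mv.span {unit_mat}"
      by (intro mv.span_scale mv.span_base) simp
    moreover have "x = tless x + mscale (mtrace n x / of_nat n) unit_mat" by (simp add: tless_def)
    ultimately show "\<exists>u\<in>?L. \<exists>w\<in>mv.span {unit_mat}. x = u + w" by blast
  qed
  then show "mv.dim ?K \<le> mv.dim ?L + 1" using dU by simp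
qed

lemma lin_functional_sum:
  assumes f: "lin_functional sl f" and u: "\<And>p. p \<in> I \<Longrightarrow> u p \<in> sl" and "finite I"
  shows "f (\<Sum>p\<in>I. mscale (c p) (u p)) = (\<Sum>p\<in>I. c p * f (u p))"
  using \<open>finite I\<close> u
proof (induction I)
  case empty
  have "f (mscale 0 0) = 0 * f 0"
    using f mv.subspace_0[OF subspace_sl] unfolding lin_functional_def by blast
  then show ?case by (simp only: mv.scale_zero_left sum.empty mult_zero_left)
next
  case (insert q I)
  have "(\<Sum>p\<in>I. mscale (c p) (u p)) \<in> sl"
    using insert by (intro mv.subspace_sum[OF subspace_sl] mv.subspace_scale[OF subspace_sl]) auto
  moreover have "mscale (c q) (u q) \<in> sl" using insert by (intro mv.subspace_scale[OF subspace_sl]) auto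
  ultimately have add: "f (mscale (c q) (u q) + (\<Sum>p\<in>I. mscale (c p) (u p)))
      = f (mscale (c q) (u q)) + f (\<Sum>p\<in>I. mscale (c p) (u p))"
    using f unfolding lin_functional_def by blast
  have scl: "f (mscale (c q) (u q)) = c q * f (u q)"
    using f insert.prems unfolding lin_functional_def by blast
  have IH: "f (\<Sum>p\<in>I. mscale (c p) (u p)) = (\<Sum>p\<in>I. c p * f (u p))"
    using insert.prems by (intro insert.IH) simp
  show ?case by (simp only: sum.insert[OF insert.hyps] add scl IH)
qed

text \<open>\<open>f\<close> is constrained only on \<open>sl\<close>. The extension is
  \<open>f\<close> after \<open>tless\<close>, written in matrix entries so that it is linear on
  matrices outside the pattern as well.\<close>

lemma linf_extension:
  assumes f: "lin_functional sl f"
  obtains g where "linf g" "\<And>x. x \<in> sl \<Longrightarrow> g x = f x"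
proof
  let ?u = "\<lambda>p. tless (munit (fst p) (snd p))"
  let ?g = "\<lambda>x. \<Sum>p\<in>P. f (?u p) * x (fst p) (snd p)"
  show "linf ?g" by (intro linf_Sum linf_times linf_entry)
  have T: "mlinear tless"
    by (rule mlinearI) (simp_all add: tless_def linf_add[OF linf_mtrace] linf_scale[OF linf_mtrace]
        add_divide_distrib mv.scale_left_distrib mv.scale_right_diff_distrib)
  fix x assume x: "x \<in> sl"
  have "x = (\<Sum>p\<in>P. mscale (x (fst p) (snd p)) (munit (fst p) (snd p)))"
    using x by (intro pmat_expand[OF finite_P]) (simp add: sl_def)
  then have "tless x = (\<Sum>p\<in>P. mscale (x (fst p) (snd p)) (?u p))"
    using mvp.linear_sum[OF T, of "\<lambda>p. mscale (x (fst p) (snd p)) (munit (fst p) (snd p))" P]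
    unfolding mlinear_scale[OF T] by simp
  then have "f x = (\<Sum>p\<in>P. x (fst p) (snd p) * f (?u p))"
    using lin_functional_sum[OF f _ finite_P, of ?u "\<lambda>p. x (fst p) (snd p)"] tless_sl munit_in_pmat
    by (simp add: tless_id[OF x])
  then show "?g x = f x" by (simp add: mult.commute)
qed

lemma lie_index_sl: "lie_index n sl + 1 = pindex n P"
proof (rule antisym)
  have br: "bracket n x y \<in> sl" if "x \<in> sl" "y \<in> sl" for x y
    using that bracket_pmat[OF P_trans] by (simp add: sl_def mtrace_bracket)
  obtain F where F: "linf F" "mv.dim (kirillov_ker n (pmat P) F) = pindex n P" using pindex_attained .
  have "lin_functional sl F" using F(1) by (auto simp: lin_functional_def)
  then have "lie_index n sl \<le> mv.dim (kirillov_ker n sl F)"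
    unfolding lie_index_def by (intro Least_le) blast
  then show "lie_index n sl + 1 \<le> pindex n P" using dim_ker_sl[OF F(1)] F(2) by simp
  have "\<exists>f. lin_functional sl f \<and> mv.dim (kirillov_ker n sl f) = lie_index n sl"
    unfolding lie_index_def by (rule LeastI_ex) (use \<open>lin_functional sl F\<close> in blast)
  then obtain f where f: "lin_functional sl f" "mv.dim (kirillov_ker n sl f) = lie_index n sl" by blast
  obtain g where g: "linf g" "\<And>x. x \<in> sl \<Longrightarrow> g x = f x" using linf_extension[OF f(1)] by metis
  have "kirillov_ker n sl g = kirillov_ker n sl f"
    unfolding kirillov_ker_def using g(2) br by auto
  then show "pindex n P \<le> lie_index n sl + 1"
    using pindex_le[OF g(1), of n P] dim_ker_sl[OF g(1)] f(2) by simp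
qed

end

theorem lie_index_seaweed:
  assumes a: "is_composition n a" and b: "is_composition n b" and n: "0 < n"
  shows "lie_index n (seaweed n a b) + defect a b + 1 = n"
proof -
  have sa: "sum_list a = n" and sb: "sum_list b = n" using a b by (auto simp: is_composition_def)
  interpret traceless_pattern n "seapat 0 a b"
  proof
    show "seapat 0 a b \<subseteq> {..<n} \<times> {..<n}" using seapat_sub[of 0 a b] sa by (auto simp: atLeast0LessThan)
    show "(i, i) \<in> seapat 0 a b" if "i < n" for i
      using that sa sb by (auto simp: seapat_def intro!: upat_le)
  qed (use n trans_seapat in auto)
  have "seaweed n a b = sl" unfolding seaweed_eq[OF a b] sl_def ..
  then show ?thesis using lie_index_sl pindex_seapat[of a b 0 n] sa sb by simp
qed

section \<open>Counting pairs of compositions of defect two\<close>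

definition comps :: "nat \<Rightarrow> nat list set" where
  "comps n = {a. is_composition n a}"

definition paircount :: "nat \<Rightarrow> nat \<Rightarrow> (nat list \<Rightarrow> nat list \<Rightarrow> bool) \<Rightarrow> nat" where
  "paircount n m R = card {(a, b). a \<in> comps n \<and> b \<in> comps m \<and> R a b}"

text \<open>A reduction may yield a first part 0, which a composition cannot have. Dropping it keeps
  the defect and stays inside \<open>comps\<close>.\<close>

definition cons_pos :: "nat \<Rightarrow> nat list \<Rightarrow> nat list" where
  "cons_pos p l = (if p = 0 then l else p # l)"

lemma comps_Cons_iff: "p # a \<in> comps n \<longleftrightarrow> 0 < p \<and> p \<le> n \<and> a \<in> comps (n - p)"
  by (auto simp: comps_def is_composition_def)

lemma comps_0: "comps 0 = {[]}"
  by (auto simp: comps_def is_composition_def) (metis list.set_intros(1) neq_Nil_conv not_less_zero)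

lemma Nil_comps_iff: "[] \<in> comps n \<longleftrightarrow> n = 0"
  by (auto simp: comps_def is_composition_def)

lemma comps_rec: "0 < n \<Longrightarrow> comps n = (\<Union>p\<in>{1..n}. (#) p ` comps (n - p))"
proof (intro Set.set_eqI)
  fix a assume "0 < n"
  then show "a \<in> comps n \<longleftrightarrow> a \<in> (\<Union>p\<in>{1..n}. (#) p ` comps (n - p))"
    by (cases a) (auto simp: comps_Cons_iff Nil_comps_iff)
qed

lemma finite_comps: "finite (comps n)"
proof (induction n rule: less_induct)
  case (less n)
  then show ?case by (cases "n = 0") (auto simp: comps_0 comps_rec)
qed

lemma finite_pairs: "finite {(a, b). a \<in> comps n \<and> b \<in> comps m \<and> R a b}"
  by (rule finite_subset[of _ "comps n \<times> comps m"]) (auto simp: finite_comps)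

lemma paircount_cong:
  "(\<And>a b. a \<in> comps n \<Longrightarrow> b \<in> comps m \<Longrightarrow> R a b \<longleftrightarrow> R' a b) \<Longrightarrow> paircount n m R = paircount n m R'"
  unfolding paircount_def by (intro arg_cong[of _ _ card]) auto

lemma paircount_swap: "paircount n m R = paircount m n (\<lambda>b a. R a b)"
proof -
  have "{(b, a). b \<in> comps m \<and> a \<in> comps n \<and> R a b} = prod.swap ` {(a, b). a \<in> comps n \<and> b \<in> comps m \<and> R a b}"
    by force
  then show ?thesis unfolding paircount_def by (simp add: card_image)
qed

lemma paircount_False: "paircount n m (\<lambda>a b. False) = 0"
  by (simp add: paircount_def)

lemma paircount_split_left:
  assumes "0 < n"
  shows "paircount n m R = (\<Sum>p=1..n. paircount (n - p) m (\<lambda>a b. R (p # a) b))"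
proof -
  let ?f = "\<lambda>p (a, b). (p # a, b)"
  let ?S = "\<lambda>p. {(a, b). a \<in> comps (n - p) \<and> b \<in> comps m \<and> R (p # a) b}"
  have "{(a, b). a \<in> comps n \<and> b \<in> comps m \<and> R a b} = (\<Union>p\<in>{1..n}. ?f p ` ?S p)"
    using assms by (auto simp: comps_rec)
  then have "paircount n m R = card (\<Union>p\<in>{1..n}. ?f p ` ?S p)" by (simp add: paircount_def)
  also have "\<dots> = (\<Sum>p\<in>{1..n}. card (?f p ` ?S p))"
    by (rule card_UN_disjoint) (auto simp: finite_pairs intro!: finite_imageI)
  also have "\<dots> = (\<Sum>p=1..n. paircount (n - p) m (\<lambda>a b. R (p # a) b))"
    unfolding paircount_def by (intro sum.cong card_image) (auto simp: inj_on_def)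
  finally show ?thesis .
qed

lemma paircount_split_right:
  assumes "0 < m"
  shows "paircount n m R = (\<Sum>q=1..m. paircount n (m - q) (\<lambda>a b. R a (q # b)))"
  unfolding paircount_swap[of n m] paircount_split_left[OF assms]
  by (intro sum.cong refl paircount_swap)

lemma paircount_graph:
  assumes "\<And>b. b \<in> comps m \<Longrightarrow> g b \<in> comps n"
  shows "paircount n m (\<lambda>a b. a = g b) = card (comps m)"
proof -
  have "{(a, b). a \<in> comps n \<and> b \<in> comps m \<and> a = g b} = (\<lambda>b. (g b, b)) ` comps m"
    using assms by auto
  then show ?thesis unfolding paircount_def by (simp add: card_image inj_on_def)
qed

lemma paircount_graph':
  "(\<And>a. a \<in> comps n \<Longrightarrow> g a \<in> comps m) \<Longrightarrow> paircount n m (\<lambda>a b. b = g a) = card (comps n)"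
  unfolding paircount_swap[of n m] by (rule paircount_graph)

lemma sum_flip:
  fixes k n :: nat
  shows "k \<le> n \<Longrightarrow> (\<Sum>q=k..n. h (n - q)) = (\<Sum>i\<le>n - k. (h i :: nat))"
  by (rule sum.reindex_bij_witness[of _ "\<lambda>i. n - i" "\<lambda>q. n - q"]) auto

lemma card_comps: "card (comps n) = (if n = 0 then 1 else 2 ^ (n - 1))"
  and sum_card_comps: "(\<Sum>i\<le>n. card (comps i)) = 2 ^ n"
proof -
  have rec: "card (comps n) = (\<Sum>i\<le>n - 1. card (comps i))" if "0 < n" for n
  proof -
    have "card (comps n) = (\<Sum>p\<in>{1..n}. card ((#) p ` comps (n - p)))"
      unfolding comps_rec[OF that] by (rule card_UN_disjoint) (auto simp: finite_comps)
    also have "\<dots> = (\<Sum>p=1..n. card (comps (n - p)))"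
      by (intro sum.cong card_image) (auto simp: inj_on_def)
    finally show ?thesis using sum_flip[of 1 n "\<lambda>i. card (comps i)"] that by simp
  qed
  have s: "(\<Sum>i\<le>n. card (comps i)) = 2 ^ n" for n
  proof (induction n)
    case 0
    then show ?case by (simp add: comps_0)
  next
    case (Suc n)
    then show ?case using rec[of "Suc n"] by simp
  qed
  show "(\<Sum>i\<le>n. card (comps i)) = 2 ^ n" by (rule s)
  show "card (comps n) = (if n = 0 then 1 else 2 ^ (n - 1))"
    using rec[of n] s[of "n - 1"] by (simp add: comps_0)
qed

lemma sum_card_comps_diff: "k \<le> n \<Longrightarrow> (\<Sum>q=k..n. card (comps (n - q))) = 2 ^ (n - k)"
  using sum_flip[of k n "\<lambda>i. card (comps i)"] sum_card_comps by simp

section \<open>Pairs of compositions of small defect\<close>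

lemma defect_zero_left: "defect (0 # a) b = defect a b"
proof (cases b)
  case Nil
  then show ?thesis by (cases a) auto
qed simp

lemma defect_zero_right: "defect a (0 # b) = defect a b"
proof (induction a)
  case (Cons p a)
  show ?case
  proof (cases "p = 0")
    case True
    then show ?thesis using Cons by (simp add: defect_zero_left)
  qed simp
qed simp

lemma defect_cons_pos: "defect a (p # b) = defect a (cons_pos p b)" "defect (p # a) b = defect (cons_pos p a) b"
  by (simp_all add: cons_pos_def defect_zero_left defect_zero_right del: defect.simps)

lemma defect_less:
  assumes "0 < p" "p < q"
  shows "defect (p # as) (q # bs) =
    (if 2 * p \<le> q then p + defect as (cons_pos (q - 2 * p) (p # bs))
     else (q - p) + defect ((2 * p - q) # as) (p # bs))"
  using assms by (simp add: defect_cons_pos(1)[symmetric] del: defect.simps(1))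
    (simp add: defect.simps(1))

lemma defect_commute: "defect a b = defect b a"
proof (induction a b rule: defect.induct)
  case (1 p as q bs)
  consider "p = 0" | "0 < p" "q = 0" | "0 < p" "0 < q" by blast
  then show ?case
  proof cases
    case 1
    then show ?thesis using "1.IH"(1) by (simp add: defect_zero_left defect_zero_right del: defect.simps)
  next
    case 2
    then show ?thesis using "1.IH"(2) by (simp add: defect_zero_left defect_zero_right del: defect.simps)
  next
    case 3
    then show ?thesis
      using "1.IH"(3-7) by (auto simp: defect.simps(1)[of p as q bs] defect.simps(1)[of q bs p as]
          simp del: defect.simps)
  qed
next
  case (2 b)
  then show ?case by (cases b) auto
qed simp

lemma defect_pos:
  assumes "0 < p" "0 < q" "p \<noteq> q" shows "0 < defect (p # as) (q # bs)"
proof -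
  have "0 < defect (p # as) (q # bs)" if "0 < p" "p < q" for p q as bs
    using that by (simp add: defect_less del: defect.simps)
  then show ?thesis using assms defect_commute by (metis linorder_neqE_nat)
qed

lemma defect_same: "0 < p \<Longrightarrow> defect (p # as) (p # bs) = defect as bs"
  by simp

lemma defect_self: "defect a a = 0"
  by (induction a) (auto simp: defect_zero_left defect_zero_right)

declare defect.simps(1) [simp del]

text \<open>Distinct first parts already cost something by \<open>defect_pos\<close>, so with defect
  0 all parts must cancel one by one.\<close>

lemma defect_eq_0_iff:
  assumes "a \<in> comps n" "b \<in> comps n" shows "defect a b = 0 \<longleftrightarrow> a = b"
proof
  show "defect a b = 0" if "a = b" using that defect_self by simp
  show "a = b" if "defect a b = 0" using assms that
  proof (induction a arbitrary: b n)
    case Nil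
    then show ?case by (simp add: Nil_comps_iff comps_0)
  next
    case (Cons p a)
    then obtain q b' where b: "b = q # b'" by (cases b) (auto simp: comps_Cons_iff Nil_comps_iff)
    have "p = q" using Cons.prems defect_pos[of p q a b'] by (auto simp: b comps_Cons_iff)
    then show ?case using Cons.prems Cons.IH[of "n - p" b'] by (auto simp: b comps_Cons_iff defect_same)
  qed
qed

lemma cons_pos_comps: "x \<le> n \<Longrightarrow> l \<in> comps (n - x) \<Longrightarrow> cons_pos x l \<in> comps n"
  by (auto simp: cons_pos_def comps_Cons_iff)

text \<open>If \<open>2 * p > q\<close>, the step costs \<open>q - p\<close> and leaves distinct
  first parts \<open>2 * p - q\<close> and \<open>p\<close>, so at least 2 in total. Otherwise it
  costs \<open>p\<close>, which forces \<open>p = 1\<close> and equality of what remains.\<close>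

lemma defect_eq_1_iff:
  assumes p: "0 < p" "p < q" "q \<le> n" and a: "as \<in> comps (n - p)" and b: "bs \<in> comps (n - q)"
  shows "defect (p # as) (q # bs) = 1 \<longleftrightarrow> p = 1 \<and> as = cons_pos (q - 2) (1 # bs)"
proof (cases "2 * p \<le> q")
  case True
  have c: "cons_pos (q - 2 * p) (p # bs) \<in> comps (n - p)"
    using p True b by (intro cons_pos_comps) (auto simp: comps_Cons_iff)
  show ?thesis
    using True p defect_eq_0_iff[OF a c] by (auto simp: defect_less simp del: defect.simps)
next
  case False
  then have "0 < defect ((2 * p - q) # as) (p # bs)" using p by (intro defect_pos) auto
  moreover have "defect (p # as) (q # bs) = (q - p) + defect ((2 * p - q) # as) (p # bs)"
    using defect_less[OF p(1,2)] False by (simp only: if_False)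
  ultimately show ?thesis using False p by auto
qed

text \<open>A first step of cost \<open>p\<close> is either \<open>p = 1\<close> with defect 1 left
  over, or \<open>p = 2\<close> with nothing left over. A first step of cost \<open>q - p\<close>
  leaves distinct first parts, so \<open>q = p + 1\<close>, and the next step between
  \<open>p - 1\<close> and \<open>p\<close> must have defect 1; this forces \<open>p = 2\<close> and
  \<open>q = 3\<close>.\<close>

lemma defect_eq_2_iff:
  assumes p: "0 < p" "p < q" "q \<le> n" and a: "as \<in> comps (n - p)" and b: "bs \<in> comps (n - q)"
  shows "defect (p # as) (q # bs) = 2 \<longleftrightarrow>
    p = 1 \<and> defect as (cons_pos (q - 2) (1 # bs)) = 1 \<or>
    p = 2 \<and> as = (if q = 3 then 1 # bs else cons_pos (q - 4) (2 # bs))"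
proof (cases "2 * p \<le> q")
  case True
  have c: "cons_pos (q - 2 * p) (p # bs) \<in> comps (n - p)"
    using p True b by (intro cons_pos_comps) (auto simp: comps_Cons_iff)
  consider "p = 1" | "p = 2" | "3 \<le> p" using p by linarith
  then show ?thesis
    using True p defect_eq_0_iff[OF a c] by cases (auto simp: defect_less simp del: defect.simps)
next
  case False
  then have pos: "0 < defect ((2 * p - q) # as) (p # bs)" using p by (intro defect_pos) auto
  show ?thesis
  proof (cases "q = p + 1")
    case True
    then have p2: "2 \<le> p" using False by simp
    \<comment> \<open>The step has lowered the total size by \<open>q - p = 1\<close>, and
      \<open>defect_eq_1_iff\<close> is applied with first parts \<open>p - 1\<close> and
      \<open>p\<close>.\<close>
    have a': "as \<in> comps ((n - 1) - (p - 1))" and b': "bs \<in> comps ((n - 1) - p)"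
      using a b True p2 by (simp_all add: Suc_diff_Suc)
    have "defect (p # as) (q # bs) = 1 + defect ((p - 1) # as) (p # bs)"
      using True False p by (simp add: defect_less del: defect.simps)
    moreover have "defect ((p - 1) # as) (p # bs) = 1 \<longleftrightarrow> p - 1 = 1 \<and> as = cons_pos (p - 2) (1 # bs)"
      by (rule defect_eq_1_iff[OF _ _ _ a' b']) (use p p2 True in auto)
    ultimately have iff: "defect (p # as) (q # bs) = 2 \<longleftrightarrow> p - 1 = 1 \<and> as = cons_pos (p - 2) (1 # bs)"
      by simp
    show ?thesis
    proof (cases "p = 2")
      case p2: True
      then have "q = 3" using True by simp
      then show ?thesis unfolding iff using p2 by (simp add: cons_pos_def)
    next
      case False
      then have "p - 1 \<noteq> 1" "p \<noteq> 1" using p2 by auto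
      then show ?thesis unfolding iff using False by simp
    qed
  next
    case ne: False
    have "defect (p # as) (q # bs) = (q - p) + defect ((2 * p - q) # as) (p # bs)"
      using defect_less[OF p(1,2)] False by (simp only: if_False)
    then have d: "defect (p # as) (q # bs) \<noteq> 2" using pos ne p by linarith
    have "\<not> (p = 1 \<or> p = 2)" using False p ne by auto
    then show ?thesis using d by simp
  qed
qed

section \<open>Recursions for the number of pairs of given defect\<close>

definition defcount :: "nat \<Rightarrow> nat \<Rightarrow> nat" where
  "defcount k n = paircount n n (\<lambda>a b. defect a b = k)"

lemma sum_split_at:
  fixes x m :: nat
  assumes "x \<in> {1..m}"
  shows "(\<Sum>p=1..m. h p) = (\<Sum>p\<in>{1..<x}. h p) + h x + (\<Sum>p=x+1..m. (h p :: nat))"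
proof -
  have "{1..m} = ({1..<x} \<union> {x}) \<union> {x+1..m}" using assms by auto
  moreover have "(\<Sum>p\<in>({1..<x} \<union> {x}) \<union> {x+1..m}. h p) = (\<Sum>p\<in>{1..<x} \<union> {x}. h p) + (\<Sum>p=x+1..m. h p)"
    by (rule sum.union_disjoint) auto
  moreover have "(\<Sum>p\<in>{1..<x} \<union> {x}. h p) = (\<Sum>p\<in>{1..<x}. h p) + (\<Sum>p\<in>{x}. h p)"
    by (rule sum.union_disjoint) auto
  ultimately show ?thesis by (simp only: sum.insert finite.emptyI empty_iff sum.empty) simp
qed

lemma sum_square_symmetric:
  fixes G :: "nat \<Rightarrow> nat \<Rightarrow> nat"
  assumes "\<And>p q. p \<in> {1..n} \<Longrightarrow> q \<in> {1..n} \<Longrightarrow> G p q = G q p"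
  shows "(\<Sum>p=1..n. \<Sum>q=1..n. G p q) = (\<Sum>p=1..n. G p p) + 2 * (\<Sum>p=1..n. \<Sum>q=p+1..n. G p q)"
proof -
  have "(\<Sum>p=1..n. \<Sum>q=1..n. G p q) = (\<Sum>p=1..n. G p p + (\<Sum>q=p+1..n. G p q) + (\<Sum>q\<in>{1..<p}. G p q))"
  proof (rule sum.cong)
    fix p assume "p \<in> {1..n}"
    then show "(\<Sum>q=1..n. G p q) = G p p + (\<Sum>q=p+1..n. G p q) + (\<Sum>q\<in>{1..<p}. G p q)"
      using sum_split_at[of p n "G p"] by linarith
  qed simp
  also have "\<dots> = (\<Sum>p=1..n. G p p) + (\<Sum>p=1..n. \<Sum>q=p+1..n. G p q) + (\<Sum>p=1..n. \<Sum>q\<in>{1..<p}. G p q)"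
    by (simp add: sum.distrib)
  also have "(\<Sum>p=1..n. \<Sum>q\<in>{1..<p}. G p q) = (\<Sum>q=1..n. \<Sum>p=q+1..n. G p q)"
    unfolding sum.Sigma[OF finite_atLeastAtMost ballI[OF finite_atLeastLessThan]]
      sum.Sigma[OF finite_atLeastAtMost ballI[OF finite_atLeastAtMost]]
    by (rule sum.reindex_bij_witness[of _ prod.swap prod.swap]) auto
  also have "\<dots> = (\<Sum>p=1..n. \<Sum>q=p+1..n. G p q)"
    using assms by (intro sum.cong) auto
  finally show ?thesis by simp
qed

text \<open>The pairs are sorted by their first parts. Equal first parts cancel and leave a pair of
  smaller size; unequal ones form two halves exchanged by \<open>defect_commute\<close>.\<close>

lemma defcount_rec:
  assumes n: "0 < n"
  shows "defcount k n = (\<Sum>p=1..n. defcount k (n - p)) +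
    2 * (\<Sum>p=1..n. \<Sum>q=p+1..n. paircount (n - p) (n - q) (\<lambda>a b. defect (p # a) (q # b) = k))"
proof -
  let ?G = "\<lambda>p q. paircount (n - p) (n - q) (\<lambda>a b. defect (p # a) (q # b) = k)"
  have "defcount k n = (\<Sum>p=1..n. paircount (n - p) n (\<lambda>a b. defect (p # a) b = k))"
    unfolding defcount_def by (rule paircount_split_left[OF n])
  also have "\<dots> = (\<Sum>p=1..n. \<Sum>q=1..n. ?G p q)"
    by (intro sum.cong refl paircount_split_right[OF n])
  also have "\<dots> = (\<Sum>p=1..n. ?G p p) + 2 * (\<Sum>p=1..n. \<Sum>q=p+1..n. ?G p q)"
  proof (rule sum_square_symmetric)
    show "?G p q = ?G q p" for p q
      unfolding paircount_swap[of "n - p"] using defect_commute by (intro paircount_cong) metis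
  qed
  also have "(\<Sum>p=1..n. ?G p p) = (\<Sum>p=1..n. defcount k (n - p))"
    unfolding defcount_def by (intro sum.cong refl paircount_cong) (simp add: defect_same)
  finally show ?thesis .
qed

lemma defcount_0: "0 < k \<Longrightarrow> defcount k 0 = 0"
proof -
  assume "0 < k"
  then have "{(a, b). a \<in> comps 0 \<and> b \<in> comps 0 \<and> defect a b = k} = {}" by (auto simp: comps_0)
  then show ?thesis by (simp only: defcount_def paircount_def card.empty)
qed

lemma sum_head: "1 \<le> (n :: nat) \<Longrightarrow> (\<Sum>p=1..n. h p) = h 1 + (\<Sum>p=2..n. (h p :: nat))"
  using sum.atLeast_Suc_atMost[of 1 n h] by (simp add: numeral_2_eq_2)

lemma sum_head2: "2 \<le> (n :: nat) \<Longrightarrow> (\<Sum>p=2..n. h p) = h 2 + (\<Sum>p=3..n. (h p :: nat))"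
  using sum.atLeast_Suc_atMost[of 2 n h] by (simp add: numeral_3_eq_3 numeral_2_eq_2)

lemma cons_pos_graph:
  assumes "2 \<le> q" "q \<le> n" "b \<in> comps (n - q)"
  shows "cons_pos (q - 2) (1 # b) \<in> comps (n - 1)"
  using assms by (intro cons_pos_comps) (auto simp: comps_Cons_iff)

lemma defcount_1_rec:
  assumes n: "0 < n"
  shows "defcount 1 n = (\<Sum>p=1..n. defcount 1 (n - p)) + (if 2 \<le> n then 2 ^ (n - 1) else 0)"
proof -
  have G: "paircount (n - p) (n - q) (\<lambda>a b. defect (p # a) (q # b) = 1) = (if p = 1 then card (comps (n - q)) else 0)"
    if "1 \<le> p" "p < q" "q \<le> n" for p q
  proof -
    have "paircount (n - p) (n - q) (\<lambda>a b. defect (p # a) (q # b) = 1)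
        = paircount (n - p) (n - q) (\<lambda>a b. p = 1 \<and> a = cons_pos (q - 2) (1 # b))"
      using that by (intro paircount_cong defect_eq_1_iff) auto
    also have "\<dots> = (if p = 1 then card (comps (n - q)) else 0)"
    proof (cases "p = 1")
      case True
      then show ?thesis
        using paircount_graph[of "n - q" "\<lambda>b. cons_pos (q - 2) (1 # b)" "n - 1"] cons_pos_graph[of q n] that
        by simp
    qed (simp add: paircount_False)
    finally show ?thesis .
  qed
  have "(\<Sum>p=1..n. \<Sum>q=p+1..n. paircount (n - p) (n - q) (\<lambda>a b. defect (p # a) (q # b) = 1))
      = (\<Sum>p=1..n. \<Sum>q=p+1..n. if p = 1 then card (comps (n - q)) else 0)"
    using G by (intro sum.cong refl) auto
  also have "\<dots> = (\<Sum>q=2..n. card (comps (n - q)))"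
    using sum_head[of n "\<lambda>p. \<Sum>q=p+1..n. if p = 1 then card (comps (n - q)) else 0"] n
    by (simp add: numeral_2_eq_2)
  also have "\<dots> = (if 2 \<le> n then 2 ^ (n - 2) else 0)" using sum_card_comps_diff[of 2 n] by auto
  finally have S: "(\<Sum>p=1..n. \<Sum>q=p+1..n. paircount (n - p) (n - q) (\<lambda>a b. defect (p # a) (q # b) = 1))
      = (if 2 \<le> n then 2 ^ (n - 2) else 0)" .
  have "2 * (if 2 \<le> n then 2 ^ (n - 2) else 0) = (if 2 \<le> n then 2 ^ (n - 1) else (0::nat))"
  proof (cases "2 \<le> n")
    case True
    then obtain k where "n = k + 2" by (metis add.commute le_Suc_ex)
    then show ?thesis by simp
  qed simp
  then show ?thesis using defcount_rec[OF n, of 1] unfolding S by (simp only:)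
qed

text \<open>The sum at \<open>Suc n\<close> is \<open>F n\<close> plus the sum at \<open>n\<close>,
  so subtracting consecutive instances removes the convolution. The statement is additive to avoid
  subtraction on \<open>nat\<close>.\<close>

lemma convolution_step:
  fixes F g :: "nat \<Rightarrow> nat"
  assumes "\<And>n. 0 < n \<Longrightarrow> F n = (\<Sum>p=1..n. F (n - p)) + g n" and "0 < n"
  shows "F (Suc n) + g n = 2 * F n + g (Suc n)"
proof -
  have "(\<Sum>p=1..Suc n. F (Suc n - p)) = F n + (\<Sum>p=1..n. F (n - p))"
    using sum_flip[of 1 "Suc n" F] sum_flip[of 1 n F] \<open>0 < n\<close> by (cases n) auto
  then show ?thesis using assms(1)[of "Suc n"] assms(1)[OF assms(2)] by simp
qed

lemma defcount_1: "defcount 1 0 = 0" "defcount 1 1 = 0" "defcount 1 (n + 2) = (n + 2) * 2 ^ n"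
proof -
  show "defcount 1 0 = 0" by (simp add: defcount_0)
  show d1: "defcount 1 1 = 0" using defcount_1_rec[of 1] defcount_0[of 1] by simp
  show "defcount 1 (n + 2) = (n + 2) * 2 ^ n"
  proof (induction n)
    case 0
    then show ?case using convolution_step[OF defcount_1_rec, of 1] d1 by simp
  next
    case (Suc n)
    then show ?case using convolution_step[OF defcount_1_rec, of "n + 2"]
      by (simp add: algebra_simps)
  qed
qed

section \<open>Pairs of defect two\<close>

text \<open>The pairs that remain for defect two when the first parts are \<open>1 < x + 2\<close>.\<close>
definition markcount :: "nat \<Rightarrow> nat \<Rightarrow> nat" where
  "markcount m x = paircount m (m - 1 - x) (\<lambda>a t. defect a (cons_pos x (1 # t)) = 1)"

text \<open>A first part 1 of \<open>a\<close> cancels against the leading 1. A first part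
  \<open>p \<ge> 2\<close> makes a step of cost one that determines \<open>t\<close> from the rest
  of \<open>a\<close>.\<close>

lemma markcount_0:
  assumes m: "0 < m"
  shows "markcount m 0 = defcount 1 (m - 1) + (if 2 \<le> m then 2 ^ (m - 2) else 0)"
proof -
  have "markcount m 0 = (\<Sum>p=1..m. paircount (m - p) (m - 1) (\<lambda>a t. defect (p # a) (1 # t) = 1))"
    unfolding markcount_def paircount_split_left[OF m] by (simp add: cons_pos_def del: defect.simps)
  also have "\<dots> = paircount (m - 1) (m - 1) (\<lambda>a t. defect (1 # a) (1 # t) = 1)
      + (\<Sum>p=2..m. paircount (m - p) (m - 1) (\<lambda>a t. defect (p # a) (1 # t) = 1))"
    using m by (intro sum_head) simp
  also have "paircount (m - 1) (m - 1) (\<lambda>a t. defect (1 # a) (1 # t) = 1) = defcount 1 (m - 1)"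
    unfolding defcount_def by (intro paircount_cong) (simp add: defect_same)
  also have "(\<Sum>p=2..m. paircount (m - p) (m - 1) (\<lambda>a t. defect (p # a) (1 # t) = 1))
      = (\<Sum>p=2..m. card (comps (m - p)))"
  proof (rule sum.cong[OF refl])
    fix p assume p: "p \<in> {2..m}"
    have "paircount (m - p) (m - 1) (\<lambda>a t. defect (p # a) (1 # t) = 1)
        = paircount (m - p) (m - 1) (\<lambda>a t. t = cons_pos (p - 2) (1 # a))"
      using p defect_eq_1_iff[of 1 p m] by (intro paircount_cong) (subst defect_commute, auto)
    also have "\<dots> = card (comps (m - p))"
      using p by (intro paircount_graph' cons_pos_graph) auto
    finally show "paircount (m - p) (m - 1) (\<lambda>a t. defect (p # a) (1 # t) = 1) = card (comps (m - p))" .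
  qed
  also have "\<dots> = (if 2 \<le> m then 2 ^ (m - 2) else 0)" using sum_card_comps_diff[of 2 m] by auto
  finally show ?thesis .
qed

text \<open>The first part \<open>p\<close> of \<open>a\<close> is compared with \<open>x\<close>.
  If \<open>p = x\<close>, both cancel. If \<open>p < x\<close>, then \<open>p = 1\<close> and
  \<open>t\<close> determines \<open>a\<close>. If \<open>p > x\<close>, then \<open>x = 1\<close>
  and the list \<open>cons_pos (p - 2) (1 # a)\<close> has to begin with 1, which leaves
  \<open>p = 2\<close> and \<open>p = 3\<close>.\<close>

lemma markcount_pos:
  assumes x: "1 \<le> x" "x < m"
  shows "markcount m x = markcount (m - x) 0 + (if 2 \<le> x then card (comps (m - 1 - x)) else 0) +
    (if x = 1 then card (comps (m - 2)) + (if 3 \<le> m then card (comps (m - 3)) else 0) else 0)"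
proof -
  let ?G = "\<lambda>p. paircount (m - p) (m - 1 - x) (\<lambda>a t. defect (p # a) (x # 1 # t) = 1)"
  have t1: "1 # t \<in> comps (m - x)" if "t \<in> comps (m - 1 - x)" for t
    using that x by (auto simp: comps_Cons_iff)
  have "markcount m x = (\<Sum>p=1..m. ?G p)"
    unfolding markcount_def using x paircount_split_left[of m] by (simp add: cons_pos_def del: defect.simps)
  also have "\<dots> = (\<Sum>p\<in>{1..<x}. ?G p) + ?G x + (\<Sum>p=x+1..m. ?G p)"
    using x by (intro sum_split_at) simp
  also have "?G x = markcount (m - x) 0"
    unfolding markcount_def using x by (simp add: cons_pos_def diff_commute defect_same)
  also have "(\<Sum>p\<in>{1..<x}. ?G p) = (\<Sum>p\<in>{1..<x}. if p = 1 then card (comps (m - 1 - x)) else 0)"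
  proof (rule sum.cong[OF refl])
    fix p assume p: "p \<in> {1..<x}"
    have "?G p = paircount (m - p) (m - 1 - x) (\<lambda>a t. p = 1 \<and> a = cons_pos (x - 2) (1 # 1 # t))"
      using p x t1 by (intro paircount_cong defect_eq_1_iff) auto
    also have "\<dots> = (if p = 1 then card (comps (m - 1 - x)) else 0)"
    proof (cases "p = 1")
      case True
      then show ?thesis
        using paircount_graph[of "m - 1 - x" "\<lambda>t. cons_pos (x - 2) (1 # 1 # t)" "m - 1"]
          cons_pos_graph[of x m] t1 p x by simp
    qed (simp add: paircount_False)
    finally show "?G p = (if p = 1 then card (comps (m - 1 - x)) else 0)" .
  qed
  also have "\<dots> = (if 2 \<le> x then card (comps (m - 1 - x)) else 0)" by auto
  also have "(\<Sum>p=x+1..m. ?G p) =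
    (\<Sum>p=x+1..m. if x = 1 \<and> p = 2 then card (comps (m - 2)) else if x = 1 \<and> p = 3 then card (comps (m - 3)) else 0)"
  proof (rule sum.cong[OF refl])
    fix p assume p: "p \<in> {x+1..m}"
    have "?G p = paircount (m - p) (m - 1 - x) (\<lambda>a t. x = 1 \<and> 1 # t = cons_pos (p - 2) (1 # a))"
    proof (rule paircount_cong)
      fix a t assume "a \<in> comps (m - p)" "t \<in> comps (m - 1 - x)"
      then show "defect (p # a) (x # 1 # t) = 1 \<longleftrightarrow> x = 1 \<and> 1 # t = cons_pos (p - 2) (1 # a)"
        using p x t1 by (subst defect_commute, intro defect_eq_1_iff) auto
    qed
    also have "\<dots> = (if x = 1 \<and> p = 2 then card (comps (m - 2)) else if x = 1 \<and> p = 3 then card (comps (m - 3)) else 0)"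
    proof -
      consider "x \<noteq> 1" | "x = 1" "p = 2" | "x = 1" "p = 3" | "x = 1" "4 \<le> p" using p by force
      then show ?thesis
      proof cases
        case 1
        then show ?thesis by (simp add: paircount_False)
      next
        case 2
        then show ?thesis using paircount_graph'[of "m - 2" "\<lambda>a. a" "m - 2"]
          by (simp add: cons_pos_def numeral_2_eq_2)
      next
        case 3
        have "paircount (m - 3) (m - 2) (\<lambda>a t. t = 1 # a) = card (comps (m - 3))"
          by (rule paircount_graph') (use 3 p in \<open>auto simp: comps_Cons_iff\<close>)
        then show ?thesis using 3 by (simp add: cons_pos_def numeral_2_eq_2)
      next
        case 4
        then have "p - 2 \<noteq> 0" "p - 2 \<noteq> 1" "p \<noteq> 2" "p \<noteq> 3" by auto
        then have "paircount (m - p) (m - 1 - x) (\<lambda>a t. x = 1 \<and> 1 # t = cons_pos (p - 2) (1 # a))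
            = paircount (m - p) (m - 1 - x) (\<lambda>a t. False)"
          by (intro paircount_cong) (auto simp: cons_pos_def)
        then show ?thesis using \<open>p \<noteq> 2\<close> \<open>p \<noteq> 3\<close> by (simp add: paircount_False)
      qed
    qed
    finally show "?G p = (if x = 1 \<and> p = 2 then card (comps (m - 2)) else if x = 1 \<and> p = 3 then card (comps (m - 3)) else 0)" .
  qed
  also have "\<dots> = (if x = 1 then card (comps (m - 2)) + (if 3 \<le> m then card (comps (m - 3)) else 0) else 0)"
  proof (cases "x = 1")
    case True
    have "(\<Sum>p=x+1..m. if x = 1 \<and> p = 2 then card (comps (m - 2)) else if x = 1 \<and> p = 3 then card (comps (m - 3)) else 0)
      = (\<Sum>p=2..m. (if p = 2 then card (comps (m - 2)) else 0) + (if p = 3 then card (comps (m - 3)) else 0))"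
      using True by (intro sum.cong) auto
    also have "\<dots> = card (comps (m - 2)) + (if 3 \<le> m then card (comps (m - 3)) else 0)"
      unfolding sum.distrib using True x by auto
    finally show ?thesis using True by (simp only: if_True simp_thms)
  qed auto
  finally show ?thesis by simp
qed

text \<open>Counts the pairs of compositions of \<open>m + 1\<close> of defect two whose first parts
  are 1 and some \<open>q \<ge> 2\<close>, with \<open>x = q - 2\<close>.\<close>

definition marksum :: "nat \<Rightarrow> nat" where
  "marksum m = (\<Sum>x<m. markcount m x)"

lemma marksum_eq:
  assumes m: "2 \<le> m"
  shows "marksum m = (\<Sum>j=1..m. markcount j 0) + (if 3 \<le> m then 2 ^ (m - 3) else 0)
    + card (comps (m - 2)) + (if 3 \<le> m then card (comps (m - 3)) else 0)"
proof -
  have "marksum m = markcount m 0 + (\<Sum>x\<in>{1..<m}. markcount m x)"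
  proof -
    have "{..<m} = insert 0 {1..<m}" using m by auto
    then show ?thesis by (simp add: marksum_def)
  qed
  also have "(\<Sum>x\<in>{1..<m}. markcount m x) =
      (\<Sum>x\<in>{1..<m}. markcount (m - x) 0) + (\<Sum>x\<in>{1..<m}. if 2 \<le> x then card (comps (m - 1 - x)) else 0) +
      (\<Sum>x\<in>{1..<m}. if x = 1 then card (comps (m - 2)) + (if 3 \<le> m then card (comps (m - 3)) else 0) else 0)"
    unfolding sum.distrib[symmetric] by (intro sum.cong refl markcount_pos) auto
  also have "(\<Sum>x\<in>{1..<m}. markcount (m - x) 0) = (\<Sum>j\<in>{1..<m}. markcount j 0)"
    by (rule sum.reindex_bij_witness[of _ "\<lambda>j. m - j" "\<lambda>j. m - j"]) auto
  also have "(\<Sum>x\<in>{1..<m}. if 2 \<le> x then card (comps (m - 1 - x)) else 0) = (\<Sum>x=2..m - 1. card (comps (m - 1 - x)))"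
    by (rule sum.mono_neutral_cong_right) auto
  also have "\<dots> = (if 3 \<le> m then 2 ^ (m - 3) else 0)"
    using sum_card_comps_diff[of 2 "m - 1"] m by (auto simp: numeral_3_eq_3 numeral_2_eq_2)
  also have "(\<Sum>x\<in>{1..<m}. if x = 1 then card (comps (m - 2)) + (if 3 \<le> m then card (comps (m - 3)) else 0) else 0)
      = card (comps (m - 2)) + (if 3 \<le> m then card (comps (m - 3)) else 0)"
    using m by simp
  also have "markcount m 0 + ((\<Sum>j\<in>{1..<m}. markcount j 0) + (if 3 \<le> m then 2 ^ (m - 3) else 0) +
      (card (comps (m - 2)) + (if 3 \<le> m then card (comps (m - 3)) else 0))) =
      (\<Sum>j\<in>insert m {1..<m}. markcount j 0) + (if 3 \<le> m then 2 ^ (m - 3) else 0)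
    + card (comps (m - 2)) + (if 3 \<le> m then card (comps (m - 3)) else 0)"
    by simp
  also have "insert m {1..<m} = {1..m}" using m by auto
  finally show ?thesis .
qed

text \<open>With first parts \<open>p < q\<close>, the case \<open>p = 1\<close> gives
  \<open>marksum (n - 1)\<close>. For \<open>p = 2\<close> each \<open>b\<close> has exactly one
  partner, and summing over \<open>q \<ge> 3\<close> gives the power of two. For
  \<open>p \<ge> 3\<close> there is nothing. The factor 2 accounts for \<open>p > q\<close>.\<close>

lemma defcount_2_rec:
  assumes n: "0 < n"
  shows "defcount 2 n = (\<Sum>p=1..n. defcount 2 (n - p)) + 2 * (marksum (n - 1) + (if 3 \<le> n then 2 ^ (n - 3) else 0))"
proof -
  let ?G = "\<lambda>p q. paircount (n - p) (n - q) (\<lambda>a b. defect (p # a) (q # b) = 2)"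
  have G1: "?G 1 q = markcount (n - 1) (q - 2)" if q: "2 \<le> q" "q \<le> n" for q
  proof -
    have "?G 1 q = paircount (n - 1) (n - q) (\<lambda>a b. defect a (cons_pos (q - 2) (1 # b)) = 1)"
      using q defect_eq_2_iff[of 1 q n] by (intro paircount_cong) auto
    moreover have "n - 1 - 1 - (q - 2) = n - q" using q by auto
    ultimately show ?thesis unfolding markcount_def by (simp only:)
  qed
  have G2: "?G 2 q = card (comps (n - q))" if q: "3 \<le> q" "q \<le> n" for q
  proof -
    have "?G 2 q = paircount (n - 2) (n - q) (\<lambda>a b. a = (if q = 3 then 1 # b else cons_pos (q - 4) (2 # b)))"
      using q defect_eq_2_iff[of 2 q n] by (intro paircount_cong) auto
    also have "\<dots> = card (comps (n - q))"
    proof (rule paircount_graph)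
      fix b assume b: "b \<in> comps (n - q)"
      show "(if q = 3 then 1 # b else cons_pos (q - 4) (2 # b)) \<in> comps (n - 2)"
      proof (cases "q = 3")
        case False
        then have "n - 2 - (q - 4) = n - q + 2" "q - 4 \<le> n - 2" using q by auto
        then show ?thesis using False b by (simp add: cons_pos_comps comps_Cons_iff)
      qed (use q b in \<open>auto simp: comps_Cons_iff\<close>)
    qed
    finally show ?thesis .
  qed
  have G3: "?G p q = 0" if pq: "3 \<le> p" "p < q" "q \<le> n" for p q
  proof -
    have "?G p q = paircount (n - p) (n - q) (\<lambda>a b. False)"
      using pq defect_eq_2_iff[of p q n] by (intro paircount_cong) auto
    then show ?thesis by (simp add: paircount_False)
  qed
  have s1: "(\<Sum>q=2..n. ?G 1 q) = marksum (n - 1)"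
  proof -
    have "(\<Sum>q=2..n. ?G 1 q) = (\<Sum>q=2..n. markcount (n - 1) (q - 2))" using G1 by (intro sum.cong) auto
    also have "\<dots> = (\<Sum>x<n - 1. markcount (n - 1) x)"
      by (rule sum.reindex_bij_witness[of _ "\<lambda>x. x + 2" "\<lambda>q. q - 2"]) auto
    finally show ?thesis by (simp add: marksum_def)
  qed
  have s2: "(\<Sum>q=3..n. ?G 2 q) = (if 3 \<le> n then 2 ^ (n - 3) else 0)"
  proof -
    have "(\<Sum>q=3..n. ?G 2 q) = (\<Sum>q=3..n. card (comps (n - q)))" using G2 by (intro sum.cong) auto
    then show ?thesis using sum_card_comps_diff[of 3 n] by auto
  qed
  have "(\<Sum>p=1..n. \<Sum>q=p+1..n. ?G p q) = marksum (n - 1) + (if 3 \<le> n then 2 ^ (n - 3) else 0)"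
  proof (cases "2 \<le> n")
    case True
    have e: "1 + 1 = (2 :: nat)" "2 + 1 = (3 :: nat)" by simp_all
    have "(\<Sum>p=1..n. \<Sum>q=p+1..n. ?G p q) = (\<Sum>q=2..n. ?G 1 q) + ((\<Sum>q=3..n. ?G 2 q) + (\<Sum>p=3..n. \<Sum>q=p+1..n. ?G p q))"
      using sum_head[OF Suc_leI[OF n, folded One_nat_def], of "\<lambda>p. \<Sum>q=p+1..n. ?G p q"]
        sum_head2[OF True, of "\<lambda>p. \<Sum>q=p+1..n. ?G p q"]
      by (simp only: e)
    moreover have "(\<Sum>p=3..n. \<Sum>q=p+1..n. ?G p q) = 0" using G3 by (intro sum.neutral ballI) auto
    ultimately show ?thesis using s1 s2 by simp
  next
    case False
    then have "n = 1" using n by simp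
    then show ?thesis by (simp add: marksum_def)
  qed
  then show ?thesis using defcount_rec[OF n, of 2] by simp
qed

lemma markcount_0_eq: "markcount (j + 3) 0 = (j + 4) * 2 ^ j"
  "markcount 1 0 = 0" "markcount 2 0 = 1"
proof -
  have "markcount (j + 3) 0 = defcount 1 (j + 3 - 1) + 2 ^ (j + 3 - 2)" by (subst markcount_0) auto
  moreover have "j + 3 - 1 = j + 2" "j + 3 - 2 = j + 1" by auto
  ultimately show "markcount (j + 3) 0 = (j + 4) * 2 ^ j"
    by (simp only: defcount_1) (simp add: algebra_simps)
  show "markcount 1 0 = 0" using defcount_1(1) by (subst markcount_0) auto
  show "markcount 2 0 = 1" using defcount_1(2) by (subst markcount_0) auto
qed

lemma sum_markcount_0: "(\<Sum>j=1..m + 3. markcount j 0) + 1 = (m + 3) * 2 ^ (m + 1)"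
proof (induction m)
  case 0
  have "{1..3::nat} = {1, 2, 3}" by auto
  then show ?case using markcount_0_eq(1)[of 0] by (simp add: markcount_0_eq del: One_nat_def)
next
  case (Suc m)
  have "(\<Sum>j=1..Suc m + 3. markcount j 0) = (\<Sum>j=1..m + 3. markcount j 0) + markcount (Suc m + 3) 0"
    unfolding add_Suc by (rule trans[OF sum.nat_ivl_Suc' add.commute]) simp
  then have "(\<Sum>j=1..Suc m + 3. markcount j 0) + 1 = (m + 3) * 2 ^ (m + 1) + (m + 5) * 2 ^ (m + 1)"
  proof -
    have "markcount (Suc m + 3) 0 = (m + 5) * 2 ^ (m + 1)" unfolding markcount_0_eq(1) by simp
    with \<open>(\<Sum>j=1..Suc m + 3. markcount j 0) = _\<close> show ?thesis using Suc by linarith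
  qed
  then show ?case by (simp add: algebra_simps)
qed

text \<open>The closed form starts at 4: at 3 the term \<open>card (comps (m - 3))\<close> counts
  the empty composition and exceeds the continued power of two by 1/2.\<close>

lemma marksum_values: "marksum 1 = 0" "marksum 2 = 2" "marksum 3 = 8" "marksum (k + 4) + 1 = (4 * k + 21) * 2 ^ k"
proof -
  show "marksum 1 = 0" using markcount_0_eq(2) by (simp add: marksum_def)
  have "{1..2::nat} = {1, 2}" by auto
  then show "marksum 2 = 2" using marksum_eq[of 2] markcount_0_eq(2,3) by (simp add: card_comps del: One_nat_def)
  show "marksum 3 = 8" using marksum_eq[of 3] sum_markcount_0[of 0] by (simp add: card_comps)
  show "marksum (k + 4) + 1 = (4 * k + 21) * 2 ^ k"
    using marksum_eq[of "k + 4"] sum_markcount_0[of "Suc k"]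
    by (simp add: card_comps algebra_simps numeral_eq_Suc)
qed

section \<open>Closed forms for defect two\<close>

lemma defcount_2_values: "defcount 2 3 = 6" "defcount 2 4 = 26" "defcount 2 5 = 80"
proof -
  have step: "0 < n \<Longrightarrow> defcount 2 (Suc n) + 2 * (marksum (n - 1) + (if 3 \<le> n then 2 ^ (n - 3) else 0))
      = 2 * defcount 2 n + 2 * (marksum n + (if 3 \<le> Suc n then 2 ^ (Suc n - 3) else 0))" for n
    using convolution_step[OF defcount_2_rec, of n] by simp
  have d1: "defcount 2 1 = 0" using defcount_2_rec[of 1] by (simp add: defcount_0 marksum_def)
  have d2: "defcount 2 2 = 0" using step[of 1] d1 marksum_values(1) by (simp add: marksum_def numeral_2_eq_2)
  show d3: "defcount 2 3 = 6"
    using step[of 2] d2 marksum_values(1,2) by (simp add: numeral_3_eq_3 numeral_2_eq_2)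
  show d4: "defcount 2 4 = 26"
    using step[of 3] d3 marksum_values(2,3) by (simp add: numeral_eq_Suc)
  show "defcount 2 5 = 80"
    using step[of 4] d4 marksum_values(3) marksum_values(4)[of 0] by (simp add: numeral_eq_Suc)
qed

text \<open>The step from \<open>n\<close> to \<open>n + 1\<close> involves
  \<open>marksum (n - 1)\<close>, whose closed form needs \<open>n \<ge> 5\<close>; so the induction
  starts at 5, from the computed value 80.\<close>

lemma defcount_2_eq:
  "real (defcount 2 (k + 5)) = (real (k + 5) ^ 2 / 2 + 11 / 4 * real (k + 5) - 25 / 4) * 2 ^ (k + 2)"
proof (induction k)
  case 0
  then show ?case using defcount_2_values(3) by (simp add: power2_eq_square)
next
  case (Suc k)
  have "defcount 2 (Suc (k + 5)) + 2 * (marksum (k + 4) + 2 ^ (k + 2))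
      = 2 * defcount 2 (k + 5) + 2 * (marksum (k + 5) + 2 ^ (k + 3))"
    using convolution_step[OF defcount_2_rec, of "k + 5"] by (simp add: numeral_eq_Suc)
  then have "real (defcount 2 (Suc (k + 5))) + 2 * (real (marksum (k + 4)) + 2 ^ (k + 2))
      = 2 * real (defcount 2 (k + 5)) + 2 * (real (marksum (k + 5)) + 2 ^ (k + 3))"
    by (metis (mono_tags, opaque_lifting) of_nat_add of_nat_mult of_nat_numeral of_nat_power)
  moreover have "real (marksum (k + 4)) + 1 = (4 * real k + 21) * 2 ^ k"
    using arg_cong[OF marksum_values(4)[of k], of real] by simp
  moreover have "real (marksum (k + 5)) + 1 = (4 * real k + 25) * 2 ^ (k + 1)"
    using arg_cong[OF marksum_values(4)[of "Suc k"], of real] by (simp add: numeral_eq_Suc algebra_simps)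
  ultimately have "real (defcount 2 (Suc (k + 5))) = 2 * real (defcount 2 (k + 5)) + (4 * real k + 33) * 2 ^ (k + 1)"
    by (simp add: algebra_simps power_add)
  then show ?case unfolding Suc.IH by (simp add: power2_eq_square power_add field_simps)
qed

text \<open>\<open>lie_index_seaweed\<close> makes the index \<open>n - 1\<close> minus the defect,
  so index \<open>n - 3\<close> means defect 2.\<close>

lemma C_eq_defcount:
  assumes n: "3 \<le> n" shows "C n (int n - 3) = defcount 2 n"
proof -
  have "int (lie_index n (seaweed n a b)) = int n - 3 \<longleftrightarrow> defect a b = 2"
    if "is_composition n a" "is_composition n b" for a b
    using lie_index_seaweed[OF that] n by linarith
  then show ?thesis
    unfolding C_def defcount_def paircount_def comps_def
    by (intro arg_cong[of _ _ card]) auto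
qed

theorem mainTheorem7:
  fixes n :: nat
  assumes "n \<ge> 3"
  shows "(n \<le> 5 \<longrightarrow>
            real (C n (int n - 3)) = (7 * real n - 15) * 2 ^ (n - 3)) \<and>
         (5 \<le> n \<longrightarrow>
            real (C n (int n - 3)) =
              (real n ^ 2 / 2 + 11 / 4 * real n - 25 / 4) * 2 ^ (n - 3))"
proof (intro conjI impI)
  assume "n \<le> 5"
  \<comment> \<open>The linear formula is checked at its three arguments, with values 6, 26 and
    80.\<close>
  then consider "n = 3" | "n = 4" | "n = 5" using assms by linarith
  then show "real (C n (int n - 3)) = (7 * real n - 15) * 2 ^ (n - 3)"
    unfolding C_eq_defcount[OF assms] by cases (simp_all add: defcount_2_values)
next
  assume "5 \<le> n"
  then obtain k where "n = k + 5" by (metis add.commute le_Suc_ex)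
  then show "real (C n (int n - 3)) = (real n ^ 2 / 2 + 11 / 4 * real n - 25 / 4) * 2 ^ (n - 3)"
    unfolding C_eq_defcount[OF assms] using defcount_2_eq[of k] by simp
qed

end
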